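(* Consider the catalytic branching random walk on $\mathbb{Z}$ branching at the origin only, started from one particle at the origin, with offspring variable $N$ of finite mean $m$ and underlying irreducible random walk $(S_n)_{n\ge 0}$. Assume $m(1-q_{esc})>1$ and let $r>0$ be the unique solution of $m\,\mathbb{E}[e^{-r\tau}]=1$. Let $\psi(t)=\log \mathbb{E}[e^{tS_1}]$ and $\zeta=\sup\{t>0:\psi(t)<\infty\}$, and assume that $\zeta>0$ and that there exists $t_0\in(0,\zeta)$ with $\psi(t_0)=r$. Let $M_n$ be the maximal position of the particles alive at time $n$, and let $\mathcal{S}$ be the event that the origin is visited by particles at infinitely many times. Then, almost surely on the event $\mathcal{S}$, $$\lim_{n\to+\infty}\frac{M_n}{n}=\alpha:=\frac{\psi(t_0)}{t_0}.$$
   Context: Underlying walk: $(S_n)_{n\ge0}$ is an irreducible random walk on $\mathbb{Z}$ (partial sums of i.i.d. integer-valued steps); $\mathbb{P}_x$ is the law when started from $x$, $\mathbb{P}=\mathbb{P}_0$, and $\mathbb{E}$ is the expectation under $\mathbb{P}$. Periodicity of $S$ is allowed. $\tau:=\inf\{n\ge1:S_n=0\}$ (with $\inf\emptyset=+\infty$) is the first return time to $0$, and $q_{esc}:=\mathbb{P}(\tau=+\infty)\in[0,1)$. Convention: $e^{-r\tau}=0$ if $\tau=+\infty$. Catalytic branching random walk (CBRW): $N$ is a random variable with values in $\{0,1,2,\dots\}$ and finite mean $m=\mathbb{E}[N]$. The system starts at time $0$ with one particle at $0$. A particle located at $x\ne0$ moves according to the transition probabilities of $S$, independently of the others. A particle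 located at $0$ at time $t$ dies at time $t+1$ and gives birth to new particles located at $S^{(1)}_1,\dots,S^{(N)}_1$, where the $(S^{(i)}_n)_{n\ge0}$, $i\ge1$, are i.i.d. copies of $(S_n)_{n\ge0}$ started from $0$, independent of $N$; different particles at the origin reproduce independently of each other and of the rest of the system up to time $t$. $\{X_u:|u|=n\}$ denotes the positions of the particles alive at time $n$ (where $|u|=n$ means that $u$ has generation $n$ in the Ulam-Harris tree). $M_n:=\sup_{|u|=n}X_u$, with $\sup\emptyset:=-\infty$. $\mathcal{S}$ is the event that, for infinitely many $n$, there is a particle $u$ with $|u|=n$ and $X_u=0$. *)

theory Defs
  imports "HOL-Probability.Probability"
begin

section \<open>The underlying random walk\<close>

text \<open>The step law is a probability mass function \<open>p\<close> on the integers. The i.i.d. steps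
  \<open>\<xi> 0, \<xi> 1, \<dots>\<close> live on the product space \<open>steps p\<close>, so that the law of the walk
  started from \<open>x\<close> is the image of \<open>steps p\<close> under \<open>walk x\<close>.\<close>

definition steps :: "int pmf \<Rightarrow> (nat \<Rightarrow> int) measure" where
  "steps p = PiM UNIV (\<lambda>_. measure_pmf p)"

definition walk :: "int \<Rightarrow> (nat \<Rightarrow> int) \<Rightarrow> nat \<Rightarrow> int" where
  "walk x \<xi> n = x + (\<Sum>k<n. \<xi> k)"

definition irreducible_walk :: "int pmf \<Rightarrow> bool" where
  "irreducible_walk p \<longleftrightarrow>
     (\<forall>x y. \<exists>n. measure (steps p) {\<xi> \<in> space (steps p). walk x \<xi> n = y} > 0)"

text \<open>In \<open>enat\<close> the infimum of the empty set is \<open>\<infinity>\<close>.\<close>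

definition return_time :: "(nat \<Rightarrow> int) \<Rightarrow> enat" where
  "return_time s = Inf {enat n |n. n \<ge> 1 \<and> s n = 0}"

definition q_esc :: "int pmf \<Rightarrow> real" where
  "q_esc p = measure (steps p) {\<xi> \<in> space (steps p). return_time (walk 0 \<xi>) = \<infinity>}"

definition exp_discount :: "real \<Rightarrow> enat \<Rightarrow> real" where
  "exp_discount r t = (case t of enat n \<Rightarrow> exp (- r * real n) | \<infinity> \<Rightarrow> 0)"

definition return_laplace :: "int pmf \<Rightarrow> real \<Rightarrow> real" where
  "return_laplace p r = (\<integral>\<xi>. exp_discount r (return_time (walk 0 \<xi>)) \<partial>steps p)"

text \<open>The log-Laplace transform takes the value \<open>\<infinity>\<close> when the exponential moment is
  infinite; the moment itself is never zero.\<close>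

definition exp_moment :: "int pmf \<Rightarrow> real \<Rightarrow> ennreal" where
  "exp_moment p t = (\<integral>\<^sup>+\<xi>. ennreal (exp (t * real_of_int (walk 0 \<xi> 1))) \<partial>steps p)"

definition psi :: "int pmf \<Rightarrow> real \<Rightarrow> ereal" where
  "psi p t = (if exp_moment p t = \<infinity> then \<infinity> else ereal (ln (enn2real (exp_moment p t))))"

text \<open>The supremum is taken in \<open>ereal\<close>: it may be \<open>\<infinity>\<close>, and it is \<open>-\<infinity>\<close> when there is no such
  \<open>t\<close>.\<close>

definition zeta :: "int pmf \<Rightarrow> ereal" where
  "zeta p = Sup {ereal t |t. t > 0 \<and> psi p t < \<infinity>}"


section \<open>The catalytic branching random walk\<close>

text \<open>Particles carry Ulam-Harris labels, written with the youngest generation first: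
  \<open>i # v\<close> is the \<open>i\<close>-th child of \<open>v\<close> (counting from \<open>0\<close>), and the generation of \<open>u\<close> is
  \<open>length u\<close>. The process is driven by a number \<open>K u\<close> and a displacement \<open>\<xi> u\<close> for each label:
  \<open>K u\<close> is the number of children of \<open>u\<close> if \<open>u\<close> sits at the origin, and it is ignored
  otherwise; \<open>\<xi> u\<close> is the displacement of \<open>u\<close> from the position of its parent (\<open>\<xi> []\<close> is not
  used). A particle away from the origin makes one step of the walk, which is encoded as
  having the single child \<open>0 # v\<close>.\<close>

primrec position :: "(nat list \<Rightarrow> int) \<Rightarrow> nat list \<Rightarrow> int" where
  "position \<xi> [] = 0"
| "position \<xi> (i # v) = position \<xi> v + \<xi> (i # v)"

primrec alive :: "(nat list \<Rightarrow> nat) \<Rightarrow> (nat list \<Rightarrow> int) \<Rightarrow> nat list \<Rightarrow> bool" where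
  "alive K \<xi> [] = True"
| "alive K \<xi> (i # v) =
     (alive K \<xi> v \<and> (if position \<xi> v = 0 then i < K v else i = 0))"

definition particles :: "(nat list \<Rightarrow> nat) \<Rightarrow> (nat list \<Rightarrow> int) \<Rightarrow> nat \<Rightarrow> nat list set" where
  "particles K \<xi> n = {u. length u = n \<and> alive K \<xi> u}"

text \<open>In \<open>ereal\<close> the supremum of the empty set is \<open>-\<infinity>\<close>.\<close>

definition max_position :: "(nat list \<Rightarrow> nat) \<Rightarrow> (nat list \<Rightarrow> int) \<Rightarrow> nat \<Rightarrow> ereal" where
  "max_position K \<xi> n = (SUP u\<in>particles K \<xi> n. ereal (real_of_int (position \<xi> u)))"

definition origin_recurrent :: "(nat list \<Rightarrow> nat) \<Rightarrow> (nat list \<Rightarrow> int) \<Rightarrow> bool" where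
  "origin_recurrent K \<xi> \<longleftrightarrow> (\<exists>\<^sub>\<infinity>n. \<exists>u\<in>particles K \<xi> n. position \<xi> u = 0)"

text \<open>All the variables \<open>K u\<close> (of law \<open>\<nu>\<close>) and \<open>\<xi> u\<close> (of law \<open>p\<close>) are jointly independent:
  the pairs are independent over \<open>u\<close>, and the law of each pair is a product.\<close>

locale cbrw = prob_space M
  for M :: "'w measure" and p :: "int pmf" and \<nu> :: "nat pmf"
    and K :: "nat list \<Rightarrow> 'w \<Rightarrow> nat" and \<xi> :: "nat list \<Rightarrow> 'w \<Rightarrow> int" +
  assumes indep: "indep_vars (\<lambda>_. count_space UNIV) (\<lambda>u \<omega>. (K u \<omega>, \<xi> u \<omega>)) UNIV"
    and law: "\<And>u. distr M (count_space UNIV) (\<lambda>\<omega>. (K u \<omega>, \<xi> u \<omega>)) = measure_pmf (pair_pmf \<nu> p)"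

end

theory Submission
  imports Defs "HOL-Real_Asymp.Real_Asymp"
begin

text \<open>
  Rearranging the given variables, with the displacement of a particle stored at its parent, turns the
  process into a function of one family of independent coordinates (\<open>env\<close>). The
  particles of one generation that sit at the origin are then the roots of independent copies of the process
  (\<open>branching\<close>), and the expected sum of a function \<open>f\<close> over generation \<open>n\<close> is \<open>(mean_op ^^ n) f 0\<close>
  for the operator \<open>mean_op\<close> that averages over one step and multiplies by \<open>m\<close> at the origin
  (\<open>many_to_one\<close>). Let \<open>\<alpha> = r / t\<^sub>0\<close>.

  Upper bound. Let \<open>H(x)\<close> be the expectation of \<open>e\<close> to the power \<open>- r \<sigma>\<close>, where \<open>\<sigma>\<close> is the hitting time of the
  origin by the walk started at \<open>x\<close>. The equation for \<open>r\<close> says that \<open>H\<close> is an eigenfunction of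
  \<open>mean_op\<close> with eigenvalue \<open>exp r\<close>. By the choice of \<open>t\<^sub>0\<close> the function \<open>exp (t\<^sub>0 * x)\<close> satisfies the same equation off the
  origin, and at the origin its defect is absorbed by a large multiple of \<open>H\<close> at the price of replacing \<open>r\<close> by
  \<open>r + \<epsilon>\<close> (\<open>mean_op_lyapunov\<close>). Hence the expected sum of \<open>exp (t\<^sub>0 * x)\<close> over generation \<open>n\<close> is
  at most a constant times \<open>exp ((r + \<epsilon>) * n)\<close>, and Markov's inequality and Borel-Cantelli exclude every speed above
  \<open>\<alpha>\<close> (\<open>AE_speed_le\<close>).

  Lower bound. The equation for \<open>r\<close> makes the discounted expected number of visits to the origin infinite
  (\<open>green_infinite\<close>), so for some \<open>n\<close> the mean number of particles at the origin at time \<open>n\<close>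
  exceeds \<open>exp ((r - \<epsilon>) * n)\<close> (\<open>ex_supercritical_block\<close>). Looking at the process at multiples of \<open>n\<close>, and
  at finitely many labels per block, one finds a supercritical Galton-Watson process with
  bounded offspring, which grows at rate \<open>r - \<epsilon>\<close> per unit of time with positive probability (\<open>growth_positive\<close>).
  For \<open>x < \<alpha>\<close>, the particles that are at the origin shortly before time \<open>T - k\<close> are used for attempts to
  be beyond \<open>x * T\<close> at time \<open>T\<close>. Under the step law tilted by \<open>t\<^sub>0\<close> the walk has a drift \<open>v \<ge> \<alpha>\<close>
  (\<open>drift_ge\<close>), and undoing the tilt shows that the walk moves at speed \<open>v\<close> during \<open>k\<close> steps with probability about
  \<open>exp (- (t\<^sub>0 * v - r) * k)\<close> (\<open>large_deviation_lower\<close>); a last exit decomposition shows that it can be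
  required to stay positive, so that branching does not interfere (\<open>last_exit_decomposition\<close>). With \<open>k = x * T / v\<close>
  the number of attempts times the probability of success is of order
  \<open>exp (r * (T - k) - (t\<^sub>0 * v - r) * k) = exp ((r - t\<^sub>0 * x) * T)\<close>, and \<open>r - t\<^sub>0 * x\<close> is positive. Therefore the speed
  is at least \<open>x\<close> with positive probability (\<open>fast_positive\<close>).

  Finally, a speed of at least \<open>x\<close> of the descendants of any particle at the origin is inherited by the whole
  process, and each visit of the origin gives a new independent chance for it. Since the event of
  infinitely many visits can be approximated by events that concern finitely many generations, the speed is at least
  \<open>x\<close> almost surely on it (\<open>recurrent_zero_one\<close>).
\<close>

section \<open>The process as a function of independent coordinates\<close>

text \<open>All the randomness is collected in one family of independent integers, indexed by pairs of a
  label and a natural number: the coordinate \<open>(v, 0)\<close> is the number of children that \<open>v\<close> has if it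
  sits at the origin, and \<open>(v, Suc i)\<close> is the displacement of the \<open>i\<close>-th child of \<open>v\<close>. With the
  displacements stored at the parent, the descendants of \<open>v\<close>, seen relative to \<open>v\<close>, depend only on
  the coordinates at labels \<open>w @ v\<close>, and the position and survival of \<open>v\<close> only on those at strictly
  shorter labels.\<close>

locale catalytic_laws =
  fixes p :: "int pmf" and \<nu> :: "nat pmf"
begin

definition coord_law :: "nat list \<times> nat \<Rightarrow> int pmf" where
  "coord_law j = (if snd j = 0 then map_pmf int \<nu> else p)"

definition env :: "(nat list \<times> nat \<Rightarrow> int) measure" where
  "env = PiM UNIV (\<lambda>j. measure_pmf (coord_law j))"

end

definition offspring :: "(nat list \<times> nat \<Rightarrow> int) \<Rightarrow> nat list \<Rightarrow> nat" where
  "offspring \<omega> u = nat (\<omega> (u, 0))"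

definition displacement :: "(nat list \<times> nat \<Rightarrow> int) \<Rightarrow> nat list \<Rightarrow> int" where
  "displacement \<omega> u = (case u of [] \<Rightarrow> 0 | i # v \<Rightarrow> \<omega> (v, Suc i))"

abbreviation lives :: "(nat list \<times> nat \<Rightarrow> int) \<Rightarrow> nat list \<Rightarrow> bool" where
  "lives \<omega> \<equiv> alive (offspring \<omega>) (displacement \<omega>)"

abbreviation pos :: "(nat list \<times> nat \<Rightarrow> int) \<Rightarrow> nat list \<Rightarrow> int" where
  "pos \<omega> \<equiv> position (displacement \<omega>)"

definition subtree :: "nat list \<Rightarrow> (nat list \<times> nat \<Rightarrow> int) \<Rightarrow> (nat list \<times> nat \<Rightarrow> int)" where
  "subtree v \<omega> = (\<lambda>(w, i). \<omega> (w @ v, i))"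

definition reaches :: "nat \<Rightarrow> real \<Rightarrow> (nat list \<times> nat \<Rightarrow> int) \<Rightarrow> bool" where
  "reaches n b \<omega> \<longleftrightarrow> (\<exists>u. length u = n \<and> lives \<omega> u \<and> b \<le> real_of_int (pos \<omega> u))"

lemma displacement_Cons [simp]: "displacement \<omega> (i # v) = \<omega> (v, Suc i)"
  by (simp add: displacement_def)

lemma pos_append: "pos \<omega> (w @ v) = pos \<omega> v + pos (subtree v \<omega>) w"
  by (induction w) (auto simp: subtree_def)

text \<open>The reproduction rule looks at absolute positions, so a subtree is a copy of the whole process
  only when its root sits at the origin.\<close>

lemma lives_append:
  assumes "pos \<omega> v = 0"
  shows "lives \<omega> (w @ v) \<longleftrightarrow> lives \<omega> v \<and> lives (subtree v \<omega>) w"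
  using assms
  by (induction w) (auto simp: pos_append subtree_def offspring_def)

lemma pos_lives_cong:
  assumes "\<And>v i. length v < length u \<Longrightarrow> \<omega> (v, i) = \<omega>' (v, i)"
  shows "pos \<omega> u = pos \<omega>' u" "lives \<omega> u \<longleftrightarrow> lives \<omega>' u"
  using assms by (induction u) (auto simp: offspring_def)

context catalytic_laws
begin

lemma space_env [simp]: "space env = UNIV"
  by (simp add: env_def space_PiM)

lemma prob_space_env: "prob_space env"
  unfolding env_def by (intro prob_space_PiM) (rule measure_pmf.prob_space_axioms)

sublocale env: prob_space env
  by (rule prob_space_env)

lemma measurable_coord [measurable]: "(\<lambda>\<omega>. \<omega> j) \<in> env \<rightarrow>\<^sub>M count_space UNIV"
proof -
  have "(\<lambda>\<omega>. \<omega> j) \<in> env \<rightarrow>\<^sub>M measure_pmf (coord_law j)"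
    unfolding env_def by (rule measurable_component_singleton) simp
  then show ?thesis
    by (simp cong: measurable_cong_sets)
qed

lemma measurable_offspring [measurable]: "(\<lambda>\<omega>. offspring \<omega> u) \<in> env \<rightarrow>\<^sub>M count_space UNIV"
  unfolding offspring_def by measurable

lemma measurable_pos [measurable]: "(\<lambda>\<omega>. pos \<omega> u) \<in> env \<rightarrow>\<^sub>M count_space UNIV"
  by (induction u) simp_all

lemma measurable_lives [measurable]: "Measurable.pred env (\<lambda>\<omega>. lives \<omega> u)"
  by (induction u) simp_all

lemma measurable_pos_ge: "Measurable.pred env (\<lambda>\<omega>. b \<le> real_of_int (pos \<omega> u))"
  by (rule measurable_compose[OF measurable_pos]) simp

lemma measurable_reaches [measurable]: "Measurable.pred env (reaches n b)"
  unfolding reaches_def[abs_def]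
  by (intro pred_intros_logic pred_intros_countable measurable_lives measurable_pos_ge) simp_all

lemma sets_reaches [measurable]: "{\<omega>. reaches n b \<omega>} \<in> sets env"
  using measurable_reaches[of n b] by (simp add: pred_def)

lemma measurable_upd [measurable]:
  "(\<lambda>(x, \<omega>). (\<omega> (j := x))) \<in> measure_pmf (coord_law j) \<Otimes>\<^sub>M env \<rightarrow>\<^sub>M env"
  unfolding env_def
  unfolding split_beta' by (rule measurable_fun_upd[where J = UNIV]) simp_all

text \<open>The coordinates are independent, so replacing one of them by a fresh copy does not change the
  law. This is how all one-step expectations below are taken: whatever depends on shorter labels is
  not affected by the replacement.\<close>

lemma resample:
  assumes [measurable]: "f \<in> borel_measurable env"
  shows "(\<integral>\<^sup>+\<omega>. f \<omega> \<partial>env) = (\<integral>\<^sup>+\<omega>. (\<integral>\<^sup>+x. f (\<omega> (j := x)) \<partial>measure_pmf (coord_law j)) \<partial>env)"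
proof -
  interpret pair_sigma_finite "measure_pmf (coord_law j)" env
    by unfold_locales
  have "env = distr (measure_pmf (coord_law j) \<Otimes>\<^sub>M env) env (\<lambda>(x, \<omega>). (\<omega> (j := x)))"
    using distr_pair_PiM_eq_PiM[of UNIV "\<lambda>j. measure_pmf (coord_law j)" j]
    by (simp add: env_def measure_pmf.prob_space_axioms)
  then have "(\<integral>\<^sup>+\<omega>. f \<omega> \<partial>env)
      = (\<integral>\<^sup>+\<omega>. f \<omega> \<partial>distr (measure_pmf (coord_law j) \<Otimes>\<^sub>M env) env (\<lambda>(x, \<omega>). (\<omega> (j := x))))"
    by simp
  also have "\<dots> = (\<integral>\<^sup>+z. f ((snd z)(j := fst z)) \<partial>(measure_pmf (coord_law j) \<Otimes>\<^sub>M env))"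
    by (subst nn_integral_distr) (simp_all add: case_prod_beta)
  also have "\<dots> = (\<integral>\<^sup>+\<omega>. (\<integral>\<^sup>+x. f (\<omega> (j := x)) \<partial>measure_pmf (coord_law j)) \<partial>env)"
    by (subst nn_integral_snd[symmetric]) (simp_all add: case_prod_beta)
  finally show ?thesis .
qed

section \<open>The mean of a generation\<close>

definition shift_mean :: "(int \<Rightarrow> ennreal) \<Rightarrow> int \<Rightarrow> ennreal" where
  "shift_mean f x = (\<integral>\<^sup>+y. f (x + y) \<partial>measure_pmf p)"

definition mean_children :: ennreal where
  "mean_children = (\<integral>\<^sup>+k. of_nat k \<partial>measure_pmf \<nu>)"

text \<open>One step of the process in mean: the expected sum of \<open>f\<close> over the children of a particle at \<open>x\<close>.\<close>

definition mean_op :: "(int \<Rightarrow> ennreal) \<Rightarrow> int \<Rightarrow> ennreal" where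
  "mean_op f x = (if x = 0 then mean_children * shift_mean f 0 else shift_mean f x)"

lemma pos_upd: "length u \<le> length v \<Longrightarrow> pos (\<omega> ((v, i) := x)) u = pos \<omega> u"
  by (intro pos_lives_cong) auto

lemma lives_upd: "length u \<le> length v \<Longrightarrow> lives (\<omega> ((v, i) := x)) u = lives \<omega> u"
  by (intro pos_lives_cong) auto

lemma offspring_upd: "offspring (\<omega> ((v, Suc i) := x)) u = offspring \<omega> u"
  by (simp add: offspring_def)

lemma nn_integral_displacement:
  assumes [measurable]: "g \<in> borel_measurable env"
    and g: "\<And>\<omega> x. g (\<omega> ((v, Suc i) := x)) = g \<omega>"
  shows "(\<integral>\<^sup>+\<omega>. g \<omega> * f (pos \<omega> (i # v)) \<partial>env) = (\<integral>\<^sup>+\<omega>. g \<omega> * shift_mean f (pos \<omega> v) \<partial>env)"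
proof -
  have [measurable]: "(\<lambda>\<omega>. f (pos \<omega> v + \<omega> (v, Suc i))) \<in> borel_measurable env"
    by (rule measurable_compose[where N = "count_space UNIV" and g = f]) simp_all
  show ?thesis
    by (subst resample[of _ "(v, Suc i)"])
       (simp_all add: g pos_upd nn_integral_cmult shift_mean_def coord_law_def)
qed

definition expected_alive :: "(int \<Rightarrow> ennreal) \<Rightarrow> nat list \<Rightarrow> ennreal" where
  "expected_alive f u = (\<integral>\<^sup>+\<omega>. indicator {\<omega>. lives \<omega> u} \<omega> * f (pos \<omega> u) \<partial>env)"

lemma sum_indicator_less: "(\<Sum>i. indicator {i. i < k} i :: ennreal) = of_nat k"
  by (subst suminf_finite[of "{..<k}"]) (auto simp: indicator_def)

lemma nn_integral_coord_offspring:
  "(\<integral>\<^sup>+x. of_nat (nat x) \<partial>measure_pmf (coord_law (v, 0))) = mean_children"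
  by (simp add: coord_law_def mean_children_def)

text \<open>The number of children and the displacement of a given child are resampled in turn. The former
  produces the factor \<open>mean_children\<close> at the origin, the latter the average over a step.\<close>

lemma expected_alive_children:
  "(\<Sum>i. expected_alive f (i # v)) = expected_alive (mean_op f) v"
proof -
  have [measurable]: "(\<lambda>\<omega>. f' (pos \<omega> u)) \<in> borel_measurable env" for u and f' :: "int \<Rightarrow> ennreal"
    by (rule measurable_compose[where N = "count_space UNIV" and g = f']) simp_all
  define a where "a i \<omega> = (indicator {\<omega>. lives \<omega> (i # v)} \<omega> :: ennreal)" for i \<omega>
  have a_eq: "a i \<omega> = (if lives \<omega> v then (if pos \<omega> v = 0 then indicator {i. i < offspring \<omega> v} i
       else indicator {0} i) else 0)" for i \<omega>
    by (auto simp: a_def indicator_def)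
  have [measurable]: "a i \<in> borel_measurable env" for i
    unfolding a_def by measurable
  have *: "expected_alive f (i # v) = (\<integral>\<^sup>+\<omega>. a i \<omega> * shift_mean f (pos \<omega> v) \<partial>env)" for i
    unfolding expected_alive_def a_def[symmetric]
    by (rule nn_integral_displacement) (auto simp: a_eq pos_upd lives_upd offspring_upd)
  have "(\<Sum>i. expected_alive f (i # v)) = (\<integral>\<^sup>+\<omega>. (\<Sum>i. a i \<omega>) * shift_mean f (pos \<omega> v) \<partial>env)"
    unfolding * by (subst nn_integral_suminf[symmetric]) simp_all
  also have "\<dots> = (\<integral>\<^sup>+\<omega>. indicator {\<omega>. lives \<omega> v} \<omega> * (if pos \<omega> v = 0 then of_nat (offspring \<omega> v) else 1)
       * shift_mean f (pos \<omega> v) \<partial>env)"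
  proof (rule nn_integral_cong)
    fix \<omega>
    have "(\<Sum>i. indicator {0} i :: ennreal) = 1"
      by (subst suminf_finite[of "{0}"]) auto
    then have "(\<Sum>i. a i \<omega>) = indicator {\<omega>. lives \<omega> v} \<omega> * (if pos \<omega> v = 0 then of_nat (offspring \<omega> v) else 1)"
      by (cases "lives \<omega> v"; cases "pos \<omega> v = 0") (simp_all add: a_eq sum_indicator_less)
    then show "(\<Sum>i. a i \<omega>) * shift_mean f (pos \<omega> v) = indicator {\<omega>. lives \<omega> v} \<omega> *
        (if pos \<omega> v = 0 then of_nat (offspring \<omega> v) else 1) * shift_mean f (pos \<omega> v)"
      by simp
  qed
  also have "\<dots> = (\<integral>\<^sup>+\<omega>. indicator {\<omega>. lives \<omega> v} \<omega> * (if pos \<omega> v = 0 then mean_children else 1)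
       * shift_mean f (pos \<omega> v) \<partial>env)"
  proof (subst resample[of _ "(v, 0)"], measurable, rule nn_integral_cong)
    fix \<omega>
    show "(\<integral>\<^sup>+x. indicator {\<omega>. lives \<omega> v} (\<omega> ((v, 0) := x)) *
        (if pos (\<omega> ((v, 0) := x)) v = 0 then of_nat (offspring (\<omega> ((v, 0) := x)) v) else 1) *
        shift_mean f (pos (\<omega> ((v, 0) := x)) v) \<partial>measure_pmf (coord_law (v, 0)))
      = indicator {\<omega>. lives \<omega> v} \<omega> * (if pos \<omega> v = 0 then mean_children else 1) * shift_mean f (pos \<omega> v)"
      by (cases "pos \<omega> v = 0")
         (simp_all add: pos_upd lives_upd offspring_def indicator_def nn_integral_multc
           nn_integral_coord_offspring)
  qed
  also have "\<dots> = expected_alive (mean_op f) v"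
    unfolding expected_alive_def by (intro nn_integral_cong) (auto simp: mean_op_def mult.assoc)
  finally show ?thesis .
qed

end

text \<open>The sum over all labels of length \<open>n\<close>, organised as an iterated sum so that inductions over the
  generations reduce to the recursion.\<close>

primrec generation_sum :: "nat \<Rightarrow> (nat list \<Rightarrow> ennreal) \<Rightarrow> ennreal" where
  "generation_sum 0 g = g []"
| "generation_sum (Suc n) g = generation_sum n (\<lambda>v. \<Sum>i. g (i # v))"

lemma generation_sum_mono:
  "(\<And>u. length u = n \<Longrightarrow> g u \<le> h u) \<Longrightarrow> generation_sum n g \<le> generation_sum n h"
proof (induction n arbitrary: g h)
  case (Suc n)
  show ?case
    unfolding generation_sum.simps by (intro Suc.IH suminf_le) (auto intro: Suc.prems)
qed simp

lemma generation_sum_cmult: "generation_sum n (\<lambda>u. c * g u) = c * generation_sum n g"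
  by (induction n arbitrary: g) (auto simp: ennreal_suminf_cmult)

lemma emeasure_generation_le:
  assumes "\<And>u. A u \<in> sets N"
  shows "emeasure N (\<Union>u\<in>{u. length u = n}. A u) \<le> generation_sum n (\<lambda>u. emeasure N (A u))"
  using assms
proof (induction n arbitrary: A)
  case (Suc n)
  have "(\<Union>u\<in>{u. length u = Suc n}. A u) = (\<Union>v\<in>{v. length v = n}. \<Union>i. A (i # v))"
    by (force simp: length_Suc_conv)
  then have "emeasure N (\<Union>u\<in>{u. length u = Suc n}. A u)
      \<le> generation_sum n (\<lambda>v. emeasure N (\<Union>i. A (i # v)))"
    using Suc.IH[of "\<lambda>v. \<Union>i. A (i # v)"] Suc.prems by auto
  also have "\<dots> \<le> generation_sum n (\<lambda>v. \<Sum>i. emeasure N (A (i # v)))"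
    using Suc.prems by (intro generation_sum_mono emeasure_subadditive_countably) auto
  finally show ?case by simp
qed simp

text \<open>Finitely many labels carry as much of the sum as desired. Restricting to such a set of labels
  will give bounded offspring numbers.\<close>

lemma generation_sum_finite_approx:
  assumes "c < generation_sum n g"
  shows "\<exists>\<Lambda>. finite \<Lambda> \<and> \<Lambda> \<subseteq> {u. length u = n} \<and> c < (\<Sum>u\<in>\<Lambda>. g u)"
  using assms
proof (induction n arbitrary: g)
  case 0
  then show ?case by (intro exI[of _ "{[]}"]) auto
next
  case (Suc n)
  then obtain \<Lambda> where \<Lambda>: "finite \<Lambda>" "\<Lambda> \<subseteq> {u. length u = n}" "c < (\<Sum>v\<in>\<Lambda>. \<Sum>i. g (i # v))"
    by (metis (no_types, lifting) generation_sum.simps(2))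
  have "(\<Sum>v\<in>\<Lambda>. \<Sum>i. g (i # v)) = (\<Sum>i. \<Sum>v\<in>\<Lambda>. g (i # v))"
    by (rule suminf_sum[symmetric]) simp
  then obtain B where B: "c < (\<Sum>i<B. \<Sum>v\<in>\<Lambda>. g (i # v))"
    using \<Lambda>(3) by (auto simp: suminf_eq_SUP less_SUP_iff)
  have "(\<Sum>i<B. \<Sum>v\<in>\<Lambda>. g (i # v)) = (\<Sum>(i, v)\<in>{..<B} \<times> \<Lambda>. g (i # v))"
    by (simp add: sum.cartesian_product)
  also have "\<dots> = (\<Sum>u\<in>(\<lambda>(i, v). i # v) ` ({..<B} \<times> \<Lambda>). g u)"
    by (subst sum.reindex) (auto simp: inj_on_def case_prod_beta)
  finally show ?case
    using B \<Lambda> by (intro exI[of _ "(\<lambda>(i, v). i # v) ` ({..<B} \<times> \<Lambda>)"]) auto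
qed

context catalytic_laws
begin

text \<open>The expected sum of \<open>f\<close> over the particles of generation \<open>n\<close> is the \<open>n\<close>-th power of the mean
  operator: the branching process is replaced by a single operator on functions on the integers.\<close>

lemma many_to_one: "generation_sum n (expected_alive f) = (mean_op ^^ n) f 0"
proof (induction n arbitrary: f)
  case 0
  then show ?case by (simp add: expected_alive_def env.emeasure_space_1[simplified])
next
  case (Suc n)
  then show ?case by (simp add: expected_alive_children funpow_swap1 del: funpow.simps(2))
     (simp add: funpow_swap1)
qed

end

section \<open>Independence of subtrees\<close>

text \<open>The coordinates at labels of length below \<open>l\<close> determine which particles of generation \<open>l\<close> are
  alive and where they are, so these events form the past of generation \<open>l\<close>.\<close>

definition depends_below :: "nat \<Rightarrow> (nat list \<times> nat \<Rightarrow> int) set \<Rightarrow> bool" where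
  "depends_below l E \<longleftrightarrow>
     (\<forall>\<omega> \<omega>'. (\<forall>v i. length v < l \<longrightarrow> \<omega> (v, i) = \<omega>' (v, i)) \<longrightarrow> (\<omega> \<in> E \<longleftrightarrow> \<omega>' \<in> E))"

lemma depends_belowI:
  assumes "\<And>\<omega> \<omega>'. (\<And>v i. length v < l \<Longrightarrow> \<omega> (v, i) = \<omega>' (v, i)) \<Longrightarrow> \<omega> \<in> E \<Longrightarrow> \<omega>' \<in> E"
  shows "depends_below l E"
  unfolding depends_below_def
proof (intro allI impI iffI)
  fix \<omega> \<omega>' :: "nat list \<times> nat \<Rightarrow> int"
  assume *: "\<forall>v i. length v < l \<longrightarrow> \<omega> (v, i) = \<omega>' (v, i)"
  then show "\<omega> \<in> E \<Longrightarrow> \<omega>' \<in> E" using assms[of \<omega> \<omega>'] by blast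
  show "\<omega>' \<in> E \<Longrightarrow> \<omega> \<in> E" using assms[of \<omega>' \<omega>] * by metis
qed

lemma depends_below_mono: "depends_below l E \<Longrightarrow> l \<le> l' \<Longrightarrow> depends_below l' E"
  unfolding depends_below_def by (meson less_le_trans)

lemma depends_below_Int: "depends_below l E \<Longrightarrow> depends_below l F \<Longrightarrow> depends_below l (E \<inter> F)"
  unfolding depends_below_def by blast

definition at_origin :: "(nat list \<times> nat \<Rightarrow> int) \<Rightarrow> nat list \<Rightarrow> bool" where
  "at_origin \<omega> u \<longleftrightarrow> lives \<omega> u \<and> pos \<omega> u = 0"

lemma depends_below_at_origin: "length u \<le> l \<Longrightarrow> depends_below l {\<omega>. at_origin \<omega> u}"
  unfolding at_origin_def
  by (intro depends_belowI) (metis (mono_tags, lifting) mem_Collect_eq order_less_le_trans pos_lives_cong)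

lemma at_origin_append:
  "at_origin \<omega> v \<Longrightarrow> at_origin (subtree v \<omega>) w \<Longrightarrow> at_origin \<omega> (w @ v)"
  by (simp add: at_origin_def lives_append pos_append)

context catalytic_laws
begin

lemma sets_at_origin [measurable]: "Measurable.pred env (\<lambda>\<omega>. at_origin \<omega> u)"
  unfolding at_origin_def by measurable

lemma measurable_into_env:
  assumes "\<And>j. (\<lambda>x. f x j) \<in> N \<rightarrow>\<^sub>M count_space UNIV"
  shows "f \<in> N \<rightarrow>\<^sub>M env"
  unfolding env_def
proof (rule measurable_PiM_single')
  show "(\<lambda>x. f x j) \<in> N \<rightarrow>\<^sub>M measure_pmf (coord_law j)" for j
    using assms[of j] by (simp cong: measurable_cong_sets)
qed simp

lemma measurable_subtree [measurable]: "subtree v \<in> env \<rightarrow>\<^sub>M env"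
  by (rule measurable_into_env) (auto simp: subtree_def split_beta')

lemma distr_subtree: "distr env env (subtree v) = env"
proof -
  have "(\<lambda>j. measure_pmf (coord_law (fst j @ v, snd j))) = (\<lambda>j. measure_pmf (coord_law j))"
    by (auto simp: coord_law_def)
  moreover have "subtree v = (\<lambda>\<omega> j. \<omega> (fst j @ v, snd j))"
    by (auto simp: subtree_def fun_eq_iff)
  ultimately show ?thesis
    using distr_PiM_reindex[of UNIV "\<lambda>j. measure_pmf (coord_law j)" "\<lambda>j. (fst j @ v, snd j)" UNIV]
    by (simp add: env_def inj_on_def measure_pmf.prob_space_axioms prod_eq_iff restrict_def)
qed

lemma nn_integral_subtree:
  "\<Phi> \<in> borel_measurable env \<Longrightarrow> (\<integral>\<^sup>+\<omega>. \<Phi> (subtree v \<omega>) \<partial>env) = (\<integral>\<^sup>+\<omega>. \<Phi> \<omega> \<partial>env)"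
  by (subst (2) distr_subtree[of v, symmetric], subst nn_integral_distr) simp_all

lemma indep_coords: "env.indep_vars (\<lambda>j. measure_pmf (coord_law j)) (\<lambda>j \<omega>. \<omega> j) UNIV"
proof -
  interpret P: product_prob_space "\<lambda>j. measure_pmf (coord_law j)" UNIV
    by standard
  have rv: "(\<lambda>\<omega>. \<omega> j) \<in> env \<rightarrow>\<^sub>M measure_pmf (coord_law j)" for j
    unfolding env_def by (rule measurable_component_singleton) simp
  have "distr env (measure_pmf (coord_law j)) (\<lambda>\<omega>. \<omega> j) = measure_pmf (coord_law j)" for j
    unfolding env_def by (rule P.PiM_component) simp
  then show ?thesis
    by (subst env.indep_vars_iff_distr_eq_PiM') (simp_all add: rv env_def[symmetric] distr_id2 restrict_def)
qed

text \<open>Labels of equal length have disjoint sets of descendants, and an event that depends on shorter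
  labels only uses yet other coordinates. The factors on the left are therefore functions of disjoint
  groups of independent coordinates.\<close>

lemma branching_fixed:
  assumes A: "finite A" "\<And>v. v \<in> A \<Longrightarrow> length v = l"
    and [measurable]: "E \<in> sets env" and E: "depends_below l E"
    and [measurable]: "\<Phi> \<in> borel_measurable env"
  shows "(\<integral>\<^sup>+\<omega>. indicator E \<omega> * (\<Prod>v\<in>A. \<Phi> (subtree v \<omega>)) \<partial>env)
    = emeasure env E * (\<integral>\<^sup>+\<omega>. \<Phi> \<omega> \<partial>env) ^ card A"
proof -
  define B :: "nat list option \<Rightarrow> (nat list \<times> nat) set" where
    "B t = (case t of None \<Rightarrow> {(v, i). length v < l} | Some v \<Rightarrow> {(w @ v, i) |w i. True})" for t
  define Y :: "nat list option \<Rightarrow> (nat list \<times> nat \<Rightarrow> int) \<Rightarrow> ennreal" where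
    "Y t y = (case t of None \<Rightarrow> indicator E (\<lambda>j. if j \<in> B None then y j else 0)
      | Some v \<Rightarrow> \<Phi> (\<lambda>j. y (fst j @ v, snd j)))" for t y
  define L where "L = insert None (Some ` A)"
  have comp: "(\<lambda>y. y j) \<in> PiM (B t) (\<lambda>j. measure_pmf (coord_law j)) \<rightarrow>\<^sub>M count_space UNIV"
    if "j \<in> B t" for j t
    using measurable_component_singleton[OF that, of "\<lambda>j. measure_pmf (coord_law j)"]
    by (simp cong: measurable_cong_sets)
  have Y_meas: "Y t \<in> PiM (B t) (\<lambda>j. measure_pmf (coord_law j)) \<rightarrow>\<^sub>M borel" for t
  proof (cases t)
    case None
    have "(\<lambda>y j. if j \<in> B None then y j else 0) \<in> PiM (B t) (\<lambda>j. measure_pmf (coord_law j)) \<rightarrow>\<^sub>M env"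
    proof (rule measurable_into_env)
      fix j
      show "(\<lambda>y. if j \<in> B None then y j else 0) \<in> PiM (B t) (\<lambda>j. measure_pmf (coord_law j)) \<rightarrow>\<^sub>M count_space UNIV"
        using comp[of j t] None by (cases "j \<in> B None") auto
    qed
    then show ?thesis
      unfolding Y_def None by (simp add: measurable_compose[OF _ borel_measurable_indicator])
  next
    case (Some v)
    have "(\<lambda>y j. y (fst j @ v, snd j)) \<in> PiM (B t) (\<lambda>j. measure_pmf (coord_law j)) \<rightarrow>\<^sub>M env"
      by (rule measurable_into_env, rule comp) (use Some in \<open>auto simp: B_def\<close>)
    then show ?thesis
      unfolding Y_def Some by (simp add: measurable_compose[OF _ \<open>\<Phi> \<in> borel_measurable env\<close>])
  qed
  have "disjoint_family_on B L"
    using A(2) by (auto simp: disjoint_family_on_def L_def B_def split: option.splits)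
  then have "env.indep_vars (\<lambda>t. PiM (B t) (\<lambda>j. measure_pmf (coord_law j))) (\<lambda>t \<omega>. restrict (\<lambda>j. \<omega> j) (B t)) L"
    by (intro env.indep_vars_restrict[OF indep_coords]) auto
  then have indep: "env.indep_vars (\<lambda>_. borel) (\<lambda>t \<omega>. Y t (restrict (\<lambda>j. \<omega> j) (B t))) L"
    by (rule env.indep_vars_compose2) (rule Y_meas)
  have YN: "Y None (restrict (\<lambda>j. \<omega> j) (B None)) = indicator E \<omega>" for \<omega>
  proof -
    have "(\<lambda>j. if j \<in> B None then restrict (\<lambda>j. \<omega> j) (B None) j else 0) \<in> E \<longleftrightarrow> \<omega> \<in> E"
      by (rule E[unfolded depends_below_def, rule_format]) (auto simp: B_def)
    then show ?thesis by (simp add: Y_def indicator_def)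
  qed
  have YS: "Y (Some v) (restrict (\<lambda>j. \<omega> j) (B (Some v))) = \<Phi> (subtree v \<omega>)" for v \<omega>
    by (auto simp: Y_def B_def subtree_def fun_eq_iff intro!: arg_cong[where f = \<Phi>])
  have prod: "(\<Prod>t\<in>L. g t) = g None * (\<Prod>v\<in>A. g (Some v))" for g :: "nat list option \<Rightarrow> ennreal"
    unfolding L_def using A(1) by (subst prod.insert) (auto simp: prod.reindex)
  have "finite L" using A(1) by (simp add: L_def)
  from env.indep_vars_nn_integral[OF this indep] show ?thesis
    by (simp add: prod YN YS nn_integral_subtree)
qed

definition present :: "nat list set \<Rightarrow> (nat list \<times> nat \<Rightarrow> int) \<Rightarrow> nat list set" where
  "present \<Lambda> \<omega> = {v \<in> \<Lambda>. at_origin \<omega> v}"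

text \<open>The branching property at a fixed generation: given the past, the particles of \<open>\<Lambda>\<close> that sit at
  the origin start independent copies of the process. The random set of these particles takes
  finitely many values, each of them an event of the past, which reduces the claim to the case of a
  fixed set of labels.\<close>

lemma branching:
  assumes \<Lambda>: "finite \<Lambda>" "\<And>v. v \<in> \<Lambda> \<Longrightarrow> length v = l"
    and [measurable]: "E \<in> sets env" and E: "depends_below l E"
    and [measurable]: "\<Phi> \<in> borel_measurable env"
  shows "(\<integral>\<^sup>+\<omega>. indicator E \<omega> * (\<Prod>v\<in>present \<Lambda> \<omega>. \<Phi> (subtree v \<omega>)) \<partial>env)
    = (\<integral>\<^sup>+\<omega>. indicator E \<omega> * (\<integral>\<^sup>+\<omega>. \<Phi> \<omega> \<partial>env) ^ card (present \<Lambda> \<omega>) \<partial>env)"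
proof -
  define F where "F A = E \<inter> {\<omega>. present \<Lambda> \<omega> = A}" for A
  have F_eq: "F A = {\<omega>\<in>E. \<forall>v\<in>\<Lambda>. at_origin \<omega> v \<longleftrightarrow> v \<in> A}" if "A \<subseteq> \<Lambda>" for A
    using that by (auto simp: F_def present_def)
  have F_meas: "F A \<in> sets env" if "A \<subseteq> \<Lambda>" for A
    unfolding F_eq[OF that] using \<Lambda>(1) by (simp add: pred_def[symmetric])
  have F_dep: "depends_below l (F A)" if "A \<subseteq> \<Lambda>" for A
  proof (rule depends_belowI)
    fix \<omega> \<omega>' :: "nat list \<times> nat \<Rightarrow> int"
    assume *: "\<And>v i. length v < l \<Longrightarrow> \<omega> (v, i) = \<omega>' (v, i)" and "\<omega> \<in> F A"
    moreover have "at_origin \<omega> v \<longleftrightarrow> at_origin \<omega>' v" if "v \<in> \<Lambda>" for v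
      using depends_below_at_origin[of v l] \<Lambda>(2)[OF that] * unfolding depends_below_def by auto
    moreover have "\<omega> \<in> E \<longleftrightarrow> \<omega>' \<in> E"
      using E * unfolding depends_below_def by auto
    ultimately show "\<omega>' \<in> F A"
      using that by (auto simp: F_eq)
  qed
  have split: "indicator E \<omega> * g (present \<Lambda> \<omega>) = (\<Sum>A\<in>Pow \<Lambda>. indicator (F A) \<omega> * g A)"
    for g :: "nat list set \<Rightarrow> ennreal" and \<omega>
  proof -
    have "(\<Sum>A\<in>Pow \<Lambda>. indicator (F A) \<omega> * g A) = (\<Sum>A\<in>Pow \<Lambda>. if A = present \<Lambda> \<omega> then indicator E \<omega> * g A else 0)"
      by (intro sum.cong) (auto simp: F_def indicator_def)
    then show ?thesis
      using \<Lambda>(1) by (simp add: present_def)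
  qed
  have "(\<integral>\<^sup>+\<omega>. indicator E \<omega> * (\<Prod>v\<in>present \<Lambda> \<omega>. \<Phi> (subtree v \<omega>)) \<partial>env)
      = (\<integral>\<^sup>+\<omega>. (\<Sum>A\<in>Pow \<Lambda>. indicator (F A) \<omega> * (\<Prod>v\<in>A. \<Phi> (subtree v \<omega>))) \<partial>env)"
    by (intro nn_integral_cong split)
  also have "\<dots> = (\<Sum>A\<in>Pow \<Lambda>. \<integral>\<^sup>+\<omega>. indicator (F A) \<omega> * (\<Prod>v\<in>A. \<Phi> (subtree v \<omega>)) \<partial>env)"
    using F_meas by (intro nn_integral_sum) auto
  also have "\<dots> = (\<Sum>A\<in>Pow \<Lambda>. \<integral>\<^sup>+\<omega>. indicator (F A) \<omega> * (\<integral>\<^sup>+\<omega>. \<Phi> \<omega> \<partial>env) ^ card A \<partial>env)"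
  proof (rule sum.cong)
    fix A assume A: "A \<in> Pow \<Lambda>"
    then have "finite A" using \<Lambda>(1) finite_subset by auto
    then show "(\<integral>\<^sup>+\<omega>. indicator (F A) \<omega> * (\<Prod>v\<in>A. \<Phi> (subtree v \<omega>)) \<partial>env)
        = (\<integral>\<^sup>+\<omega>. indicator (F A) \<omega> * (\<integral>\<^sup>+\<omega>. \<Phi> \<omega> \<partial>env) ^ card A \<partial>env)"
      using A F_meas F_dep \<Lambda>(2)
      by (subst branching_fixed[where l = l]) (auto simp: nn_integral_multc)
  qed simp
  also have "\<dots> = (\<integral>\<^sup>+\<omega>. (\<Sum>A\<in>Pow \<Lambda>. indicator (F A) \<omega> * (\<integral>\<^sup>+\<omega>. \<Phi> \<omega> \<partial>env) ^ card A) \<partial>env)"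
    using F_meas by (intro nn_integral_sum[symmetric]) auto
  also have "\<dots> = (\<integral>\<^sup>+\<omega>. indicator E \<omega> * (\<integral>\<^sup>+\<omega>. \<Phi> \<omega> \<partial>env) ^ card (present \<Lambda> \<omega>) \<partial>env)"
    by (intro nn_integral_cong split[symmetric])
  finally show ?thesis .
qed

end

section \<open>First passage through the origin\<close>

definition hits_at :: "nat \<Rightarrow> (nat \<Rightarrow> int) \<Rightarrow> bool" where
  "hits_at k s \<longleftrightarrow> s k = 0 \<and> (\<forall>i<k. s i \<noteq> 0)"

lemma hits_at_Suc: "hits_at (Suc k) s \<longleftrightarrow> s 0 \<noteq> 0 \<and> hits_at k (\<lambda>i. s (Suc i))"
  by (auto simp: hits_at_def less_Suc_eq_0_disj)

lemma walk_case_nat: "walk x (case_nat y \<xi>) (Suc i) = walk (x + y) \<xi> i"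
  unfolding walk_def sum.lessThan_Suc_shift by simp

text \<open>The return time is \<open>Suc k\<close> exactly when the path seen from time \<open>1\<close> hits the origin for the
  first time at time \<open>k\<close>, so at most one term of the series is nonzero.\<close>

lemma exp_discount_return_time:
  "ennreal (exp_discount r (return_time s))
    = (\<Sum>k. ennreal (exp (- r)) ^ Suc k * indicator {k. hits_at k (\<lambda>i. s (Suc i))} k)"
proof (cases "\<exists>k. s (Suc k) = 0")
  case True
  define k where "k = (LEAST k. s (Suc k) = 0)"
  have k: "s (Suc k) = 0"
    unfolding k_def using True by (rule LeastI_ex)
  have k_le: "k \<le> i" if "s (Suc i) = 0" for i
    unfolding k_def using that by (rule Least_le)
  have "return_time s = enat (Suc k)"
    unfolding return_time_def
  proof (rule cInf_eq_minimum)
    fix x assume "x \<in> {enat n |n. n \<ge> 1 \<and> s n = 0}"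
    then obtain n where n: "x = enat n" "n \<ge> 1" "s n = 0" by auto
    then obtain i where "n = Suc i" by (cases n) auto
    then show "enat (Suc k) \<le> x" using n k_le by auto
  qed (use k in auto)
  then have 1: "exp_discount r (return_time s) = exp (- r) ^ Suc k"
    using exp_of_nat_mult[of "Suc k" "- r"] by (simp add: exp_discount_def mult.commute)
  have "i = k" if "hits_at i (\<lambda>i. s (Suc i))" for i
  proof -
    have "\<not> k < i" "s (Suc i) = 0"
      using that k unfolding hits_at_def by blast+
    then show ?thesis using k_le[of i] by simp
  qed
  moreover have "hits_at k (\<lambda>i. s (Suc i))"
    unfolding hits_at_def using k k_le by (auto simp: not_le[symmetric])
  ultimately have 2: "{i. hits_at i (\<lambda>i. s (Suc i))} = {k}"
    by blast
  have "(\<Sum>i. ennreal (exp (- r)) ^ Suc i * indicator {k} i) = ennreal (exp (- r)) ^ Suc k"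
    by (subst suminf_finite[of "{k}"]) (simp_all add: indicator_def)
  then show ?thesis
    unfolding 1 2 by (simp add: ennreal_power del: power_Suc)
next
  case False
  then have "{enat n |n. n \<ge> 1 \<and> s n = 0} = {}"
    by (auto simp: Suc_le_eq gr0_conv_Suc)
  then have "return_time s = \<infinity>"
    by (simp only: return_time_def) (simp add: Inf_enat_def)
  then show ?thesis
    using False by (simp add: exp_discount_def hits_at_def)
qed

context catalytic_laws
begin

lemma space_steps [simp]: "space (steps p) = UNIV"
  by (simp add: steps_def space_PiM)

lemma prob_space_steps: "prob_space (steps p)"
  unfolding steps_def by (intro prob_space_PiM) (rule measure_pmf.prob_space_axioms)

lemma measurable_step [measurable]: "(\<lambda>\<xi>. \<xi> k) \<in> steps p \<rightarrow>\<^sub>M count_space UNIV"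
proof -
  have "(\<lambda>\<xi>. \<xi> k) \<in> steps p \<rightarrow>\<^sub>M measure_pmf p"
    unfolding steps_def by (rule measurable_component_singleton) simp
  then show ?thesis by (simp cong: measurable_cong_sets)
qed

lemma measurable_walk [measurable]: "(\<lambda>\<xi>. walk x \<xi> k) \<in> steps p \<rightarrow>\<^sub>M count_space UNIV"
proof (induction k)
  case (Suc k)
  have "walk x \<xi> (Suc k) = walk x \<xi> k + \<xi> k" for \<xi>
    by (simp add: walk_def)
  then show ?case using Suc by simp
qed (simp add: walk_def)

lemma measurable_hits_at [measurable]: "Measurable.pred (steps p) (\<lambda>\<xi>. hits_at k (\<lambda>i. walk x \<xi> (f i)))"
  unfolding hits_at_def by measurable

text \<open>The Markov property at time \<open>1\<close>: the first step and the remaining steps are independent.\<close>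

lemma nn_integral_first_step:
  assumes [measurable]: "f \<in> borel_measurable (steps p)"
  shows "(\<integral>\<^sup>+\<xi>. f \<xi> \<partial>steps p) = (\<integral>\<^sup>+y. (\<integral>\<^sup>+\<xi>. f (case_nat y \<xi>) \<partial>steps p) \<partial>measure_pmf p)"
proof -
  interpret sequence_space "measure_pmf p" by standard
  interpret S: prob_space "steps p" by (rule prob_space_steps)
  have *: "(\<lambda>(s, \<omega>). case_nat s \<omega>) \<in> measure_pmf p \<Otimes>\<^sub>M steps p \<rightarrow>\<^sub>M steps p"
    unfolding steps_def by measurable
  then have [measurable]: "(\<lambda>z. case_nat (fst z) (snd z)) \<in> measure_pmf p \<Otimes>\<^sub>M steps p \<rightarrow>\<^sub>M steps p"
    by (simp add: split_beta')
  have "(\<integral>\<^sup>+\<xi>. f \<xi> \<partial>steps p)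
      = (\<integral>\<^sup>+\<xi>. f \<xi> \<partial>distr (measure_pmf p \<Otimes>\<^sub>M steps p) (steps p) (\<lambda>(s, \<omega>). case_nat s \<omega>))"
    using PiM_iter by (simp add: steps_def)
  also have "\<dots> = (\<integral>\<^sup>+y. (\<integral>\<^sup>+\<xi>. f (case_nat y \<xi>) \<partial>steps p) \<partial>measure_pmf p)"
    using * by (simp add: nn_integral_distr S.nn_integral_fst[symmetric] split_beta')
  finally show ?thesis .
qed

primrec hit_prob :: "nat \<Rightarrow> int \<Rightarrow> ennreal" where
  "hit_prob 0 = indicator {0}"
| "hit_prob (Suc k) = (\<lambda>x. if x = 0 then 0 else shift_mean (hit_prob k) x)"

lemma emeasure_hits_at: "(\<integral>\<^sup>+\<xi>. indicator {\<xi>. hits_at k (walk x \<xi>)} \<xi> \<partial>steps p) = hit_prob k x"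
proof (induction k arbitrary: x)
  case 0
  interpret S: prob_space "steps p" by (rule prob_space_steps)
  have "indicator {\<xi>. hits_at 0 (walk x \<xi>)} \<xi> = (indicator {0} x :: ennreal)" for \<xi>
    by (auto simp: hits_at_def walk_def indicator_def)
  then show ?case by (simp add: S.emeasure_space_1[simplified])
next
  case (Suc k)
  have "indicator {\<xi>. hits_at (Suc k) (walk x \<xi>)} (case_nat y \<xi>)
      = (if x = 0 then 0 else indicator {\<xi>. hits_at k (walk (x + y) \<xi>)} \<xi> :: ennreal)" for y \<xi>
    by (auto simp: hits_at_Suc walk_case_nat indicator_def) (simp_all add: walk_def)
  then show ?case
    by (subst nn_integral_first_step)
       (use measurable_hits_at[of "Suc k" x "\<lambda>i. i"] in \<open>auto simp: Suc shift_mean_def\<close>)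
qed

text \<open>The expectation of \<open>e\<close> to the power \<open>- r \<sigma>\<close>, where \<open>\<sigma>\<close> is the hitting time of the origin by
  the walk started at \<open>x\<close>.\<close>

definition hit_laplace :: "real \<Rightarrow> int \<Rightarrow> ennreal" where
  "hit_laplace r x = (\<Sum>k. ennreal (exp (- r)) ^ k * hit_prob k x)"

lemma shift_mean_suminf: "shift_mean (\<lambda>x. \<Sum>k. f k x) x = (\<Sum>k. shift_mean (f k) x)"
  unfolding shift_mean_def by (rule nn_integral_suminf) simp

lemma shift_mean_cmult: "shift_mean (\<lambda>x. c * f x) x = c * shift_mean f x"
  unfolding shift_mean_def by (rule nn_integral_cmult) simp

lemma shift_mean_add: "shift_mean (\<lambda>x. f x + g x) x = shift_mean f x + shift_mean g x"
  unfolding shift_mean_def by (rule nn_integral_add) simp_all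

lemma shift_mean_const: "shift_mean (\<lambda>x. c) x = c"
  unfolding shift_mean_def by (simp add: measure_pmf.emeasure_space_1[simplified])

lemma shift_mean_mono: "(\<And>x. f x \<le> g x) \<Longrightarrow> shift_mean f x \<le> shift_mean g x"
  unfolding shift_mean_def by (rule nn_integral_mono)

lemma suminf_ennreal_head: "(\<Sum>k. f k) = f 0 + (\<Sum>k. f (Suc k))" for f :: "nat \<Rightarrow> ennreal"
  using suminf_offset[OF summableI, of f 1] by (simp add: add.commute)

lemma hit_laplace_0: "hit_laplace r 0 = 1"
  unfolding hit_laplace_def by (subst suminf_finite[of "{0}"]) (auto simp: gr0_conv_Suc)

lemma shift_mean_hit_laplace:
  "ennreal (exp (- r)) * shift_mean (hit_laplace r) x
    = (\<Sum>k. ennreal (exp (- r)) ^ Suc k * shift_mean (hit_prob k) x)"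
  unfolding hit_laplace_def
  by (simp add: shift_mean_suminf shift_mean_cmult mult.assoc)

lemma hit_laplace_step:
  "x \<noteq> 0 \<Longrightarrow> hit_laplace r x = ennreal (exp (- r)) * shift_mean (hit_laplace r) x"
  unfolding shift_mean_hit_laplace by (simp add: hit_laplace_def) (subst suminf_ennreal_head, simp)

text \<open>The walk that leaves the origin makes one step and then hits the origin. This rewrites the
  hypothesis on the return time as an equation for \<open>hit_laplace\<close> at the origin.\<close>

lemma nn_return_laplace:
  "(\<integral>\<^sup>+\<xi>. exp_discount r (return_time (walk 0 \<xi>)) \<partial>steps p)
    = ennreal (exp (- r)) * shift_mean (hit_laplace r) 0"
proof -
  interpret S: prob_space "steps p" by (rule prob_space_steps)
  have "(\<integral>\<^sup>+\<xi>. exp_discount r (return_time (walk 0 \<xi>)) \<partial>steps p)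
      = (\<integral>\<^sup>+\<xi>. (\<Sum>k. ennreal (exp (- r)) ^ Suc k *
           indicator {\<xi>. hits_at k (\<lambda>i. walk 0 \<xi> (Suc i))} \<xi>) \<partial>steps p)"
    by (subst exp_discount_return_time) (simp add: indicator_def)
  also have "\<dots> = (\<Sum>k. ennreal (exp (- r)) ^ Suc k *
      (\<integral>\<^sup>+\<xi>. indicator {\<xi>. hits_at k (\<lambda>i. walk 0 \<xi> (Suc i))} \<xi> \<partial>steps p))"
    by (subst nn_integral_suminf) (simp_all add: nn_integral_cmult del: power_Suc)
  also have "\<dots> = (\<Sum>k. ennreal (exp (- r)) ^ Suc k * shift_mean (hit_prob k) 0)"
  proof -
    have "indicator {\<xi>. hits_at k (\<lambda>i. walk 0 \<xi> (Suc i))} (case_nat y \<xi>)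
      = (indicator {\<xi>. hits_at k (walk (0 + y) \<xi>)} \<xi> :: ennreal)" for k y \<xi>
      by (simp add: walk_case_nat indicator_def)
    then have "(\<integral>\<^sup>+\<xi>. indicator {\<xi>. hits_at k (\<lambda>i. walk 0 \<xi> (Suc i))} \<xi> \<partial>steps p) = shift_mean (hit_prob k) 0" for k
      by (subst nn_integral_first_step) (simp_all add: emeasure_hits_at shift_mean_def del: add_0)
    then show ?thesis by simp
  qed
  finally show ?thesis unfolding shift_mean_hit_laplace .
qed

lemma exp_moment_eq: "exp_moment p t = (\<integral>\<^sup>+y. ennreal (exp (t * real_of_int y)) \<partial>measure_pmf p)"
proof -
  interpret S: prob_space "steps p" by (rule prob_space_steps)
  have [measurable]: "(\<lambda>\<xi>. ennreal (exp (t * real_of_int (walk 0 \<xi> 1)))) \<in> borel_measurable (steps p)"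
    by (rule measurable_compose[where N = "count_space UNIV" and g = "\<lambda>y. ennreal (exp (t * real_of_int y))"]) simp_all
  have "exp_moment p t = (\<integral>\<^sup>+y. (\<integral>\<^sup>+\<xi>. ennreal (exp (t * real_of_int y)) \<partial>steps p) \<partial>measure_pmf p)"
    unfolding exp_moment_def by (subst nn_integral_first_step) (simp_all add: walk_case_nat, simp add: walk_def)
  then show ?thesis by (simp add: S.emeasure_space_1[simplified])
qed

end

section \<open>Upper bound on the speed\<close>

text \<open>The assumptions in the form in which they are used: \<open>malthus\<close> is the equation for \<open>r\<close>,
  \<open>laplace_t0\<close> says that \<open>r\<close> is the value of the log-Laplace transform at \<open>t0\<close>, and \<open>laplace_t1\<close> that the transform is
  still finite a little further to the right, which gives second moments under the tilted law.\<close>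

locale catalytic_walk = catalytic_laws p \<nu> for p :: "int pmf" and \<nu> :: "nat pmf" +
  fixes m r t0 t1 :: real
  assumes m_pos: "m > 0"
    and mean_children_eq: "mean_children = ennreal m"
    and malthus: "ennreal m * (ennreal (exp (- r)) * shift_mean (hit_laplace r) 0) = 1"
    and r_pos: "r > 0"
    and t0_pos: "t0 > 0"
    and t1_gt: "t1 > t0"
    and laplace_t0: "(\<integral>\<^sup>+y. ennreal (exp (t0 * real_of_int y)) \<partial>measure_pmf p) = ennreal (exp r)"
    and laplace_t1: "(\<integral>\<^sup>+y. ennreal (exp (t1 * real_of_int y)) \<partial>measure_pmf p) < \<infinity>"

context catalytic_laws
begin

lemma mean_op_mono: "(\<And>x. f x \<le> g x) \<Longrightarrow> mean_op f x \<le> mean_op g x"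
  unfolding mean_op_def by (auto intro!: mult_left_mono shift_mean_mono)

lemma mean_op_cmult: "mean_op (\<lambda>x. c * f x) x = c * mean_op f x"
  by (simp add: mean_op_def shift_mean_cmult ac_simps)

lemma mean_op_suminf: "mean_op (\<lambda>x. \<Sum>k. f k x) x = (\<Sum>k. mean_op (f k) x)"
  by (simp add: mean_op_def shift_mean_suminf)

lemma mean_op_power_le:
  assumes "\<And>x. mean_op f x \<le> c * f x"
  shows "(mean_op ^^ n) f x \<le> c ^ n * f x"
proof (induction n arbitrary: x)
  case (Suc n)
  have "(mean_op ^^ Suc n) f x \<le> mean_op (\<lambda>x. c ^ n * f x) x"
    using Suc by (auto intro: mean_op_mono)
  also have "\<dots> \<le> c ^ n * (c * f x)"
    unfolding mean_op_cmult by (intro mult_left_mono assms) simp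
  finally show ?case by (simp add: ac_simps)
qed simp

end

context catalytic_walk
begin

lemma exp_cancel: "ennreal (exp a) * (ennreal (exp (- a)) * x) = x" "ennreal (exp (- a)) * (ennreal (exp a) * x) = x"
  by (simp_all add: mult.assoc[symmetric] ennreal_mult[symmetric] exp_add[symmetric])

lemma shift_mean_exp:
  "shift_mean (\<lambda>x. ennreal (exp (t0 * real_of_int x))) x = ennreal (exp r) * ennreal (exp (t0 * real_of_int x))"
proof -
  have "shift_mean (\<lambda>x. ennreal (exp (t0 * real_of_int x))) x
      = (\<integral>\<^sup>+y. ennreal (exp (t0 * real_of_int x)) * ennreal (exp (t0 * real_of_int y)) \<partial>measure_pmf p)"
    unfolding shift_mean_def by (simp add: distrib_left exp_add ennreal_mult)
  then show ?thesis
    by (simp add: nn_integral_cmult laplace_t0) (simp add: mult.commute)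
qed

lemma shift_mean_hit_laplace_away: "x \<noteq> 0 \<Longrightarrow> shift_mean (hit_laplace r) x = ennreal (exp r) * hit_laplace r x"
  by (simp add: hit_laplace_step exp_cancel)

lemma mean_shift_mean_hit_laplace_0: "ennreal m * shift_mean (hit_laplace r) 0 = ennreal (exp r)"
proof -
  have "ennreal m * shift_mean (hit_laplace r) 0
      = ennreal (exp r) * (ennreal m * (ennreal (exp (- r)) * shift_mean (hit_laplace r) 0))"
    using exp_cancel(1)[of r "ennreal m * shift_mean (hit_laplace r) 0"] by (simp add: ac_simps)
  then show ?thesis by (simp add: malthus)
qed

text \<open>Away from the origin both terms are multiplied by \<open>exp r\<close> in one step. At the origin this stays
  true for \<open>hit_laplace\<close>, by the equation for \<open>r\<close>, but the exponential gains an additional factor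
  \<open>m\<close>; a large multiple of \<open>hit_laplace\<close> makes this excess relatively small.\<close>

definition lyapunov :: "real \<Rightarrow> int \<Rightarrow> ennreal" where
  "lyapunov C x = ennreal (exp (t0 * real_of_int x)) + ennreal C * hit_laplace r x"

lemma shift_mean_lyapunov:
  "shift_mean (lyapunov C) x
    = ennreal (exp r) * ennreal (exp (t0 * real_of_int x)) + ennreal C * shift_mean (hit_laplace r) x"
  unfolding lyapunov_def[abs_def] by (simp add: shift_mean_add shift_mean_cmult shift_mean_exp)

lemma mean_op_lyapunov:
  assumes "0 \<le> C" "0 \<le> \<epsilon>" "m + C \<le> exp \<epsilon> * (1 + C)"
  shows "mean_op (lyapunov C) x \<le> ennreal (exp (r + \<epsilon>)) * lyapunov C x"
proof (cases "x = 0")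
  case False
  then have "mean_op (lyapunov C) x = ennreal (exp r) * lyapunov C x"
    by (simp add: mean_op_def shift_mean_lyapunov lyapunov_def
        shift_mean_hit_laplace_away distrib_left ac_simps)
  also have "\<dots> \<le> ennreal (exp (r + \<epsilon>)) * lyapunov C x"
    using assms by (intro mult_right_mono) simp_all
  finally show ?thesis .
next
  case True
  have "mean_op (lyapunov C) 0 = ennreal m * ennreal (exp r) + ennreal C * (ennreal m * shift_mean (hit_laplace r) 0)"
    by (simp add: mean_op_def mean_children_eq shift_mean_lyapunov distrib_left ac_simps)
  also have "\<dots> = ennreal (exp r * (m + C))"
    using assms m_pos
    by (simp add: mean_shift_mean_hit_laplace_0 ennreal_mult[symmetric] ennreal_plus[symmetric] distrib_left ac_simps
        del: ennreal_plus)
  also have "\<dots> \<le> ennreal (exp (r + \<epsilon>) * (1 + C))"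
    using assms by (intro ennreal_leI) (simp add: exp_add mult.assoc)
  also have "\<dots> = ennreal (exp (r + \<epsilon>)) * lyapunov C 0"
    using assms by (simp add: lyapunov_def hit_laplace_0 ennreal_mult ennreal_plus[symmetric] del: ennreal_plus)
       (simp add: ennreal_1[symmetric] ennreal_plus[symmetric] del: ennreal_plus ennreal_1)
  finally show ?thesis using True by simp
qed

text \<open>Markov's inequality for the exponential part of \<open>lyapunov\<close>, summed over the generation with the
  many-to-one formula.\<close>

lemma generation_tail:
  assumes "0 \<le> C" "0 \<le> \<epsilon>" "m + C \<le> exp \<epsilon> * (1 + C)"
  shows "emeasure env {\<omega>. reaches n b \<omega>}
    \<le> ennreal (exp ((r + \<epsilon>) * n - t0 * b) * (1 + C))"
proof -
  define A where "A u = {\<omega>. lives \<omega> u \<and> b \<le> real_of_int (pos \<omega> u)}" for u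
  have A_meas: "A u \<in> sets env" for u
  proof -
    have "Measurable.pred env (\<lambda>\<omega>. lives \<omega> u \<and> b \<le> real_of_int (pos \<omega> u))"
      by (intro pred_intros_logic measurable_lives measurable_pos_ge)
    then show ?thesis by (simp add: A_def pred_def)
  qed
  have "emeasure env (A u) \<le> ennreal (exp (- (t0 * b))) * expected_alive (lyapunov C) u" for u
  proof -
    have "emeasure env (A u) = (\<integral>\<^sup>+\<omega>. indicator (A u) \<omega> \<partial>env)"
      using A_meas by simp
    also have "\<dots> \<le> (\<integral>\<^sup>+\<omega>. ennreal (exp (- (t0 * b))) * (indicator {\<omega>. lives \<omega> u} \<omega> * lyapunov C (pos \<omega> u)) \<partial>env)"
    proof (rule nn_integral_mono)
      fix \<omega>
      have "1 \<le> ennreal (exp (- (t0 * b))) * lyapunov C (pos \<omega> u)" if "b \<le> real_of_int (pos \<omega> u)"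
      proof -
        have "ennreal 1 \<le> ennreal (exp (- (t0 * b)) * exp (t0 * real_of_int (pos \<omega> u)))"
          using that t0_pos by (intro ennreal_leI) (simp add: exp_add[symmetric])
        also have "\<dots> = ennreal (exp (- (t0 * b))) * ennreal (exp (t0 * real_of_int (pos \<omega> u)))"
          by (simp add: ennreal_mult)
        also have "\<dots> \<le> ennreal (exp (- (t0 * b))) * lyapunov C (pos \<omega> u)"
          unfolding lyapunov_def by (intro mult_left_mono) simp_all
        finally show ?thesis by simp
      qed
      then show "indicator (A u) \<omega> \<le> ennreal (exp (- (t0 * b))) * (indicator {\<omega>. lives \<omega> u} \<omega> * lyapunov C (pos \<omega> u))"
        by (auto simp: A_def indicator_def)
    qed
    also have "\<dots> = ennreal (exp (- (t0 * b))) * expected_alive (lyapunov C) u"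
    proof -
      have [measurable]: "(\<lambda>\<omega>. lyapunov C (pos \<omega> u)) \<in> borel_measurable env"
        by (rule measurable_compose[OF measurable_pos]) simp
      show ?thesis
        unfolding expected_alive_def by (rule nn_integral_cmult) measurable
    qed
    finally show ?thesis .
  qed
  then have "generation_sum n (\<lambda>u. emeasure env (A u)) \<le> ennreal (exp (- (t0 * b))) * (mean_op ^^ n) (lyapunov C) 0"
    unfolding many_to_one[symmetric] generation_sum_cmult[symmetric] by (intro generation_sum_mono)
  also have "\<dots> \<le> ennreal (exp (- (t0 * b))) * (ennreal (exp (r + \<epsilon>)) ^ n * lyapunov C 0)"
    by (intro mult_left_mono mean_op_power_le mean_op_lyapunov assms) simp
  also have "lyapunov C 0 = ennreal (1 + C)"
    using assms by (simp add: lyapunov_def hit_laplace_0)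
  also have "ennreal (exp (- (t0 * b))) * (ennreal (exp (r + \<epsilon>)) ^ n * ennreal (1 + C))
      = ennreal (exp ((r + \<epsilon>) * n - t0 * b) * (1 + C))"
  proof -
    have "exp ((r + \<epsilon>) * n - t0 * b) = exp (- (t0 * b)) * exp (r + \<epsilon>) ^ n"
      by (simp add: exp_of_nat_mult[symmetric] exp_add[symmetric] ac_simps)
    then show ?thesis
      using assms by (simp add: ennreal_power ennreal_mult mult.assoc)
  qed
  finally have "generation_sum n (\<lambda>u. emeasure env (A u)) \<le> ennreal (exp ((r + \<epsilon>) * n - t0 * b) * (1 + C))" .
  moreover have "{\<omega>. reaches n b \<omega>} = (\<Union>u\<in>{u. length u = n}. A u)"
    by (auto simp: A_def reaches_def)
  ultimately show ?thesis
    using emeasure_generation_le[of A env n, OF A_meas] by simp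
qed

text \<open>For \<open>a > r / t0\<close> the bound of \<open>generation_tail\<close> is summable, with \<open>\<epsilon>\<close> half of the gap
  \<open>t0 * a - r\<close>.\<close>

lemma AE_speed_le:
  assumes a: "a > r / t0"
  shows "AE \<omega> in env. \<forall>\<^sub>F n in sequentially. \<not> reaches n (a * real n) \<omega>"
proof -
  define \<epsilon> where "\<epsilon> = (t0 * a - r) / 2"
  have \<epsilon>: "\<epsilon> > 0" and rate: "r + \<epsilon> - t0 * a = - \<epsilon>"
    using a t0_pos by (simp_all add: \<epsilon>_def field_simps)
  \<comment> \<open>chosen such that \<open>m + C = exp \<epsilon> * C\<close>\<close>
  define C where "C = m / (exp \<epsilon> - 1)"
  have C: "0 \<le> C" "m + C \<le> exp \<epsilon> * (1 + C)"
  proof -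
    have "exp \<epsilon> - 1 > 0" using \<epsilon> by simp
    then have "m = C * (exp \<epsilon> - 1)" "0 \<le> C" using m_pos by (simp_all add: C_def)
    then show "0 \<le> C" "m + C \<le> exp \<epsilon> * (1 + C)" by (simp_all add: algebra_simps)
  qed
  define A where "A n = {\<omega>. reaches n (a * real n) \<omega>}" for n
  have bound: "measure env (A n) \<le> (1 + C) * exp (- \<epsilon>) ^ n" for n
  proof -
    have "(r + \<epsilon>) * real n - t0 * (a * real n) = real n * (- \<epsilon>)"
      unfolding rate[symmetric] by (simp add: algebra_simps)
    then have "emeasure env (A n) \<le> ennreal ((1 + C) * exp (- \<epsilon>) ^ n)"
      using generation_tail[OF C(1) less_imp_le[OF \<epsilon>] C(2), of n "a * real n"]
      by (simp add: A_def exp_of_nat_mult[symmetric] mult.commute)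
    then show ?thesis
      using C by (simp add: env.emeasure_eq_measure)
  qed
  have "summable (\<lambda>n. measure env (A n))"
  proof (rule summable_comparison_test')
    show "summable (\<lambda>n. (1 + C) * exp (- \<epsilon>) ^ n)"
      using \<epsilon> by (intro summable_mult summable_geometric) simp
    show "norm (measure env (A n)) \<le> (1 + C) * exp (- \<epsilon>) ^ n" if "n \<ge> 0" for n
      using bound by simp
  qed
  then have "AE \<omega> in env. \<forall>\<^sub>F n in sequentially. \<omega> \<in> space env - A n"
    by (intro borel_cantelli_AE1) (auto simp: A_def env.emeasure_eq_measure)
  then show ?thesis
    by (rule AE_mp) (auto intro!: AE_I2 elim!: eventually_mono simp: A_def)
qed

section \<open>Growth of the mean number of particles at the origin\<close>

text \<open>The discounted expected number of visits to the origin by the branching process started from one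
  particle at \<open>x\<close>.\<close>

definition green :: "int \<Rightarrow> ennreal" where
  "green x = (\<Sum>n. ennreal (exp (- r)) ^ n * (mean_op ^^ n) (indicator {0}) x)"

lemma green_step: "green x = indicator {0} x + ennreal (exp (- r)) * mean_op green x"
proof -
  have "mean_op green x = (\<Sum>n. ennreal (exp (- r)) ^ n * (mean_op ^^ Suc n) (indicator {0}) x)"
    unfolding green_def by (simp add: mean_op_suminf mean_op_cmult)
  then show ?thesis
    unfolding green_def by (subst suminf_ennreal_head) (simp add: mult.assoc)
qed

text \<open>To visit the origin, the particle at \<open>x\<close> must first hit it; from there on it contributes
  \<open>green 0\<close>. The first hitting time is truncated at \<open>k\<close> and the claim proved by induction on \<open>k\<close>.\<close>

lemma green_ge: "hit_laplace r x * green 0 \<le> green x"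
proof -
  have part: "(\<Sum>i<k. ennreal (exp (- r)) ^ i * hit_prob i x) * green 0 \<le> green x" for k
  proof (induction k arbitrary: x)
    case (Suc k)
    show ?case
    proof (cases "x = 0")
      case True
      have "(\<Sum>i<Suc k. ennreal (exp (- r)) ^ i * hit_prob i x) = 1"
        using True by (subst sum.lessThan_Suc_shift) (simp add: sum.neutral)
      then show ?thesis using True by simp
    next
      case False
      have "(\<Sum>i<Suc k. ennreal (exp (- r)) ^ i * hit_prob i x) * green 0
          = ennreal (exp (- r)) * (\<Sum>i<k. ennreal (exp (- r)) ^ i * shift_mean (hit_prob i) x) * green 0"
        using False by (subst sum.lessThan_Suc_shift) (simp add: sum_distrib_left mult.assoc)
      also have "(\<Sum>i<k. ennreal (exp (- r)) ^ i * shift_mean (hit_prob i) x)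
          = shift_mean (\<lambda>x. \<Sum>i<k. ennreal (exp (- r)) ^ i * hit_prob i x) x"
        unfolding shift_mean_def by (subst nn_integral_sum) (simp_all add: nn_integral_cmult)
      also have "ennreal (exp (- r)) * \<dots> * green 0
          = ennreal (exp (- r)) * shift_mean (\<lambda>x. green 0 * (\<Sum>i<k. ennreal (exp (- r)) ^ i * hit_prob i x)) x"
        by (simp add: shift_mean_cmult ac_simps)
      also have "\<dots> \<le> ennreal (exp (- r)) * shift_mean green x"
        by (intro mult_left_mono shift_mean_mono) (use Suc in \<open>simp_all add: mult.commute\<close>)
      also have "\<dots> \<le> green x"
        using False by (subst green_step[of x]) (simp add: mean_op_def)
      finally show ?thesis .
    qed
  qed simp
  have "hit_laplace r x * green 0 = (\<Sum>i. ennreal (exp (- r)) ^ i * hit_prob i x * green 0)"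
    by (simp add: hit_laplace_def ennreal_suminf_multc)
  also have "\<dots> = (SUP k. (\<Sum>i<k. ennreal (exp (- r)) ^ i * hit_prob i x * green 0))"
    by (rule suminf_eq_SUP)
  also have "\<dots> \<le> green x"
    using part by (intro SUP_least) (simp add: sum_distrib_right)
  finally show ?thesis .
qed

text \<open>By the equation for \<open>r\<close>, the discounted expected number of returns of the children of a particle at the origin equals
  one; so the renewal equation reads \<open>green 0 \<ge> 1 + green 0\<close>.\<close>

lemma green_infinite: "green 0 = \<infinity>"
proof -
  have "1 + green 0 = 1 + (ennreal m * (ennreal (exp (- r)) * shift_mean (hit_laplace r) 0)) * green 0"
    by (simp add: malthus)
  also have "\<dots> = 1 + ennreal (exp (- r)) * (ennreal m * shift_mean (\<lambda>x. green 0 * hit_laplace r x) 0)"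
    unfolding shift_mean_cmult by (simp only: ac_simps)
  also have "\<dots> \<le> 1 + ennreal (exp (- r)) * (ennreal m * shift_mean green 0)"
    using green_ge by (intro add_left_mono mult_left_mono shift_mean_mono) (simp_all add: mult.commute)
  also have "\<dots> = green 0"
    by (subst green_step[of 0]) (simp add: mean_op_def mean_children_eq)
  finally have "1 + green 0 \<le> green 0" .
  then show ?thesis
    by (cases "green 0") (simp_all add: ennreal_1[symmetric] ennreal_plus[symmetric] del: ennreal_plus ennreal_1)
qed

lemma expected_alive_origin: "expected_alive (indicator {0}) u = emeasure env {\<omega>. at_origin \<omega> u}"
proof -
  have "expected_alive (indicator {0}) u = (\<integral>\<^sup>+\<omega>. indicator {\<omega>. at_origin \<omega> u} \<omega> \<partial>env)"
    unfolding expected_alive_def by (intro nn_integral_cong) (auto simp: at_origin_def indicator_def)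
  then show ?thesis
    using sets_at_origin[of u] by (simp add: pred_def)
qed

text \<open>If the mean number of particles at the origin at time \<open>n\<close> were at most \<open>exp ((r - \<epsilon>) * n)\<close> for
  all \<open>n \<ge> 1\<close>, the series \<open>green 0\<close> would be dominated by a geometric one. Working with some \<open>n\<close>, not with
  all large \<open>n\<close>, makes the argument insensitive to the period of the walk.\<close>

lemma ex_supercritical_block:
  assumes "\<epsilon> > 0"
  shows "\<exists>n \<Lambda>. n \<ge> 1 \<and> finite \<Lambda> \<and> \<Lambda> \<subseteq> {u. length u = n} \<and>
    exp ((r - \<epsilon>) * real n) < (\<Sum>u\<in>\<Lambda>. measure env {\<omega>. at_origin \<omega> u})"
proof -
  let ?g = "\<lambda>n. (mean_op ^^ n) (indicator {0}) 0"
  have "\<exists>n\<ge>1. ennreal (exp ((r - \<epsilon>) * real n)) < ?g n"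
  proof (rule ccontr)
    assume none: "\<not> ?thesis"
    then have le: "?g n \<le> ennreal (exp ((r - \<epsilon>) * real n))" for n
    proof (cases "n = 0")
      case False
      then have "n \<ge> 1" by simp
      then show ?thesis using none not_less by blast
    qed simp
    have "green 0 \<le> (\<Sum>n. ennreal (exp (- \<epsilon>) ^ n))"
      unfolding green_def
    proof (intro suminf_le)
      fix n
      have "ennreal (exp (- r)) ^ n * ?g n \<le> ennreal (exp (- r)) ^ n * ennreal (exp ((r - \<epsilon>) * real n))"
        by (intro mult_left_mono le) simp
      also have "\<dots> = ennreal (exp (- r) ^ n * exp ((r - \<epsilon>) * real n))"
        by (simp add: ennreal_power ennreal_mult)
      also have "exp (- r) ^ n * exp ((r - \<epsilon>) * real n) = exp (- \<epsilon>) ^ n"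
        by (simp add: exp_of_nat_mult[symmetric] exp_add[symmetric] algebra_simps)
      finally show "ennreal (exp (- r)) ^ n * ?g n \<le> ennreal (exp (- \<epsilon>) ^ n)" .
    qed simp_all
    also have "\<dots> = ennreal (\<Sum>n. exp (- \<epsilon>) ^ n)"
      using assms by (intro suminf_ennreal2 summable_geometric) simp_all
    finally show False by (simp add: green_infinite top_unique)
  qed
  then obtain n where n: "n \<ge> 1" "ennreal (exp ((r - \<epsilon>) * real n)) < ?g n" by blast
  then have "ennreal (exp ((r - \<epsilon>) * real n)) < generation_sum n (\<lambda>u. emeasure env {\<omega>. at_origin \<omega> u})"
    by (simp add: many_to_one[symmetric] expected_alive_origin[symmetric])
  from generation_sum_finite_approx[OF this] obtain \<Lambda> where
    \<Lambda>: "finite \<Lambda>" "\<Lambda> \<subseteq> {u. length u = n}"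
      "ennreal (exp ((r - \<epsilon>) * real n)) < (\<Sum>u\<in>\<Lambda>. emeasure env {\<omega>. at_origin \<omega> u})"
    by blast
  then show ?thesis
    using n(1) by (intro exI[of _ n] exI[of _ \<Lambda>]) (simp add: env.emeasure_eq_measure sum_ennreal ennreal_less_iff)
qed

end

section \<open>Excursions above the origin\<close>

context catalytic_laws
begin

text \<open>One step of the walk killed when it enters the nonpositive half-line. A particle that stays
  positive does not branch, so its trajectory is one of a plain walk.\<close>

definition stay_op :: "(int \<Rightarrow> ennreal) \<Rightarrow> int \<Rightarrow> ennreal" where
  "stay_op f = shift_mean (\<lambda>x. indicator {0<..} x * f x)"

definition above :: "real \<Rightarrow> int \<Rightarrow> ennreal" where
  "above a = indicator {x. a \<le> real_of_int x}"

lemma shift_mean_mono_arg: "(\<And>y. f (x + y) \<le> g (x' + y)) \<Longrightarrow> shift_mean f x \<le> shift_mean g x'"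
  unfolding shift_mean_def by (rule nn_integral_mono)

lemma stay_above_mono: "x \<le> y \<Longrightarrow> (stay_op ^^ k) (above a) x \<le> (stay_op ^^ k) (above a) y"
proof (induction k arbitrary: x y)
  case 0
  then show ?case by (auto simp: above_def indicator_def)
next
  case (Suc k)
  show ?case
    unfolding funpow.simps comp_def stay_op_def[of "(stay_op ^^ k) (above a)"]
  proof (rule shift_mean_mono_arg)
    fix z
    show "indicator {0<..} (x + z) * (stay_op ^^ k) (above a) (x + z)
        \<le> indicator {0<..} (y + z) * (stay_op ^^ k) (above a) (y + z)"
      using Suc.IH[of "x + z" "y + z"] Suc.prems by (auto simp: indicator_def)
  qed
qed

text \<open>A walk that ends above \<open>a > 0\<close> either stays positive after its start or has a last time at which it is
  nonpositive. After that time it is a positive path, of some length \<open>i < k\<close>, and it would climb at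
  least as well if it started at the origin, by monotonicity in the starting point.\<close>

lemma last_exit_decomposition:
  assumes "a > 0"
  shows "(shift_mean ^^ k) (above a) y \<le> (stay_op ^^ k) (above a) y + (\<Sum>i<k. (stay_op ^^ i) (above a) 0)"
proof (induction k arbitrary: y)
  case (Suc k)
  let ?c = "\<Sum>i<k. (stay_op ^^ i) (above a) 0" and ?d = "(stay_op ^^ k) (above a) 0"
  have "(shift_mean ^^ Suc k) (above a) y \<le> shift_mean (\<lambda>x. (stay_op ^^ k) (above a) x + ?c) y"
    using Suc by (auto intro: shift_mean_mono)
  also have "\<dots> \<le> shift_mean (\<lambda>x. indicator {0<..} x * (stay_op ^^ k) (above a) x + (?c + ?d)) y"
  proof (rule shift_mean_mono)
    fix x :: int
    show "(stay_op ^^ k) (above a) x + ?c \<le> indicator {0<..} x * (stay_op ^^ k) (above a) x + (?c + ?d)"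
    proof (cases "x > 0")
      case True
      then show ?thesis by simp
    next
      case False
      then have "(stay_op ^^ k) (above a) x \<le> ?d" by (intro stay_above_mono) simp
      then show ?thesis using False by (simp add: add.commute add_left_mono)
    qed
  qed
  also have "\<dots> = (stay_op ^^ Suc k) (above a) y + (\<Sum>i<Suc k. (stay_op ^^ i) (above a) 0)"
    by (simp add: shift_mean_add shift_mean_const stay_op_def)
  finally show ?case .
qed simp

text \<open>Additional upward steps at the beginning: they cost a constant factor each, keep the path
  positive and only raise its end. They serve to adjust the length of a path.\<close>

lemma stay_above_extend:
  assumes "d > 0"
  shows "ennreal (pmf p d) ^ e * (stay_op ^^ k) (above a) 0 \<le> (stay_op ^^ (k + e)) (above a) 0"
proof (induction e)
  case (Suc e)
  have "ennreal (pmf p d) * (stay_op ^^ (k + e)) (above a) 0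
      \<le> ennreal (pmf p d) * (stay_op ^^ (k + e)) (above a) d"
    using assms by (intro mult_left_mono stay_above_mono) simp_all
  also have "\<dots> = (\<integral>\<^sup>+y. indicator {d} y * (stay_op ^^ (k + e)) (above a) d \<partial>measure_pmf p)"
    by (simp add: nn_integral_multc emeasure_pmf_single)
  also have "\<dots> \<le> (stay_op ^^ Suc (k + e)) (above a) 0"
    using assms unfolding funpow.simps comp_def stay_op_def[of "(stay_op ^^ (k + e)) (above a)"] shift_mean_def
    by (intro nn_integral_mono) (auto simp: indicator_def)
  finally have "ennreal (pmf p d) * (stay_op ^^ (k + e)) (above a) 0 \<le> (stay_op ^^ (k + Suc e)) (above a) 0"
    by simp
  moreover have "ennreal (pmf p d) ^ Suc e * (stay_op ^^ k) (above a) 0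
      \<le> ennreal (pmf p d) * (stay_op ^^ (k + e)) (above a) 0"
    using Suc by (simp add: mult.assoc mult_left_mono)
  ultimately show ?case by (rule order_trans[rotated])
qed simp

text \<open>The line of first children from the root makes an excursion above the origin. Only the root has to reproduce,
  which is the reason for the factor \<open>nonbarren\<close> below.\<close>

definition follows_first :: "nat \<Rightarrow> (nat list \<times> nat \<Rightarrow> int) \<Rightarrow> bool" where
  "follows_first k \<omega> \<longleftrightarrow> 0 < offspring \<omega> [] \<and> (\<forall>i\<in>{1..k}. 0 < pos \<omega> (replicate i 0))"

lemma follows_first_Suc:
  "follows_first (Suc k) \<omega> \<longleftrightarrow> follows_first k \<omega> \<and> 0 < pos \<omega> (0 # replicate k 0)"
  by (auto simp: follows_first_def atLeastAtMostSuc_conv simp del: position.simps)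

lemma follows_first_lives: "follows_first k \<omega> \<Longrightarrow> lives \<omega> (replicate k 0)"
proof (induction k)
  case (Suc k)
  then have "follows_first k \<omega>" by (simp add: follows_first_Suc)
  moreover have "0 < pos \<omega> (replicate k 0)" if "1 \<le> k"
    using \<open>follows_first k \<omega>\<close> that by (simp add: follows_first_def)
  then have "pos \<omega> (replicate k 0) = 0 \<Longrightarrow> k = 0"
    by (cases "k = 0") auto
  ultimately show ?case
    using Suc.IH by (auto simp: follows_first_def)
qed simp

lemma measurable_follows_first [measurable]: "Measurable.pred env (follows_first k)"
  unfolding follows_first_def[abs_def]
  by (intro pred_intros_logic pred_intros_finite) measurable

lemma follows_first_upd: "follows_first k (fun_upd \<omega> (replicate k 0, Suc i) x) = follows_first k \<omega>"
proof -
  have "pos (fun_upd \<omega> (replicate k 0, Suc i) x) (replicate j 0) = pos \<omega> (replicate j 0)" if "j \<le> k" for j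
    using that by (intro pos_upd) simp
  then show ?thesis by (auto simp: follows_first_def offspring_upd)
qed

lemma sets_nonbarren: "{\<omega>. 0 < offspring \<omega> []} \<in> sets env"
proof -
  have "Measurable.pred env (\<lambda>\<omega>. 0 < offspring \<omega> [])" by measurable
  then show ?thesis by (simp add: pred_def)
qed

definition nonbarren :: ennreal where
  "nonbarren = emeasure env {\<omega>. 0 < offspring \<omega> []}"

lemma nn_integral_follows_first:
  "(\<integral>\<^sup>+\<omega>. indicator {\<omega>. follows_first k \<omega>} \<omega> * f (pos \<omega> (replicate k 0)) \<partial>env)
    = nonbarren * (stay_op ^^ k) f 0"
proof (induction k arbitrary: f)
  case 0
  show ?case
    by (simp add: follows_first_def nonbarren_def nn_integral_multc sets_nonbarren)
next
  case (Suc k)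
  have "(\<integral>\<^sup>+\<omega>. indicator {\<omega>. follows_first (Suc k) \<omega>} \<omega> * f (pos \<omega> (replicate (Suc k) 0)) \<partial>env)
      = (\<integral>\<^sup>+\<omega>. indicator {\<omega>. follows_first k \<omega>} \<omega> *
          (indicator {0<..} (pos \<omega> (0 # replicate k 0)) * f (pos \<omega> (0 # replicate k 0))) \<partial>env)"
    by (intro nn_integral_cong) (auto simp: follows_first_Suc indicator_def)
  also have "\<dots> = (\<integral>\<^sup>+\<omega>. indicator {\<omega>. follows_first k \<omega>} \<omega> * stay_op f (pos \<omega> (replicate k 0)) \<partial>env)"
    unfolding stay_op_def
    by (rule nn_integral_displacement[where f = "\<lambda>x. indicator {0<..} x * f x"])
       (simp_all add: follows_first_upd indicator_def)
  also have "\<dots> = nonbarren * (stay_op ^^ Suc k) f 0"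
    unfolding Suc by (simp add: funpow_swap1)
  finally show ?case .
qed

lemma emeasure_reach_ge:
  "nonbarren * (stay_op ^^ k) (above a) 0
    \<le> emeasure env {\<omega>. reaches k a \<omega>}"
proof -
  have "nonbarren * (stay_op ^^ k) (above a) 0
      = (\<integral>\<^sup>+\<omega>. indicator {\<omega>. follows_first k \<omega>} \<omega> * above a (pos \<omega> (replicate k 0)) \<partial>env)"
    by (rule nn_integral_follows_first[symmetric])
  also have "\<dots> \<le> (\<integral>\<^sup>+\<omega>. indicator {\<omega>. reaches k a \<omega>} \<omega> \<partial>env)"
  proof (rule nn_integral_mono)
    fix \<omega>
    show "indicator {\<omega>. follows_first k \<omega>} \<omega> * above a (pos \<omega> (replicate k 0))
        \<le> indicator {\<omega>. reaches k a \<omega>} \<omega>"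
      using follows_first_lives[of k \<omega>] length_replicate[of k 0]
      by (auto simp: reaches_def above_def indicator_def simp del: length_replicate)
  qed
  also have "\<dots> = emeasure env {\<omega>. reaches k a \<omega>}"
    by (simp add: sets_reaches)
  finally show ?thesis .
qed

end

context catalytic_walk
begin

lemma nonbarren_pos: "nonbarren > 0"
proof (rule ccontr)
  assume "\<not> nonbarren > 0"
  then have "AE \<omega> in env. \<not> 0 < offspring \<omega> []"
    by (subst AE_iff_measurable[OF _ refl]) (auto simp: nonbarren_def sets_nonbarren)
  then have "(\<integral>\<^sup>+\<omega>. of_nat (offspring \<omega> []) \<partial>env) = 0"
    by (subst nn_integral_0_iff_AE) auto
  moreover have "(\<integral>\<^sup>+\<omega>. of_nat (offspring \<omega> []) \<partial>env) = mean_children"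
    by (subst resample[of _ "([], 0)"])
       (simp_all add: offspring_def nn_integral_coord_offspring env.emeasure_space_1[simplified])
  ultimately show False using m_pos by (simp add: mean_children_eq)
qed

section \<open>Large deviations of the walk by exponential tilting\<close>

text \<open>The density, with respect to \<open>p\<close>, of the step law tilted by \<open>t0\<close>; it has total mass one since
  \<open>r\<close> is the value of the log-Laplace transform at \<open>t0\<close>.\<close>

definition tilt :: "int \<Rightarrow> real" where
  "tilt y = exp (t0 * real_of_int y - r)"

definition tilt_mean :: "(int \<Rightarrow> ennreal) \<Rightarrow> int \<Rightarrow> ennreal" where
  "tilt_mean f x = (\<integral>\<^sup>+y. ennreal (tilt y) * f (x + y) \<partial>measure_pmf p)"

lemma tilt_mean_power:
  "(shift_mean ^^ k) (\<lambda>x. ennreal (exp (t0 * real_of_int x)) * f x) y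
    = ennreal (exp (t0 * real_of_int y + r * real k)) * (tilt_mean ^^ k) f y"
proof (induction k arbitrary: y)
  case (Suc k)
  have "(shift_mean ^^ Suc k) (\<lambda>x. ennreal (exp (t0 * real_of_int x)) * f x) y
      = (\<integral>\<^sup>+z. ennreal (exp (t0 * real_of_int (y + z) + r * real k)) * (tilt_mean ^^ k) f (y + z) \<partial>measure_pmf p)"
    by (simp add: Suc shift_mean_def)
  also have "\<dots> = (\<integral>\<^sup>+z. ennreal (exp (t0 * real_of_int y + r * real (Suc k))) *
      (ennreal (tilt z) * (tilt_mean ^^ k) f (y + z)) \<partial>measure_pmf p)"
  proof (rule nn_integral_cong)
    fix z
    have "exp (t0 * real_of_int (y + z) + r * real k) = exp (t0 * real_of_int y + r * real (Suc k)) * tilt z"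
      by (simp add: tilt_def exp_add[symmetric] algebra_simps)
    then show "ennreal (exp (t0 * real_of_int (y + z) + r * real k)) * (tilt_mean ^^ k) f (y + z)
        = ennreal (exp (t0 * real_of_int y + r * real (Suc k))) * (ennreal (tilt z) * (tilt_mean ^^ k) f (y + z))"
      by (simp add: ennreal_mult tilt_def mult.assoc)
  qed
  also have "\<dots> = ennreal (exp (t0 * real_of_int y + r * real (Suc k))) * (tilt_mean ^^ Suc k) f y"
    by (simp add: nn_integral_cmult tilt_mean_def)
  finally show ?case .
qed simp

lemma nn_integral_tilt: "(\<integral>\<^sup>+y. ennreal (tilt y) \<partial>measure_pmf p) = 1"
proof -
  have "(\<integral>\<^sup>+y. ennreal (tilt y) \<partial>measure_pmf p)
      = (\<integral>\<^sup>+y. ennreal (exp (- r)) * ennreal (exp (t0 * real_of_int y)) \<partial>measure_pmf p)"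
    by (simp add: tilt_def ennreal_mult[symmetric] exp_add[symmetric])
  also have "\<dots> = ennreal (exp (- r) * exp r)"
    by (simp add: nn_integral_cmult laplace_t0 ennreal_mult)
  finally show ?thesis by (simp add: exp_add[symmetric])
qed

lemma tilt_nonneg [simp]: "0 \<le> tilt y"
  by (simp add: tilt_def)

lemma integrable_tilt: "integrable (measure_pmf p) tilt" and integral_tilt: "(\<integral>y. tilt y \<partial>measure_pmf p) = 1"
proof -
  show "integrable (measure_pmf p) tilt"
    by (rule integrableI_nonneg) (simp_all add: nn_integral_tilt)
  show "(\<integral>y. tilt y \<partial>measure_pmf p) = 1"
    by (subst integral_eq_nn_integral) (simp_all add: nn_integral_tilt)
qed

lemma integrable_exp_t1: "integrable (measure_pmf p) (\<lambda>y. exp (t1 * real_of_int y))"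
  by (rule integrableI_nonneg) (use laplace_t1 in simp_all)

lemma square_le_exp: "x ^ 2 \<le> 2 * exp x" if "0 \<le> x" for x :: real
  using exp_lower_Taylor_quadratic[OF that] that by simp

text \<open>For large positive values the square is absorbed by moving from \<open>t0\<close> to \<open>t1\<close>, and for negative
  values by the factor \<open>exp (t0 * y)\<close> itself.\<close>

lemma integrable_square_tilt: "integrable (measure_pmf p) (\<lambda>y. (real_of_int y)\<^sup>2 * tilt y)"
proof -
  define d where "d = t1 - t0"
  have d: "d > 0" using t1_gt by (simp add: d_def)
  define C where "C = 2 / d\<^sup>2 + 2 / t0\<^sup>2"
  have bound: "y\<^sup>2 * exp (t0 * y) \<le> C * (exp (t1 * y) + 1)" for y :: real
  proof (cases "y \<ge> 0")
    case True
    have "(d * y)\<^sup>2 \<le> 2 * exp (d * y)" using True d by (intro square_le_exp) simp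
    then have "y\<^sup>2 \<le> 2 / d\<^sup>2 * exp (d * y)" using d by (simp add: power_mult_distrib field_simps)
    then have "y\<^sup>2 * exp (t0 * y) \<le> 2 / d\<^sup>2 * exp (d * y) * exp (t0 * y)" by (rule mult_right_mono) simp
    also have "\<dots> = 2 / d\<^sup>2 * exp (t1 * y)" by (simp add: d_def exp_add[symmetric] algebra_simps)
    also have "\<dots> \<le> C * (exp (t1 * y) + 1)" unfolding C_def by (intro mult_mono) auto
    finally show ?thesis .
  next
    case False
    have "(t0 * (- y))\<^sup>2 \<le> 2 * exp (t0 * (- y))" using False t0_pos by (intro square_le_exp) (simp add: mult_nonneg_nonpos)
    then have "y\<^sup>2 \<le> 2 / t0\<^sup>2 * exp (t0 * (- y))" using t0_pos by (simp add: power_mult_distrib field_simps)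
    then have "y\<^sup>2 * exp (t0 * y) \<le> 2 / t0\<^sup>2 * exp (t0 * (- y)) * exp (t0 * y)" by (rule mult_right_mono) simp
    also have "\<dots> = 2 / t0\<^sup>2" by (simp add: exp_add[symmetric])
    also have "\<dots> \<le> C * (exp (t1 * y) + 1)" unfolding C_def by (rule order_trans[OF _ mult_left_mono[of 1]]) auto
    finally show ?thesis .
  qed
  show ?thesis
  proof (rule Bochner_Integration.integrable_bound[where f = "\<lambda>y. exp (- r) * (C * (exp (t1 * real_of_int y) + 1))"])
    show "integrable (measure_pmf p) (\<lambda>y. exp (- r) * (C * (exp (t1 * real_of_int y) + 1)))"
      using integrable_exp_t1 by (intro integrable_mult_right integrable_add) simp_all
    show "AE y in measure_pmf p. norm ((real_of_int y)\<^sup>2 * tilt y) \<le> norm (exp (- r) * (C * (exp (t1 * real_of_int y) + 1)))"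
    proof (rule AE_I2)
      fix y
      have "(real_of_int y)\<^sup>2 * tilt y = exp (- r) * ((real_of_int y)\<^sup>2 * exp (t0 * real_of_int y))"
        by (simp add: tilt_def exp_diff exp_minus field_simps)
      also have "\<dots> \<le> exp (- r) * (C * (exp (t1 * real_of_int y) + 1))"
        by (intro mult_left_mono bound) simp
      finally show "norm ((real_of_int y)\<^sup>2 * tilt y) \<le> norm (exp (- r) * (C * (exp (t1 * real_of_int y) + 1)))"
        by (simp add: abs_mult C_def)
    qed
  qed simp
qed

lemma integrable_linear_tilt: "integrable (measure_pmf p) (\<lambda>y. real_of_int y * tilt y)"
proof (rule Bochner_Integration.integrable_bound[where f = "\<lambda>y. tilt y + (real_of_int y)\<^sup>2 * tilt y"])
  show "integrable (measure_pmf p) (\<lambda>y. tilt y + (real_of_int y)\<^sup>2 * tilt y)"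
    by (intro Bochner_Integration.integrable_add integrable_tilt integrable_square_tilt)
  show "AE y in measure_pmf p. norm (real_of_int y * tilt y) \<le> norm (tilt y + (real_of_int y)\<^sup>2 * tilt y)"
  proof (rule AE_I2)
    fix y
    have "\<bar>real_of_int y\<bar> \<le> 1 + (real_of_int y)\<^sup>2"
      using sum_power2_ge_zero[of "\<bar>real_of_int y\<bar> - 1" 0] by (simp add: power2_eq_square algebra_simps)
    then have "\<bar>real_of_int y\<bar> * tilt y \<le> (1 + (real_of_int y)\<^sup>2) * tilt y"
      by (rule mult_right_mono) simp
    then show "norm (real_of_int y * tilt y) \<le> norm (tilt y + (real_of_int y)\<^sup>2 * tilt y)"
      by (simp add: abs_mult distrib_right)
  qed
qed simp

definition drift :: real where
  "drift = (\<integral>y. real_of_int y * tilt y \<partial>measure_pmf p)"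

definition tilt_variance :: real where
  "tilt_variance = (\<integral>y. (real_of_int y)\<^sup>2 * tilt y \<partial>measure_pmf p) - drift\<^sup>2"

lemma shifted_square_tilt:
  "integrable (measure_pmf p) (\<lambda>y. (a + real_of_int y)\<^sup>2 * tilt y)"
  "(\<integral>y. (a + real_of_int y)\<^sup>2 * tilt y \<partial>measure_pmf p) = (a + drift)\<^sup>2 + tilt_variance"
proof -
  have eq: "(a + real_of_int y)\<^sup>2 * tilt y
      = a\<^sup>2 * tilt y + (2 * a) * (real_of_int y * tilt y) + (real_of_int y)\<^sup>2 * tilt y" for y
    by (simp add: power2_eq_square algebra_simps)
  show "integrable (measure_pmf p) (\<lambda>y. (a + real_of_int y)\<^sup>2 * tilt y)"
    unfolding eq by (intro Bochner_Integration.integrable_add integrable_mult_right integrable_tilt integrable_linear_tilt integrable_square_tilt)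
  have "(\<integral>y. (a + real_of_int y)\<^sup>2 * tilt y \<partial>measure_pmf p)
      = a\<^sup>2 * 1 + (2 * a) * drift + (tilt_variance + drift\<^sup>2)"
    unfolding eq
    by (simp add: Bochner_Integration.integral_add integrable_tilt integrable_linear_tilt integrable_square_tilt
        integral_tilt drift_def[symmetric] tilt_variance_def)
  then show "(\<integral>y. (a + real_of_int y)\<^sup>2 * tilt y \<partial>measure_pmf p) = (a + drift)\<^sup>2 + tilt_variance"
    by (simp add: power2_eq_square algebra_simps)
qed

lemma tilt_variance_nonneg: "0 \<le> tilt_variance"
proof -
  have "0 \<le> (\<integral>y. (- drift + real_of_int y)\<^sup>2 * tilt y \<partial>measure_pmf p)"
    by (intro integral_nonneg_AE AE_I2) simp
  then show ?thesis unfolding shifted_square_tilt(2) by simp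
qed

text \<open>Jensen's inequality: \<open>exp (r - t0 * y)\<close> has tilted mean one, so its exponent has nonpositive tilted mean.\<close>

lemma drift_ge: "r / t0 \<le> drift"
proof -
  have "(\<integral>y. (1 + r) * tilt y - t0 * (real_of_int y * tilt y) \<partial>measure_pmf p) \<le> (\<integral>y. 1 \<partial>measure_pmf p)"
  proof (rule integral_mono)
    fix y
    have "1 + r - t0 * real_of_int y \<le> exp (- (t0 * real_of_int y - r))"
      using exp_ge_add_one_self[of "- (t0 * real_of_int y - r)"] by linarith
    then have "(1 + r - t0 * real_of_int y) * tilt y \<le> exp (- (t0 * real_of_int y - r)) * tilt y"
      by (rule mult_right_mono) simp
    then show "(1 + r) * tilt y - t0 * (real_of_int y * tilt y) \<le> 1"
      by (simp add: tilt_def exp_add[symmetric] algebra_simps)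
  qed (intro Bochner_Integration.integrable_diff integrable_mult_right integrable_tilt integrable_linear_tilt, simp)
  then have "1 + r - t0 * drift \<le> 1"
    by (simp add: Bochner_Integration.integral_diff integrable_tilt integrable_linear_tilt integral_tilt drift_def)
  then show ?thesis using t0_pos by (simp add: field_simps)
qed

lemma tilt_mean_const: "tilt_mean (\<lambda>x. c) x = c"
  by (simp add: tilt_mean_def nn_integral_multc nn_integral_tilt)

lemma tilt_mean_add: "tilt_mean (\<lambda>x. f x + g x) x = tilt_mean f x + tilt_mean g x"
  by (simp add: tilt_mean_def distrib_left nn_integral_add)

lemma tilt_mean_cmult: "tilt_mean (\<lambda>x. c * f x) x = c * tilt_mean f x"
proof -
  have "tilt_mean (\<lambda>x. c * f x) x = (\<integral>\<^sup>+y. c * (ennreal (tilt y) * f (x + y)) \<partial>measure_pmf p)"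
    by (simp add: tilt_mean_def ac_simps)
  then show ?thesis by (simp add: tilt_mean_def nn_integral_cmult)
qed

lemma tilt_mean_mono: "(\<And>x. f x \<le> g x) \<Longrightarrow> tilt_mean f x \<le> tilt_mean g x"
  unfolding tilt_mean_def by (intro nn_integral_mono mult_left_mono) simp_all

lemma tilt_mean_power_linear:
  "(tilt_mean ^^ k) (\<lambda>x. f x + c * g x) x = (tilt_mean ^^ k) f x + c * (tilt_mean ^^ k) g x"
proof (induction k arbitrary: x)
  case (Suc k)
  then have "(tilt_mean ^^ k) (\<lambda>x. f x + c * g x) = (\<lambda>x. (tilt_mean ^^ k) f x + c * (tilt_mean ^^ k) g x)"
    by (rule ext)
  then show ?case by (simp add: tilt_mean_add tilt_mean_cmult)
qed simp

lemma tilt_mean_power_mono: "(\<And>x. f x \<le> g x) \<Longrightarrow> (tilt_mean ^^ k) f x \<le> (tilt_mean ^^ k) g x"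
  by (induction k arbitrary: x) (simp_all add: tilt_mean_mono)

lemma tilt_mean_power_const: "(tilt_mean ^^ k) (\<lambda>x. c) x = c"
proof (induction k arbitrary: x)
  case (Suc k)
  then have "(tilt_mean ^^ k) (\<lambda>x. c) = (\<lambda>x. c)"
    by (rule ext)
  then show ?case by (simp add: tilt_mean_const)
qed simp

lemma tilt_mean_square:
  "tilt_mean (\<lambda>x. ennreal ((real_of_int x - c)\<^sup>2 + b)) x = ennreal ((real_of_int x + drift - c)\<^sup>2 + tilt_variance + b)"
  if "b \<ge> 0"
proof -
  have "tilt_mean (\<lambda>x. ennreal ((real_of_int x - c)\<^sup>2)) x
      = (\<integral>\<^sup>+y. ennreal (((real_of_int x - c) + real_of_int y)\<^sup>2 * tilt y) \<partial>measure_pmf p)"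
    by (simp add: tilt_mean_def ennreal_mult[symmetric] algebra_simps)
  also have "\<dots> = ennreal ((real_of_int x - c + drift)\<^sup>2 + tilt_variance)"
    by (subst nn_integral_eq_integral) (simp_all add: shifted_square_tilt)
  finally have "tilt_mean (\<lambda>x. ennreal ((real_of_int x - c)\<^sup>2)) x = ennreal ((real_of_int x - c + drift)\<^sup>2 + tilt_variance)" .
  then show ?thesis
    using that tilt_variance_nonneg by (simp add: tilt_mean_add tilt_mean_const algebra_simps ennreal_plus[symmetric] del: ennreal_plus)
      (simp add: tilt_mean_add tilt_mean_const algebra_simps)
qed

lemma tilt_mean_power_square:
  "(tilt_mean ^^ k) (\<lambda>x. ennreal ((real_of_int x - c)\<^sup>2)) x
    = ennreal ((real_of_int x + k * drift - c)\<^sup>2 + k * tilt_variance)"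
proof (induction k arbitrary: x)
  case (Suc k)
  have "(tilt_mean ^^ Suc k) (\<lambda>x. ennreal ((real_of_int x - c)\<^sup>2)) x
      = tilt_mean (\<lambda>x. ennreal ((real_of_int x - (c - k * drift))\<^sup>2 + k * tilt_variance)) x"
  proof -
    have "(tilt_mean ^^ k) (\<lambda>x. ennreal ((real_of_int x - c)\<^sup>2))
        = (\<lambda>x. ennreal ((real_of_int x - (c - k * drift))\<^sup>2 + k * tilt_variance))"
      by (rule ext, subst Suc) (simp add: algebra_simps)
    then show ?thesis by simp
  qed
  also have "\<dots> = ennreal ((real_of_int x + drift - (c - k * drift))\<^sup>2 + tilt_variance + k * tilt_variance)"
    using tilt_variance_nonneg by (intro tilt_mean_square) simp
  finally show ?case by (simp add: algebra_simps)
qed simp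

text \<open>Chebyshev's inequality under the tilted law. The tilted mean of the squared deviation from
  \<open>k * drift\<close> is \<open>k * tilt_variance\<close>.\<close>

lemma tilted_concentration:
  assumes "\<delta> > 0" "k \<ge> 1" "2 * tilt_variance \<le> \<delta>\<^sup>2 * real k"
  shows "ennreal (1 / 2) \<le> (tilt_mean ^^ k) (indicator {x. \<bar>real_of_int x - k * drift\<bar> \<le> \<delta> * k}) 0"
    (is "_ \<le> (tilt_mean ^^ k) ?\<phi> 0")
proof -
  let ?c = "1 / (\<delta> * k)\<^sup>2"
  have pointwise: "1 \<le> ?\<phi> x + ennreal ?c * ennreal ((real_of_int x - k * drift)\<^sup>2)" for x
  proof (cases "\<bar>real_of_int x - k * drift\<bar> \<le> \<delta> * k")
    case False
    then have "(\<delta> * k)\<^sup>2 \<le> (real_of_int x - k * drift)\<^sup>2"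
      using assms by (intro abs_le_square_iff[THEN iffD1]) (simp add: abs_mult)
    then have "1 \<le> ?c * (real_of_int x - k * drift)\<^sup>2"
      using assms by (simp add: field_simps)
    then have "ennreal 1 \<le> ennreal ?c * ennreal ((real_of_int x - k * drift)\<^sup>2)"
      by (subst ennreal_mult[symmetric]) (auto intro: ennreal_leI)
    then show ?thesis using False by simp
  qed simp
  have "1 \<le> (tilt_mean ^^ k) (\<lambda>x. ?\<phi> x + ennreal ?c * ennreal ((real_of_int x - k * drift)\<^sup>2)) 0"
    using tilt_mean_power_mono[of "\<lambda>x. 1", OF pointwise, of k 0] by (simp add: tilt_mean_power_const)
  then have "1 \<le> (tilt_mean ^^ k) ?\<phi> 0 + ennreal ?c * ennreal (k * tilt_variance)"
    by (simp add: tilt_mean_power_linear tilt_mean_power_square)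
  also have "ennreal ?c * ennreal (k * tilt_variance) \<le> ennreal (1 / 2)"
  proof -
    have "?c * (k * tilt_variance) = tilt_variance / (\<delta>\<^sup>2 * real k)"
      using assms by (simp add: power2_eq_square)
    also have "\<dots> \<le> 1 / 2" using assms by (simp add: field_simps)
    finally show ?thesis
      using tilt_variance_nonneg ennreal_leI[of "?c * (k * tilt_variance)" "1 / 2"] ennreal_mult[of ?c "k * tilt_variance"]
      by (metis divide_nonneg_nonneg mult_nonneg_nonneg of_nat_0_le_iff zero_le_one zero_le_power2)
  qed
  finally have *: "1 \<le> (tilt_mean ^^ k) ?\<phi> 0 + ennreal (1 / 2)"
    by (simp add: add_left_mono)
  show ?thesis
  proof (cases "(tilt_mean ^^ k) ?\<phi> 0")
    case (real z)
    then have "ennreal 1 \<le> ennreal (z + 1 / 2)" using * by simp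
    then have "1 \<le> z + 1 / 2" using real by (subst (asm) ennreal_le_iff) auto
    then have "ennreal (1 / 2) \<le> ennreal z" by (intro ennreal_leI) simp
    then show ?thesis using real by metis
  qed simp
qed

text \<open>On paths that end within \<open>\<delta> * k\<close> of \<open>k * drift\<close> the density of the original law with respect to the tilted one
  is at least \<open>exp (- (t0 * (drift + \<delta>) - r) * k)\<close>.\<close>

lemma large_deviation_lower:
  assumes "\<delta> > 0" "k \<ge> 1" "2 * tilt_variance \<le> \<delta>\<^sup>2 * real k" "a \<le> (drift - \<delta>) * k"
  shows "ennreal (exp (- (t0 * (drift + \<delta>) - r) * k) / 2) \<le> (shift_mean ^^ k) (above a) 0"
proof -
  let ?\<phi> = "indicator {x. \<bar>real_of_int x - k * drift\<bar> \<le> \<delta> * k} :: int \<Rightarrow> ennreal"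
  let ?e = "exp (- (t0 * (drift + \<delta>) * k))"
  have "ennreal (exp (- (t0 * (drift + \<delta>) - r) * k) / 2) = ennreal (?e * exp (r * k)) * ennreal (1 / 2)"
    by (subst ennreal_mult[symmetric]) (simp_all add: exp_add[symmetric] algebra_simps)
  also have "\<dots> \<le> ennreal (?e * exp (r * k)) * (tilt_mean ^^ k) ?\<phi> 0"
    by (intro mult_left_mono tilted_concentration assms) simp
  also have "\<dots> = ennreal ?e * (shift_mean ^^ k) (\<lambda>x. ennreal (exp (t0 * real_of_int x)) * ?\<phi> x) 0"
    by (simp add: tilt_mean_power ennreal_mult mult.assoc)
  also have "\<dots> = (shift_mean ^^ k) (\<lambda>x. ennreal ?e * (ennreal (exp (t0 * real_of_int x)) * ?\<phi> x)) 0"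
  proof -
    have "(shift_mean ^^ k) (\<lambda>x. c * f x) y = c * (shift_mean ^^ k) f y" for c f y
    proof (induction k arbitrary: y)
      case (Suc k)
      then have "(shift_mean ^^ k) (\<lambda>x. c * f x) = (\<lambda>y. c * (shift_mean ^^ k) f y)"
        by (rule ext)
      then show ?case by (simp add: shift_mean_cmult)
    qed simp
    then show ?thesis by simp
  qed
  also have "\<dots> \<le> (shift_mean ^^ k) (above a) 0"
  proof -
    have mono: "(shift_mean ^^ k) f y \<le> (shift_mean ^^ k) g y" if "\<And>x. f x \<le> g x" for f g y
      using that by (induction k arbitrary: y) (simp_all add: shift_mean_mono)
    show ?thesis
    proof (rule mono)
      fix x :: int
      show "ennreal ?e * (ennreal (exp (t0 * real_of_int x)) * ?\<phi> x) \<le> above a x"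
      proof (cases "\<bar>real_of_int x - k * drift\<bar> \<le> \<delta> * k")
        case True
        then have x: "real_of_int x \<le> (drift + \<delta>) * k" "a \<le> real_of_int x"
          using assms(4) by (simp_all add: abs_le_iff algebra_simps)
        have "t0 * real_of_int x \<le> t0 * ((drift + \<delta>) * k)"
          using x(1) t0_pos by (intro mult_left_mono) simp_all
        then have "?e * exp (t0 * real_of_int x) \<le> 1"
          by (simp add: exp_add[symmetric] mult.assoc)
        then have "ennreal ?e * ennreal (exp (t0 * real_of_int x)) \<le> ennreal 1"
          by (subst ennreal_mult[symmetric]) (auto intro: ennreal_leI)
        then show ?thesis using True x(2) by (simp add: above_def)
      qed simp
    qed
  qed
  finally show ?thesis .
qed

lemma ex_upward_step: "\<exists>d>0. pmf p d > 0"
proof (rule ccontr)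
  assume "\<not> ?thesis"
  then have np: "d \<le> 0" if "d \<in> set_pmf p" for d
    using that by (auto simp: set_pmf_iff not_less)
  have "(\<integral>\<^sup>+y. ennreal (exp (t0 * real_of_int y)) \<partial>measure_pmf p) \<le> (\<integral>\<^sup>+y. 1 \<partial>measure_pmf p)"
    by (rule nn_integral_mono_AE)
       (use np t0_pos in \<open>auto simp: AE_measure_pmf_iff mult_nonneg_nonpos\<close>)
  then show False
    using r_pos by (simp add: laplace_t0 measure_pmf.emeasure_space_1[simplified])
qed

text \<open>Pigeonhole in the last exit decomposition: one of the \<open>k + 1\<close> possible lengths of the final
  positive piece carries at least the average. This loses a factor \<open>k + 1\<close>, which is negligible on
  the exponential scale.\<close>

lemma ex_stay_bound:
  assumes "a > 0" "ennreal c \<le> (shift_mean ^^ k) (above a) 0" "c > 0"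
  shows "\<exists>i\<le>k. ennreal (c / (real k + 1)) \<le> (stay_op ^^ i) (above a) 0"
proof (rule ccontr)
  assume "\<not> ?thesis"
  then have less: "(stay_op ^^ i) (above a) 0 < ennreal (c / (real k + 1))" if "i < Suc k" for i
    using that by (meson less_Suc_eq_le not_le)
  define z where "z i = enn2real ((stay_op ^^ i) (above a) 0)" for i
  have z: "(stay_op ^^ i) (above a) 0 = ennreal (z i)" "z i < c / (real k + 1)" "0 \<le> z i" if "i < Suc k" for i
    using less[OF that] by (cases "(stay_op ^^ i) (above a) 0"; simp add: z_def ennreal_less_iff)+
  have "ennreal c \<le> (\<Sum>i<Suc k. (stay_op ^^ i) (above a) 0)"
    using assms(2) last_exit_decomposition[OF assms(1), of k 0] by (simp add: add.commute)
  also have "\<dots> = ennreal (\<Sum>i<Suc k. z i)"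
  proof -
    have "(\<Sum>i<Suc k. (stay_op ^^ i) (above a) 0) = (\<Sum>i<Suc k. ennreal (z i))"
      by (rule sum.cong[OF refl]) (use z(1) in blast)
    then show ?thesis using z(3) by (subst sum_ennreal[symmetric]) auto
  qed
  finally have "c \<le> (\<Sum>i<Suc k. z i)"
    using z(3) by (subst (asm) ennreal_le_iff) (auto intro!: sum_nonneg simp del: sum.lessThan_Suc)
  also have "\<dots> < (\<Sum>i<Suc k. c / (real k + 1))"
    using z(2) by (intro sum_strict_mono) auto
  also have "\<dots> = c"
    by (simp del: sum.lessThan_Suc add: add.commute)
  finally show False by simp
qed

end

section \<open>Growth of the number of particles at the origin\<close>

text \<open>The process is looked at only at the multiples of a fixed time, and between two such times only
  the descendants with relative label in \<open>\<Lambda>\<close> are kept. The particles at the origin with label in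
  \<open>blocks \<Lambda> j\<close> dominate a Galton-Watson process with bounded offspring numbers.\<close>

primrec blocks :: "nat list set \<Rightarrow> nat \<Rightarrow> nat list set" where
  "blocks \<Lambda> 0 = {[]}"
| "blocks \<Lambda> (Suc j) = (\<lambda>(v, w). w @ v) ` (blocks \<Lambda> j \<times> \<Lambda>)"

lemma finite_blocks: "finite \<Lambda> \<Longrightarrow> finite (blocks \<Lambda> j)"
  by (induction j) simp_all

lemma length_blocks: "\<Lambda> \<subseteq> {u. length u = n} \<Longrightarrow> v \<in> blocks \<Lambda> j \<Longrightarrow> length v = j * n"
  by (induction j arbitrary: v) auto

lemma exp_minus_le_quadratic: "exp (- y) \<le> 1 - y + y\<^sup>2 / 2" if "0 \<le> y" for y :: real
proof -
  have "0 \<le> y * (y * (y * y))" using that by simp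
  then have "1 \<le> (1 - y + y\<^sup>2 / 2) * (1 + y + y\<^sup>2 / 2)"
    by (simp add: power2_eq_square algebra_simps)
  also have "\<dots> \<le> (1 - y + y\<^sup>2 / 2) * exp y"
  proof (rule mult_left_mono)
    show "1 + y + y\<^sup>2 / 2 \<le> exp y" by (rule exp_lower_Taylor_quadratic[OF that])
    have "0 \<le> (1 - y)\<^sup>2 + 1" by simp
    then show "0 \<le> 1 - y + y\<^sup>2 / 2" by (simp add: power2_eq_square algebra_simps)
  qed
  finally show ?thesis by (simp add: exp_minus field_simps)
qed

lemma summable_exp_neg_power: "summable (\<lambda>j. exp (- b * c ^ j))" if "b > 0" "c > 1" for b c :: real
proof (rule summable_comparison_test')
  show "summable (\<lambda>j. (1 / b) * (1 / c) ^ j)"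
    using that by (intro summable_mult summable_geometric) simp
  show "norm (exp (- b * c ^ j)) \<le> (1 / b) * (1 / c) ^ j" for j
  proof -
    have "b * c ^ j \<le> exp (b * c ^ j)"
      using exp_ge_add_one_self[of "b * c ^ j"] by linarith
    then have "exp (- b * c ^ j) \<le> 1 / (b * c ^ j)"
      using that by (simp add: exp_minus field_simps)
    then show ?thesis by (simp add: power_one_over)
  qed
qed

context catalytic_laws
begin

lemma measurable_card_present [measurable]:
  assumes "finite \<Lambda>"
  shows "(\<lambda>\<omega>. card (present \<Lambda> \<omega>)) \<in> env \<rightarrow>\<^sub>M count_space UNIV"
proof -
  have "card (present \<Lambda> \<omega>) = (\<Sum>v\<in>\<Lambda>. if at_origin \<omega> v then 1 else 0)" for \<omega>
    using assms by (simp add: present_def sum.If_cases Int_def)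
  moreover have "(\<lambda>\<omega>. \<Sum>v\<in>\<Lambda>. if at_origin \<omega> v then 1 else 0 :: nat) \<in> env \<rightarrow>\<^sub>M count_space UNIV"
    using assms by (induction \<Lambda>) auto
  ultimately show ?thesis by simp
qed

lemma measurable_card_present_fun [measurable]:
  assumes "finite \<Lambda>"
  shows "(\<lambda>\<omega>. f (card (present \<Lambda> \<omega>))) \<in> env \<rightarrow>\<^sub>M borel"
  by (rule measurable_compose[OF measurable_card_present[OF assms]]) simp

lemma present_subset: "present \<Lambda> \<omega> \<subseteq> \<Lambda>"
  by (auto simp: present_def)

lemma finite_present: "finite \<Lambda> \<Longrightarrow> finite (present \<Lambda> \<omega>)"
  by (rule finite_subset[OF present_subset])

lemma depends_below_card_present:
  assumes "\<And>v. v \<in> \<Lambda> \<Longrightarrow> length v \<le> l"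
  shows "depends_below l {\<omega>. P (card (present \<Lambda> \<omega>))}"
proof (rule depends_belowI)
  fix \<omega> \<omega>' :: "nat list \<times> nat \<Rightarrow> int"
  assume *: "\<And>v i. length v < l \<Longrightarrow> \<omega> (v, i) = \<omega>' (v, i)" and P: "\<omega> \<in> {\<omega>. P (card (present \<Lambda> \<omega>))}"
  have "at_origin \<omega> v \<longleftrightarrow> at_origin \<omega>' v" if "v \<in> \<Lambda>" for v
    using depends_below_at_origin[OF assms[OF that]] * unfolding depends_below_def by auto
  then have "present \<Lambda> \<omega> = present \<Lambda> \<omega>'" by (auto simp: present_def)
  then show "\<omega>' \<in> {\<omega>. P (card (present \<Lambda> \<omega>))}" using P by simp
qed

lemma expectation_card_present:
  assumes "finite \<Lambda>"
  shows "integrable env (\<lambda>\<omega>. real (card (present \<Lambda> \<omega>)))"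
    "(\<integral>\<omega>. real (card (present \<Lambda> \<omega>)) \<partial>env) = (\<Sum>u\<in>\<Lambda>. measure env {\<omega>. at_origin \<omega> u})"
proof -
  have eq: "real (card (present \<Lambda> \<omega>)) = (\<Sum>u\<in>\<Lambda>. indicator {\<omega>. at_origin \<omega> u} \<omega>)" for \<omega>
    using assms by (simp add: present_def indicator_def sum.If_cases Int_def)
  have [measurable]: "{\<omega>. at_origin \<omega> u} \<in> sets env" for u
    using sets_at_origin[of u] by (simp add: pred_def)
  show "integrable env (\<lambda>\<omega>. real (card (present \<Lambda> \<omega>)))"
    unfolding eq by (intro Bochner_Integration.integrable_sum) (simp add: env.emeasure_eq_measure)
  show "(\<integral>\<omega>. real (card (present \<Lambda> \<omega>)) \<partial>env) = (\<Sum>u\<in>\<Lambda>. measure env {\<omega>. at_origin \<omega> u})"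
    unfolding eq by (subst Bochner_Integration.integral_sum) (simp_all add: env.emeasure_eq_measure)
qed

end

locale block_process = catalytic_laws p \<nu> for p :: "int pmf" and \<nu> :: "nat pmf" +
  fixes \<Lambda> :: "nat list set" and n :: nat
  assumes finite_labels: "finite \<Lambda>" and labels_length: "\<Lambda> \<subseteq> {u. length u = n}"
begin

definition block_count :: "nat \<Rightarrow> (nat list \<times> nat \<Rightarrow> int) \<Rightarrow> nat" where
  "block_count j \<omega> = card (present (blocks \<Lambda> j) \<omega>)"

definition block_mean :: real where
  "block_mean = (\<Sum>u\<in>\<Lambda>. measure env {\<omega>. at_origin \<omega> u})"

lemma block_count_0: "block_count 0 \<omega> = 1"
proof -
  have "present {[]} \<omega> = {[]}" by (auto simp: present_def at_origin_def)
  then show ?thesis by (simp add: block_count_def)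
qed

lemma measurable_block_count [measurable]: "block_count j \<in> env \<rightarrow>\<^sub>M count_space UNIV"
  unfolding block_count_def[abs_def] by (rule measurable_card_present) (rule finite_blocks[OF finite_labels])

lemma depends_below_block_count: "depends_below (j * n) {\<omega>. P (block_count j \<omega>)}"
  unfolding block_count_def
  by (rule depends_below_card_present) (simp add: length_blocks[OF labels_length])

lemma block_count_Suc_ge:
  "(\<Sum>v\<in>present (blocks \<Lambda> j) \<omega>. card (present \<Lambda> (subtree v \<omega>))) \<le> block_count (Suc j) \<omega>"
proof -
  let ?R = "present (blocks \<Lambda> j) \<omega>"
  let ?S = "SIGMA v:?R. present \<Lambda> (subtree v \<omega>)"
  have len: "length v = j * n" if "v \<in> ?R" for v
    using that present_subset length_blocks[OF labels_length] by blast
  have inj: "inj_on (\<lambda>(v, w). w @ v) ?S"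
  proof (rule inj_onI, clarify)
    fix v w v' w'
    assume "v \<in> ?R" "v' \<in> ?R" and eq: "w @ v = w' @ v'"
    then have "length v = length v'" by (simp add: len)
    with eq show "v = v' \<and> w = w'" by simp
  qed
  have "(\<lambda>(v, w). w @ v) ` ?S \<subseteq> present (blocks \<Lambda> (Suc j)) \<omega>"
    by (auto simp: present_def at_origin_append intro!: image_eqI[where x = "(_, _)"])
  then have "card ?S \<le> block_count (Suc j) \<omega>"
    unfolding block_count_def
    using card_mono[OF finite_present[OF finite_blocks[OF finite_labels]]] card_image[OF inj] by metis
  then show ?thesis
    by (subst (asm) card_SigmaI) (simp_all add: finite_present finite_blocks finite_labels)
qed

text \<open>The offspring number of a block is bounded, so its Laplace transform is \<open>1 - \<theta> * block_mean\<close> up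
  to an error of order \<open>\<theta>\<close> squared, which is below \<open>exp (- \<theta> * c)\<close> for small \<open>\<theta>\<close>.\<close>

lemma laplace_block:
  assumes "c < block_mean"
  shows "\<exists>\<theta>\<^sub>0>0. \<forall>\<theta>. 0 < \<theta> \<longrightarrow> \<theta> \<le> \<theta>\<^sub>0 \<longrightarrow>
    (\<integral>\<^sup>+\<omega>. ennreal (exp (- \<theta> * real (card (present \<Lambda> \<omega>)))) \<partial>env) \<le> ennreal (exp (- \<theta> * c))"
proof -
  define B where "B = real (card \<Lambda>)"
  define \<theta>\<^sub>0 where "\<theta>\<^sub>0 = 2 * (block_mean - c) / (B\<^sup>2 + 1)"
  have "\<theta>\<^sub>0 > 0" using assms by (simp add: \<theta>\<^sub>0_def add_nonneg_pos)
  moreover have "(\<integral>\<^sup>+\<omega>. ennreal (exp (- \<theta> * real (card (present \<Lambda> \<omega>)))) \<partial>env) \<le> ennreal (exp (- \<theta> * c))"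
    if \<theta>: "0 < \<theta>" "\<theta> \<le> \<theta>\<^sub>0" for \<theta>
  proof -
    let ?Z = "\<lambda>\<omega>. real (card (present \<Lambda> \<omega>))"
    have Z: "0 \<le> ?Z \<omega>" "?Z \<omega> \<le> B" for \<omega>
      using card_mono[OF finite_labels present_subset] by (simp_all add: B_def)
    have "(\<integral>\<^sup>+\<omega>. ennreal (exp (- \<theta> * ?Z \<omega>)) \<partial>env) \<le> (\<integral>\<^sup>+\<omega>. ennreal (1 - \<theta> * ?Z \<omega> + (\<theta> * ?Z \<omega>)\<^sup>2 / 2) \<partial>env)"
      using exp_minus_le_quadratic \<theta> by (intro nn_integral_mono ennreal_leI) simp
    also have "\<dots> \<le> (\<integral>\<^sup>+\<omega>. ennreal ((1 + \<theta>\<^sup>2 * B\<^sup>2 / 2) - \<theta> * ?Z \<omega>) \<partial>env)"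
    proof (intro nn_integral_mono ennreal_leI)
      fix \<omega>
      have "(\<theta> * ?Z \<omega>)\<^sup>2 \<le> (\<theta> * B)\<^sup>2"
        using Z \<theta> by (intro power_mono mult_left_mono) auto
      then show "1 - \<theta> * ?Z \<omega> + (\<theta> * ?Z \<omega>)\<^sup>2 / 2 \<le> (1 + \<theta>\<^sup>2 * B\<^sup>2 / 2) - \<theta> * ?Z \<omega>"
        by (simp add: power_mult_distrib)
    qed
    also have "\<dots> = ennreal (\<integral>\<omega>. (1 + \<theta>\<^sup>2 * B\<^sup>2 / 2) - \<theta> * ?Z \<omega> \<partial>env)"
    proof (rule nn_integral_eq_integral)
      show "integrable env (\<lambda>\<omega>. (1 + \<theta>\<^sup>2 * B\<^sup>2 / 2) - \<theta> * ?Z \<omega>)"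
        by (intro Bochner_Integration.integrable_diff integrable_mult_right expectation_card_present finite_labels) simp
      show "AE \<omega> in env. 0 \<le> (1 + \<theta>\<^sup>2 * B\<^sup>2 / 2) - \<theta> * ?Z \<omega>"
      proof (rule AE_I2)
        fix \<omega>
        have "\<theta> * ?Z \<omega> \<le> \<theta> * B" using Z \<theta> by (intro mult_left_mono) auto
        moreover have "0 \<le> (1 - \<theta> * B)\<^sup>2" by simp
        ultimately show "0 \<le> (1 + \<theta>\<^sup>2 * B\<^sup>2 / 2) - \<theta> * ?Z \<omega>"
          by (simp add: power2_eq_square algebra_simps)
      qed
    qed
    also have "(\<integral>\<omega>. (1 + \<theta>\<^sup>2 * B\<^sup>2 / 2) - \<theta> * ?Z \<omega> \<partial>env) = (1 + \<theta>\<^sup>2 * B\<^sup>2 / 2) - \<theta> * block_mean"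
      using expectation_card_present[OF finite_labels]
      by (subst Bochner_Integration.integral_diff) (simp_all add: block_mean_def env.prob_space[simplified])
    also have "ennreal \<dots> \<le> ennreal (exp (- \<theta> * c))"
    proof (rule ennreal_leI)
      have "\<theta> * (B\<^sup>2 + 1) \<le> 2 * (block_mean - c)"
        using \<theta>(2) by (simp add: \<theta>\<^sub>0_def pos_le_divide_eq add_nonneg_pos)
      then have "\<theta> * (\<theta> * (B\<^sup>2 + 1)) \<le> \<theta> * (2 * (block_mean - c))"
        using \<theta>(1) by (intro mult_left_mono) auto
      moreover have "\<theta> * (\<theta> * (B\<^sup>2 + 1)) = \<theta>\<^sup>2 * B\<^sup>2 + \<theta>\<^sup>2"
        by (simp add: power2_eq_square algebra_simps)
      moreover have "0 \<le> \<theta>\<^sup>2" by simp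
      ultimately have "\<theta>\<^sup>2 * B\<^sup>2 / 2 \<le> \<theta> * (block_mean - c)"
        by linarith
      then have "1 + \<theta>\<^sup>2 * B\<^sup>2 / 2 - \<theta> * block_mean \<le> 1 + (- \<theta> * c)"
        by (simp add: algebra_simps)
      also have "\<dots> \<le> exp (- \<theta> * c)" by (rule exp_ge_add_one_self)
      finally show "1 + \<theta>\<^sup>2 * B\<^sup>2 / 2 - \<theta> * block_mean \<le> exp (- \<theta> * c)" .
    qed
    finally show ?thesis .
  qed
  ultimately show ?thesis by blast
qed

lemma branching_blocks:
  assumes [measurable]: "E \<in> sets env" "\<Phi> \<in> borel_measurable env"
    and "depends_below (j * n) E"
    and \<Phi>: "(\<integral>\<^sup>+\<omega>. \<Phi> \<omega> \<partial>env) \<le> ennreal (exp (- s))"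
  shows "(\<integral>\<^sup>+\<omega>. indicator E \<omega> * (\<Prod>v\<in>present (blocks \<Lambda> j) \<omega>. \<Phi> (subtree v \<omega>)) \<partial>env)
    \<le> (\<integral>\<^sup>+\<omega>. indicator E \<omega> * ennreal (exp (- s * real (block_count j \<omega>))) \<partial>env)"
proof -
  have "(\<integral>\<^sup>+\<omega>. indicator E \<omega> * (\<Prod>v\<in>present (blocks \<Lambda> j) \<omega>. \<Phi> (subtree v \<omega>)) \<partial>env)
      = (\<integral>\<^sup>+\<omega>. indicator E \<omega> * (\<integral>\<^sup>+\<omega>. \<Phi> \<omega> \<partial>env) ^ block_count j \<omega> \<partial>env)"
    unfolding block_count_def
    using assms finite_blocks[OF finite_labels] length_blocks[OF labels_length]
    by (intro branching[where l = "j * n"]) auto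
  also have "\<dots> \<le> (\<integral>\<^sup>+\<omega>. indicator E \<omega> * ennreal (exp (- s * real (block_count j \<omega>))) \<partial>env)"
  proof (intro nn_integral_mono mult_left_mono)
    fix \<omega>
    have "(\<integral>\<^sup>+\<omega>. \<Phi> \<omega> \<partial>env) ^ block_count j \<omega> \<le> ennreal (exp (- s)) ^ block_count j \<omega>"
      by (intro power_mono \<Phi>) simp
    also have "\<dots> = ennreal (exp (- s * real (block_count j \<omega>)))"
      by (simp add: ennreal_power exp_of_nat_mult[symmetric] mult.commute)
    finally show "(\<integral>\<^sup>+\<omega>. \<Phi> \<omega> \<partial>env) ^ block_count j \<omega> \<le> ennreal (exp (- s * real (block_count j \<omega>)))" .
  qed simp
  finally show ?thesis .
qed

text \<open>Given the first \<open>j\<close> blocks, the Laplace transform factorises over the particles present.\<close>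

lemma laplace_step:
  assumes [measurable]: "E \<in> sets env" and "depends_below (j * n) E" and "0 \<le> \<theta>"
    and \<theta>: "(\<integral>\<^sup>+\<omega>. ennreal (exp (- \<theta> * real (card (present \<Lambda> \<omega>)))) \<partial>env) \<le> ennreal (exp (- \<theta> * c))"
  shows "(\<integral>\<^sup>+\<omega>. indicator E \<omega> * ennreal (exp (- \<theta> * real (block_count (Suc j) \<omega>))) \<partial>env)
    \<le> (\<integral>\<^sup>+\<omega>. indicator E \<omega> * ennreal (exp (- (\<theta> * c) * real (block_count j \<omega>))) \<partial>env)"
proof -
  let ?\<Phi> = "\<lambda>\<omega>. ennreal (exp (- \<theta> * real (card (present \<Lambda> \<omega>))))"
  have "(\<integral>\<^sup>+\<omega>. indicator E \<omega> * ennreal (exp (- \<theta> * real (block_count (Suc j) \<omega>))) \<partial>env)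
      \<le> (\<integral>\<^sup>+\<omega>. indicator E \<omega> * (\<Prod>v\<in>present (blocks \<Lambda> j) \<omega>. ?\<Phi> (subtree v \<omega>)) \<partial>env)"
  proof (intro nn_integral_mono mult_left_mono)
    fix \<omega>
    let ?R = "present (blocks \<Lambda> j) \<omega>"
    have "\<theta> * (\<Sum>v\<in>?R. real (card (present \<Lambda> (subtree v \<omega>)))) \<le> \<theta> * real (block_count (Suc j) \<omega>)"
      using block_count_Suc_ge[where j = j and \<omega> = \<omega>] assms(3) by (intro mult_left_mono) (simp_all flip: of_nat_sum)
    then have "exp (- \<theta> * real (block_count (Suc j) \<omega>)) \<le> exp (\<Sum>v\<in>?R. - \<theta> * real (card (present \<Lambda> (subtree v \<omega>))))"
      by (simp add: sum_distrib_left sum_negf)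
    also have "\<dots> = (\<Prod>v\<in>?R. exp (- \<theta> * real (card (present \<Lambda> (subtree v \<omega>)))))"
      by (rule exp_sum) (simp add: finite_present finite_blocks finite_labels)
    finally show "ennreal (exp (- \<theta> * real (block_count (Suc j) \<omega>))) \<le> (\<Prod>v\<in>?R. ?\<Phi> (subtree v \<omega>))"
      by (subst prod_ennreal) (auto intro: ennreal_leI)
  qed simp
  also have "\<dots> \<le> (\<integral>\<^sup>+\<omega>. indicator E \<omega> * ennreal (exp (- (\<theta> * c) * real (block_count j \<omega>))) \<partial>env)"
    using assms measurable_card_present_fun[OF finite_labels, of "\<lambda>k. ennreal (exp (- \<theta> * real k))"]
    by (intro branching_blocks) simp_all
  finally show ?thesis .
qed

text \<open>Each step of the iteration multiplies \<open>\<theta>\<close> by \<open>c\<close>; the assumption on \<open>\<theta>\<close> keeps all these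
  parameters below \<open>\<theta>\<^sub>0\<close>.\<close>

lemma laplace_iterate:
  assumes c: "c \<ge> 1"
    and step: "\<And>\<theta>. 0 < \<theta> \<Longrightarrow> \<theta> \<le> \<theta>\<^sub>0 \<Longrightarrow>
      (\<integral>\<^sup>+\<omega>. ennreal (exp (- \<theta> * real (card (present \<Lambda> \<omega>)))) \<partial>env) \<le> ennreal (exp (- \<theta> * c))"
    and "0 < \<theta>" "\<theta> * c ^ j \<le> \<theta>\<^sub>0"
  shows "(\<integral>\<^sup>+\<omega>. ennreal (exp (- \<theta> * real (block_count j \<omega>))) \<partial>env) \<le> ennreal (exp (- \<theta> * c ^ j))"
  using assms(3,4)
proof (induction j arbitrary: \<theta>)
  case 0
  then show ?case by (simp add: block_count_0 env.emeasure_space_1[simplified])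
next
  case (Suc j)
  have "\<theta> * 1 \<le> \<theta> * c ^ Suc j"
    using Suc.prems c by (intro mult_left_mono one_le_power) auto
  then have \<theta>: "\<theta> \<le> \<theta>\<^sub>0" using Suc.prems by linarith
  have "(\<integral>\<^sup>+\<omega>. ennreal (exp (- \<theta> * real (block_count (Suc j) \<omega>))) \<partial>env)
      = (\<integral>\<^sup>+\<omega>. indicator UNIV \<omega> * ennreal (exp (- \<theta> * real (block_count (Suc j) \<omega>))) \<partial>env)"
    by simp
  also have "\<dots> \<le> (\<integral>\<^sup>+\<omega>. indicator UNIV \<omega> * ennreal (exp (- (\<theta> * c) * real (block_count j \<omega>))) \<partial>env)"
    using Suc.prems \<theta> sets.top[of env] by (intro laplace_step step) (auto simp: depends_below_def)
  also have "\<dots> \<le> ennreal (exp (- (\<theta> * c) * c ^ j))"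
    using Suc.IH[of "\<theta> * c"] Suc.prems c by (simp add: ac_simps)
  finally show ?case by (simp add: ac_simps)
qed

lemma measurable_block_pred [measurable]: "{\<omega>. P (block_count j \<omega>)} \<in> sets env"
proof -
  have "Measurable.pred env (\<lambda>\<omega>. P (block_count j \<omega>))"
    by (rule measurable_compose[OF measurable_block_count]) simp
  then show ?thesis by (simp add: pred_def)
qed

text \<open>Many particles are very unlikely to produce fewer than \<open>c\<close> times their number, by the exponential
  Markov inequality with \<open>c < c'\<close>.\<close>

lemma growth_failure:
  assumes "\<theta> > 0" "0 < c" "c \<le> c'"
    and \<theta>: "(\<integral>\<^sup>+\<omega>. ennreal (exp (- \<theta> * real (card (present \<Lambda> \<omega>)))) \<partial>env) \<le> ennreal (exp (- \<theta> * c'))"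
  shows "measure env {\<omega>. c ^ j / 2 \<le> real (block_count j \<omega>) \<and> real (block_count (Suc j) \<omega>) < c ^ Suc j / 2}
    \<le> exp (- (\<theta> * (c' - c) / 2) * c ^ j)"
proof -
  let ?E = "{\<omega>. c ^ j / 2 \<le> real (block_count j \<omega>)}" and ?F = "{\<omega>. real (block_count (Suc j) \<omega>) < c ^ Suc j / 2}"
  have [measurable]: "?E \<in> sets env" "?F \<in> sets env"
    by (rule measurable_block_pred)+
  have "emeasure env (?E \<inter> ?F) = (\<integral>\<^sup>+\<omega>. indicator (?E \<inter> ?F) \<omega> \<partial>env)"
    by simp
  also have "\<dots> \<le> (\<integral>\<^sup>+\<omega>. ennreal (exp (\<theta> * c ^ Suc j / 2)) *
      (indicator ?E \<omega> * ennreal (exp (- \<theta> * real (block_count (Suc j) \<omega>)))) \<partial>env)"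
  proof (rule nn_integral_mono)
    fix \<omega>
    show "indicator (?E \<inter> ?F) \<omega> \<le> ennreal (exp (\<theta> * c ^ Suc j / 2)) *
      (indicator ?E \<omega> * ennreal (exp (- \<theta> * real (block_count (Suc j) \<omega>))))"
    proof (cases "\<omega> \<in> ?E \<inter> ?F")
      case True
      then have "\<theta> * real (block_count (Suc j) \<omega>) \<le> \<theta> * (c ^ Suc j / 2)"
        using assms by (intro mult_left_mono) auto
      then have "ennreal 1 \<le> ennreal (exp (\<theta> * c ^ Suc j / 2) * exp (- \<theta> * real (block_count (Suc j) \<omega>)))"
        by (intro ennreal_leI) (simp add: exp_add[symmetric])
      then show ?thesis using True by (simp add: ennreal_mult)
    qed simp
  qed
  also have "\<dots> = ennreal (exp (\<theta> * c ^ Suc j / 2)) *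
      (\<integral>\<^sup>+\<omega>. indicator ?E \<omega> * ennreal (exp (- \<theta> * real (block_count (Suc j) \<omega>))) \<partial>env)"
    by (intro nn_integral_cmult borel_measurable_times_ennreal borel_measurable_indicator
        measurable_compose[OF measurable_block_count]) simp_all
  also have "\<dots> \<le> ennreal (exp (\<theta> * c ^ Suc j / 2)) *
      (\<integral>\<^sup>+\<omega>. indicator ?E \<omega> * ennreal (exp (- (\<theta> * c') * real (block_count j \<omega>))) \<partial>env)"
    using assms by (intro mult_left_mono laplace_step depends_below_block_count) auto
  also have "\<dots> \<le> ennreal (exp (\<theta> * c ^ Suc j / 2)) * (\<integral>\<^sup>+\<omega>. ennreal (exp (- (\<theta> * c') * (c ^ j / 2))) \<partial>env)"
  proof (intro mult_left_mono nn_integral_mono)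
    fix \<omega>
    show "indicator ?E \<omega> * ennreal (exp (- (\<theta> * c') * real (block_count j \<omega>))) \<le> ennreal (exp (- (\<theta> * c') * (c ^ j / 2)))"
      using assms by (cases "\<omega> \<in> ?E") (auto intro!: ennreal_leI mult_left_mono)
  qed simp
  also have "\<dots> = ennreal (exp (- (\<theta> * (c' - c) / 2) * c ^ j))"
    by (simp add: env.emeasure_space_1[simplified] ennreal_mult[symmetric] exp_add[symmetric] field_simps)
  finally show ?thesis
    by (simp add: env.emeasure_eq_measure Collect_conj_eq)
qed

text \<open>Growth failures happen finitely often, by Borel-Cantelli. So if almost surely the population did not grow
  at rate \<open>c\<close>, it would almost surely be below \<open>c ^ j / 2\<close> from some block on; then the Laplace transform at
  \<open>\<theta>\<^sub>0 / c ^ j\<close> would be at least \<open>exp (- \<theta>\<^sub>0 / 2)\<close> in the limit, by Fatou's lemma. But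
  \<open>laplace_iterate\<close> bounds it by \<open>exp (- \<theta>\<^sub>0)\<close>.\<close>

lemma growth_positive:
  assumes c: "1 < c" "c < block_mean"
  shows "\<not> (AE \<omega> in env. \<not> (\<forall>\<^sub>F j in sequentially. c ^ j / 2 \<le> real (block_count j \<omega>)))"
proof
  assume none: "AE \<omega> in env. \<not> (\<forall>\<^sub>F j in sequentially. c ^ j / 2 \<le> real (block_count j \<omega>))"
  define c' where "c' = (c + block_mean) / 2"
  have c': "c < c'" "c' < block_mean" using c by (simp_all add: c'_def)
  obtain \<theta>\<^sub>0 where \<theta>\<^sub>0: "\<theta>\<^sub>0 > 0" and lap: "\<And>\<theta>. 0 < \<theta> \<Longrightarrow> \<theta> \<le> \<theta>\<^sub>0 \<Longrightarrow>
      (\<integral>\<^sup>+\<omega>. ennreal (exp (- \<theta> * real (card (present \<Lambda> \<omega>)))) \<partial>env) \<le> ennreal (exp (- \<theta> * c'))"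
    using laplace_block[OF c'(2)] by blast
  have lap_c: "(\<integral>\<^sup>+\<omega>. ennreal (exp (- \<theta> * real (card (present \<Lambda> \<omega>)))) \<partial>env) \<le> ennreal (exp (- \<theta> * c))"
    if "0 < \<theta>" "\<theta> \<le> \<theta>\<^sub>0" for \<theta>
    using lap[OF that] c' that by (elim order_trans) (auto intro!: ennreal_leI)
  define B where "B j = {\<omega>. c ^ j / 2 \<le> real (block_count j \<omega>) \<and> real (block_count (Suc j) \<omega>) < c ^ Suc j / 2}" for j
  have B_meas: "B j \<in> sets env" for j
    unfolding B_def Collect_conj_eq by (intro sets.Int measurable_block_pred)
  have "summable (\<lambda>j. measure env (B j))"
  proof (rule summable_comparison_test')
    show "summable (\<lambda>j. exp (- (\<theta>\<^sub>0 * (c' - c) / 2) * c ^ j))"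
      using \<theta>\<^sub>0 c c' by (intro summable_exp_neg_power) auto
    show "norm (measure env (B j)) \<le> exp (- (\<theta>\<^sub>0 * (c' - c) / 2) * c ^ j)" for j
      unfolding B_def using growth_failure[OF \<theta>\<^sub>0, of c c' j] lap[of \<theta>\<^sub>0] \<theta>\<^sub>0 c c' by simp
  qed
  then have "AE \<omega> in env. \<forall>\<^sub>F j in sequentially. \<omega> \<in> space env - B j"
    by (intro borel_cantelli_AE1 B_meas) (simp_all add: env.emeasure_eq_measure)
  with none have small: "AE \<omega> in env. \<forall>\<^sub>F j in sequentially. real (block_count j \<omega>) < c ^ j / 2"
  proof eventually_elim
    case (elim \<omega>)
    then obtain J where J: "\<omega> \<notin> B j" if "j \<ge> J" for j
      by (auto simp: eventually_sequentially)
    have "real (block_count j \<omega>) < c ^ j / 2" if "j \<ge> J" for j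
    proof (rule ccontr)
      assume j: "\<not> ?thesis"
      have "c ^ i / 2 \<le> real (block_count i \<omega>)" if "i \<ge> j" for i
        using that
      proof (induction i rule: dec_induct)
        case base
        then show ?case using j by simp
      next
        case (step i)
        then show ?case using J[of i] \<open>j \<ge> J\<close> by (simp add: B_def not_less)
      qed
      then show False using elim(1) by (auto simp: eventually_sequentially)
    qed
    then show ?case by (auto simp: eventually_sequentially)
  qed
  define f where "f j \<omega> = ennreal (exp (- (\<theta>\<^sub>0 / c ^ j) * real (block_count j \<omega>)))" for j \<omega>
  have f_meas [measurable]: "f j \<in> borel_measurable env" for j
    unfolding f_def by (rule measurable_compose[OF measurable_block_count]) simp
  have f_le: "(\<integral>\<^sup>+\<omega>. f j \<omega> \<partial>env) \<le> ennreal (exp (- \<theta>\<^sub>0))" for j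
  proof -
    have "c ^ j > 0" using c by simp
    then have "(\<integral>\<^sup>+\<omega>. f j \<omega> \<partial>env) \<le> ennreal (exp (- (\<theta>\<^sub>0 / c ^ j) * c ^ j))"
      unfolding f_def
      by (intro laplace_iterate[where \<theta>\<^sub>0 = \<theta>\<^sub>0] lap_c) (use \<theta>\<^sub>0 c in auto)
    then show ?thesis using c by simp
  qed
  have "ennreal (exp (- (\<theta>\<^sub>0 / 2))) = (\<integral>\<^sup>+\<omega>. ennreal (exp (- (\<theta>\<^sub>0 / 2))) \<partial>env)"
    by (simp add: env.emeasure_space_1[simplified])
  also have "\<dots> \<le> (\<integral>\<^sup>+\<omega>. liminf (\<lambda>j. f j \<omega>) \<partial>env)"
  proof (rule nn_integral_mono_AE)
    show "AE \<omega> in env. ennreal (exp (- (\<theta>\<^sub>0 / 2))) \<le> liminf (\<lambda>j. f j \<omega>)"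
      using small
    proof eventually_elim
      case (elim \<omega>)
      show ?case
      proof (rule Liminf_bounded)
        show "\<forall>\<^sub>F j in sequentially. ennreal (exp (- (\<theta>\<^sub>0 / 2))) \<le> f j \<omega>"
          using elim
        proof eventually_elim
          case (elim j)
          have "c ^ j > 0" using c by simp
          then have "\<theta>\<^sub>0 / c ^ j * real (block_count j \<omega>) \<le> \<theta>\<^sub>0 / c ^ j * (c ^ j / 2)"
            using elim \<theta>\<^sub>0 by (intro mult_left_mono) auto
          then show ?case using c unfolding f_def by (intro ennreal_leI) simp
        qed
      qed
    qed
  qed
  also have "\<dots> \<le> liminf (\<lambda>j. \<integral>\<^sup>+\<omega>. f j \<omega> \<partial>env)"
    by (rule nn_integral_liminf) (rule f_meas)
  also have "\<dots> \<le> ennreal (exp (- \<theta>\<^sub>0))"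
    by (rule order_trans[OF Liminf_le_Limsup Limsup_bounded]) (simp_all add: f_le)
  finally show False using \<theta>\<^sub>0 by simp
qed

text \<open>The particles at the origin make independent attempts, each with success probability at least \<open>\<pi>\<close>.\<close>

lemma reach_failure:
  assumes "\<pi> \<le> measure env {\<omega>. reaches k a \<omega>}" "0 \<le> \<pi>"
  shows "measure env {\<omega>. b \<le> real (block_count j \<omega>) \<and>
      \<not> reaches (j * n + k) a \<omega>} \<le> exp (- \<pi> * b)"
proof -
  define A where "A k = {\<omega>. reaches k a \<omega>}" for k
  let ?E = "{\<omega>. b \<le> real (block_count j \<omega>)}"
  have A_meas [measurable]: "A k \<in> sets env" for k
    unfolding A_def by (rule sets_reaches)
  have [measurable]: "?E \<in> sets env" by (rule measurable_block_pred)
  have shift: "\<omega> \<in> A (j * n + k)" if "v \<in> present (blocks \<Lambda> j) \<omega>" "subtree v \<omega> \<in> A k" for v \<omega>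
  proof -
    from that obtain u where "length u = k" "lives (subtree v \<omega>) u" "a \<le> real_of_int (pos (subtree v \<omega>) u)"
      by (auto simp: A_def reaches_def)
    moreover have "length v = j * n" "lives \<omega> v" "pos \<omega> v = 0"
      using that(1) length_blocks[OF labels_length] by (auto simp: present_def at_origin_def)
    ultimately show ?thesis
      by (auto simp: A_def reaches_def lives_append pos_append intro!: exI[of _ "u @ v"])
  qed
  have "UNIV - A k \<in> sets env"
    using sets.Diff[OF sets.top A_meas[of k]] by simp
  then have "(\<integral>\<^sup>+\<omega>. indicator (- A k) \<omega> \<partial>env) = ennreal (1 - measure env (A k))"
    using env.prob_compl[OF A_meas[of k]] by (simp add: env.emeasure_eq_measure Compl_eq_Diff_UNIV)
  also have "\<dots> \<le> ennreal (exp (- \<pi>))"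
    using assms(1) exp_ge_add_one_self[of "- \<pi>"] by (intro ennreal_leI) (simp add: A_def)
  finally have fail: "(\<integral>\<^sup>+\<omega>. indicator (- A k) \<omega> \<partial>env) \<le> ennreal (exp (- \<pi>))" .
  have "emeasure env (?E - A (j * n + k)) = (\<integral>\<^sup>+\<omega>. indicator (?E - A (j * n + k)) \<omega> \<partial>env)"
    by simp
  also have "\<dots> \<le> (\<integral>\<^sup>+\<omega>. indicator ?E \<omega> * (\<Prod>v\<in>present (blocks \<Lambda> j) \<omega>. indicator (- A k) (subtree v \<omega>)) \<partial>env)"
  proof (rule nn_integral_mono)
    fix \<omega>
    show "indicator (?E - A (j * n + k)) \<omega>
        \<le> indicator ?E \<omega> * (\<Prod>v\<in>present (blocks \<Lambda> j) \<omega>. indicator (- A k) (subtree v \<omega>) :: ennreal)"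
    proof (cases "\<omega> \<in> ?E - A (j * n + k)")
      case True
      then have "(\<Prod>v\<in>present (blocks \<Lambda> j) \<omega>. indicator (- A k) (subtree v \<omega>) :: ennreal) = 1"
        using shift[of _ \<omega>] by (intro prod.neutral) (auto simp: indicator_def)
      then show ?thesis using True by simp
    qed simp
  qed
  also have "\<dots> \<le> (\<integral>\<^sup>+\<omega>. indicator ?E \<omega> * ennreal (exp (- \<pi> * real (block_count j \<omega>))) \<partial>env)"
    by (intro branching_blocks fail depends_below_block_count) (simp_all add: Compl_eq_Diff_UNIV)
  also have "\<dots> \<le> (\<integral>\<^sup>+\<omega>. ennreal (exp (- \<pi> * b)) \<partial>env)"
  proof (intro nn_integral_mono)
    fix \<omega>
    show "indicator ?E \<omega> * ennreal (exp (- \<pi> * real (block_count j \<omega>))) \<le> ennreal (exp (- \<pi> * b))"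
      using assms by (cases "\<omega> \<in> ?E") (auto intro!: ennreal_leI mult_left_mono)
  qed
  finally have "measure env (?E - A (j * n + k)) \<le> exp (- \<pi> * b)"
    by (simp add: env.prob_space[simplified] env.emeasure_eq_measure)
  moreover have "?E - A (j * n + k) = {\<omega>. b \<le> real (block_count j \<omega>) \<and>
      \<not> reaches (j * n + k) a \<omega>}"
    by (auto simp: A_def)
  ultimately show ?thesis by simp
qed

end

section \<open>High speed with positive probability\<close>

text \<open>Speed at least \<open>x\<close>, in a form that does not change when time and space are shifted by constants.\<close>

definition fast :: "real \<Rightarrow> (nat list \<times> nat \<Rightarrow> int) \<Rightarrow> bool" where
  "fast x \<omega> \<longleftrightarrow> (\<exists>C::nat. \<forall>n\<ge>C. reaches n (x * real n - real C) \<omega>)"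

context catalytic_walk
begin

lemma nonbarren_ennreal: "\<exists>\<beta>>0. nonbarren = ennreal \<beta>"
  using nonbarren_pos by (intro exI[of _ "measure env {\<omega>. 0 < offspring \<omega> []}"])
    (auto simp: nonbarren_def env.emeasure_eq_measure)

text \<open>The length \<open>i\<close> of the path that stays positive depends on \<open>k\<close> and \<open>a\<close> in an unknown way, whereas
  particles at the origin are available at multiples of \<open>n\<close> only. The freedom in \<open>e\<close> bridges the gap.\<close>

lemma ex_reach_prob:
  "\<exists>b>0. \<forall>\<delta> k a. \<delta> > 0 \<longrightarrow> k \<ge> 1 \<longrightarrow> 2 * tilt_variance \<le> \<delta>\<^sup>2 * real k \<longrightarrow> 0 < a \<longrightarrow> a \<le> (drift - \<delta>) * real k \<longrightarrow>
    (\<exists>i\<le>k. \<forall>e\<le>n. b * exp (- (t0 * (drift + \<delta>) - r) * real k) / (real k + 1)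
      \<le> measure env {\<omega>. reaches (i + e) a \<omega>})"
proof -
  obtain \<beta> where \<beta>: "\<beta> > 0" "nonbarren = ennreal \<beta>" using nonbarren_ennreal by blast
  obtain d where d: "d > 0" "pmf p d > 0" using ex_upward_step by blast
  define b where "b = \<beta> * pmf p d ^ n / 2"
  have "b > 0" using \<beta> d by (simp add: b_def)
  moreover have "\<exists>i\<le>k. \<forall>e\<le>n. b * exp (- (t0 * (drift + \<delta>) - r) * real k) / (real k + 1)
      \<le> measure env {\<omega>. reaches (i + e) a \<omega>}"
    if \<delta>: "\<delta> > 0" "k \<ge> 1" "2 * tilt_variance \<le> \<delta>\<^sup>2 * real k" "0 < a" "a \<le> (drift - \<delta>) * real k" for \<delta> k a
  proof -
    let ?q = "exp (- (t0 * (drift + \<delta>) - r) * real k)"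
    obtain i where i: "i \<le> k" "ennreal (?q / 2 / (real k + 1)) \<le> (stay_op ^^ i) (above a) 0"
      using ex_stay_bound[OF \<delta>(4) large_deviation_lower[OF \<delta>(1-3,5)]] by auto
    have "b * ?q / (real k + 1) \<le> measure env {\<omega>. reaches (i + e) a \<omega>}"
      if e: "e \<le> n" for e
    proof -
      have "b * ?q / (real k + 1) = \<beta> * (pmf p d ^ n * (?q / 2 / (real k + 1)))"
        by (simp add: b_def)
      also have "\<dots> \<le> \<beta> * (pmf p d ^ e * (?q / 2 / (real k + 1)))"
        using \<beta> d e by (intro mult_left_mono mult_right_mono power_decreasing) (simp_all add: pmf_le_1)
      finally have "ennreal (b * ?q / (real k + 1)) \<le> ennreal (\<beta> * (pmf p d ^ e * (?q / 2 / (real k + 1))))"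
        by (rule ennreal_leI)
      also have "\<dots> = nonbarren * (ennreal (pmf p d) ^ e * ennreal (?q / 2 / (real k + 1)))"
        using \<beta> by (simp add: ennreal_power ennreal_mult[symmetric])
      also have "\<dots> \<le> nonbarren * (ennreal (pmf p d) ^ e * (stay_op ^^ i) (above a) 0)"
        by (intro mult_left_mono i) simp_all
      also have "\<dots> \<le> nonbarren * (stay_op ^^ (i + e)) (above a) 0"
        by (intro mult_left_mono stay_above_extend d) simp
      also have "\<dots> \<le> emeasure env {\<omega>. reaches (i + e) a \<omega>}"
        by (rule emeasure_reach_ge)
      finally show ?thesis by (simp add: env.emeasure_eq_measure)
    qed
    then show ?thesis using i(1) by blast
  qed
  ultimately show ?thesis by blast
qed

text \<open>For \<open>\<delta> = 0\<close> the second inequality is \<open>t0 * x < r\<close>.\<close>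

lemma ex_margin:
  assumes "0 < x" "x < r / t0"
  shows "\<exists>\<delta>>0. x < drift - \<delta> \<and> t0 * (drift + \<delta>) * (x / (drift - \<delta>)) < r"
proof -
  have x: "x < drift" using assms drift_ge by linarith
  have x': "t0 * x < r" using assms t0_pos by (simp add: field_simps)
  have "((\<lambda>\<delta>. t0 * (drift + \<delta>) * (x / (drift - \<delta>))) \<longlongrightarrow> t0 * (drift + 0) * (x / (drift - 0))) (at_right 0)"
    using x assms by (intro tendsto_intros) auto
  then have "((\<lambda>\<delta>. t0 * (drift + \<delta>) * (x / (drift - \<delta>))) \<longlongrightarrow> t0 * x) (at_right 0)"
    using x assms by simp
  then have "\<forall>\<^sub>F \<delta> in at_right 0. t0 * (drift + \<delta>) * (x / (drift - \<delta>)) < r"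
    using x' by (rule order_tendstoD)
  moreover have "((\<lambda>\<delta>. drift - \<delta>) \<longlongrightarrow> drift - 0) (at_right 0)"
    by (intro tendsto_intros)
  then have "\<forall>\<^sub>F \<delta> in at_right 0. x < drift - \<delta>"
    using x by (intro order_tendstoD) auto
  moreover have "\<forall>\<^sub>F \<delta> in at_right (0::real). 0 < \<delta>"
    by (rule eventually_at_right_less)
  ultimately have "\<forall>\<^sub>F \<delta> in at_right 0. 0 < \<delta> \<and> x < drift - \<delta> \<and> t0 * (drift + \<delta>) * (x / (drift - \<delta>)) < r"
    by eventually_elim auto
  then show ?thesis
    using eventually_happens'[OF trivial_limit_at_right_real] by fastforce
qed

text \<open>To be beyond \<open>x * T\<close> at time \<open>T\<close>, let the population at the origin grow until about time
  \<open>(1 - s) * T\<close> and then use an excursion of duration about \<open>s * T\<close> at speed \<open>drift - \<delta>\<close>, with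
  \<open>s = x / (drift - \<delta>)\<close>. There are about \<open>exp ((r - \<eta>) * (1 - s) * T)\<close> particles, each of which succeeds with
  probability about \<open>exp (- (t0 * (drift + \<delta>) - r) * s * T)\<close>. The product has the exponent
  \<open>r - t0 * (drift + \<delta>) * s - \<eta> * (1 - s)\<close> per unit of time, where \<open>3 * \<eta>\<close> is the difference of the
  first two terms. So the expected number of successes is exponentially large and the probability of
  having none is summable in \<open>T\<close>.\<close>

lemma fast_positive:
  assumes x: "0 < x" "x < r / t0"
  shows "\<not> (AE \<omega> in env. \<not> fast x \<omega>)"
proof -
  obtain \<delta> where \<delta>: "\<delta> > 0" "x < drift - \<delta>" "t0 * (drift + \<delta>) * (x / (drift - \<delta>)) < r"
    using ex_margin[OF x] by blast
  define s where "s = x / (drift - \<delta>)"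
  have s: "0 < s" "s < 1" "(drift - \<delta>) * s = x"
    using \<delta> x by (simp_all add: s_def)
  define \<eta> where "\<eta> = (r - t0 * (drift + \<delta>) * s) / 3"
  have \<eta>: "\<eta> > 0" using \<delta>(3) by (simp add: \<eta>_def s_def)
  have "drift > 0" using drift_ge r_pos t0_pos divide_pos_pos[of r t0] by linarith
  then have "0 \<le> t0 * (drift + \<delta>) * s" using t0_pos \<delta>(1) s by simp
  then have r_\<eta>: "r - \<eta> > 0" using r_pos by (simp add: \<eta>_def field_simps)
  define I where "I = t0 * (drift + \<delta>) - r"
  have I: "I \<ge> 0"
  proof -
    have "r \<le> t0 * drift" using drift_ge t0_pos by (simp add: field_simps)
    moreover have "0 \<le> t0 * \<delta>" using t0_pos \<delta>(1) by simp
    ultimately show ?thesis by (simp add: I_def algebra_simps)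
  qed
  obtain n \<Lambda> where n: "n \<ge> 1" and \<Lambda>: "finite \<Lambda>" "\<Lambda> \<subseteq> {u. length u = n}"
    and mean: "exp ((r - \<eta>) * real n) < (\<Sum>u\<in>\<Lambda>. measure env {\<omega>. at_origin \<omega> u})"
    using ex_supercritical_block[OF \<eta>] by blast
  interpret block_process p \<nu> \<Lambda> n by unfold_locales fact+
  define c where "c = exp ((r - \<eta>) * real n)"
  have c: "1 < c" "c < block_mean"
    using mean n r_\<eta> by (simp_all add: c_def block_mean_def)
  obtain b where b: "b > 0" and reach: "\<And>\<delta> k a. \<delta> > 0 \<Longrightarrow> k \<ge> 1 \<Longrightarrow> 2 * tilt_variance \<le> \<delta>\<^sup>2 * real k \<Longrightarrow>
      0 < a \<Longrightarrow> a \<le> (drift - \<delta>) * real k \<Longrightarrow>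
      \<exists>i\<le>k. \<forall>e\<le>n. b * exp (- (t0 * (drift + \<delta>) - r) * real k) / (real k + 1)
      \<le> measure env {\<omega>. reaches (i + e) a \<omega>}"
    using ex_reach_prob[of n] by blast
  define C0 where "C0 = b / (2 * (1 + 1 / \<eta>)) * exp (- I - (r - \<eta>) * (1 + real n))"
  have C0: "C0 > 0" using b \<eta> by (simp add: C0_def add_pos_pos)
  \<comment> \<open>beyond \<open>T1\<close> the excursion fits into the available time and Chebyshev's inequality applies to it\<close>
  define T1 where "T1 = nat \<lceil>max 1 (max (1 / (1 - s)) (2 * tilt_variance / (\<delta>\<^sup>2 * s)))\<rceil>"
  let ?D = "\<lambda>T j. {\<omega>. c ^ j / 2 \<le> real (block_count j \<omega>) \<and> \<not> reaches T (x * real T) \<omega>}"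
  have ex_j: "\<exists>j. (1 - s) * real T - 1 - real n \<le> real j * real n \<and> measure env (?D T j) \<le> exp (- C0 * exp \<eta> ^ T)"
    if T: "T \<ge> T1" for T
  proof -
    have T': "real T \<ge> 1" "real T \<ge> 1 / (1 - s)" "real T \<ge> 2 * tilt_variance / (\<delta>\<^sup>2 * s)"
      using T by (simp_all add: T1_def nat_le_iff ceiling_le_iff)
    define k where "k = nat \<lceil>s * real T\<rceil>"
    have k_real: "real k = of_int \<lceil>s * real T\<rceil>" using s T' by (simp add: k_def)
    have k: "s * real T \<le> real k" "real k < s * real T + 1"
      unfolding k_real by linarith+
    have "0 < s * real T" using s T' by (intro mult_pos_pos) linarith+
    then have "0 < real k" using k(1) by linarith
    then have "k \<ge> 1" by simp
    have "1 \<le> (1 - s) * real T" using T'(2) s by (simp add: field_simps)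
    then have "k \<le> T" using k(2) by (simp add: algebra_simps)
    have var: "2 * tilt_variance \<le> \<delta>\<^sup>2 * real k"
    proof -
      have "2 * tilt_variance \<le> \<delta>\<^sup>2 * (s * real T)"
        using T'(3) s \<delta>(1) by (simp add: pos_divide_le_eq ac_simps)
      also have "\<dots> \<le> \<delta>\<^sup>2 * real k" using k(1) by (intro mult_left_mono) auto
      finally show ?thesis .
    qed
    have a: "0 < x * real T" "x * real T \<le> (drift - \<delta>) * real k"
    proof -
      show "0 < x * real T" using x T' by simp
      have "x * real T = (drift - \<delta>) * (s * real T)" using s(3) by simp
      also have "\<dots> \<le> (drift - \<delta>) * real k" using k(1) \<delta> x by (intro mult_left_mono) auto
      finally show "x * real T \<le> (drift - \<delta>) * real k" .
    qed
    define \<pi> where "\<pi> = b * exp (- I * real k) / (real k + 1)"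
    obtain i where i: "i \<le> k" "\<And>e. e \<le> n \<Longrightarrow> \<pi> \<le> measure env
        {\<omega>. reaches (i + e) (x * real T) \<omega>}"
      using reach[OF \<delta>(1) \<open>k \<ge> 1\<close> var a] unfolding \<pi>_def I_def by blast
    define j where "j = (T - i) div n"
    define e where "e = (T - i) mod n"
    have T_eq: "T = j * n + (i + e)" and e: "e < n"
      using i(1) \<open>k \<le> T\<close> n by (simp_all add: j_def e_def)
    have jn: "(1 - s) * real T - 1 - real n \<le> real j * real n"
    proof -
      have "real T = real j * real n + (real i + real e)" using T_eq by (metis of_nat_add of_nat_mult)
      then show ?thesis using i(1) e k(2) by (simp add: algebra_simps)
    qed
    have D_le: "measure env (?D T j) \<le> exp (- \<pi> * (c ^ j / 2))"
      using reach_failure[of \<pi> "i + e" "x * real T" "c ^ j / 2" j] i(2)[of e] e b T_eq by (simp add: \<pi>_def)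
    have "C0 * exp \<eta> ^ T \<le> \<pi> * (c ^ j / 2)"
    proof -
      \<comment> \<open>one of the two spare multiples of \<open>\<eta>\<close> in the exponent pays for the polynomial factor\<close>
      have "exp (- \<eta> * real T) / (1 + 1 / \<eta>) \<le> 1 / (real k + 1)"
      proof -
        have "real k + 1 \<le> (1 + 1 / \<eta>) * (1 + \<eta> * real T)"
        proof -
          have "(1 + 1 / \<eta>) * (1 + \<eta> * real T) = 1 + 1 / \<eta> + \<eta> * real T + real T"
            using \<eta> by (simp add: field_simps)
          moreover have "0 \<le> 1 / \<eta>" "0 \<le> \<eta> * real T" using \<eta> by simp_all
          ultimately show ?thesis using \<open>k \<le> T\<close> by linarith
        qed
        also have "\<dots> \<le> (1 + 1 / \<eta>) * exp (\<eta> * real T)"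
          using \<eta> exp_ge_add_one_self[of "\<eta> * real T"] by (intro mult_left_mono) auto
        finally have "1 / ((1 + 1 / \<eta>) * exp (\<eta> * real T)) \<le> 1 / (real k + 1)"
          by (intro divide_left_mono) auto
        then show ?thesis by (simp add: exp_minus field_simps)
      qed
      moreover have "exp (- I - I * s * real T) \<le> exp (- I * real k)"
      proof -
        have "I * real k \<le> I * (s * real T + 1)" using k(2) I by (intro mult_left_mono) auto
        then show ?thesis by (simp add: algebra_simps)
      qed
      moreover have "exp ((r - \<eta>) * ((1 - s) * real T - 1 - real n)) \<le> c ^ j"
        using mult_left_mono[OF jn, of "r - \<eta>"] r_\<eta> by (simp add: c_def exp_of_nat_mult[symmetric] ac_simps)
      ultimately have "b * exp (- I - I * s * real T) * (exp (- \<eta> * real T) / (1 + 1 / \<eta>)) *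
            (exp ((r - \<eta>) * ((1 - s) * real T - 1 - real n)) / 2)
          \<le> b * exp (- I * real k) * (1 / (real k + 1)) * (c ^ j / 2)"
        using b \<eta> by (intro mult_mono mult_left_mono divide_right_mono) auto
      moreover have "C0 * exp \<eta> ^ T \<le> b * exp (- I - I * s * real T) * (exp (- \<eta> * real T) / (1 + 1 / \<eta>)) *
            (exp ((r - \<eta>) * ((1 - s) * real T - 1 - real n)) / 2)"
      proof -
        have "(2 * \<eta>) * real T \<le> (r - \<eta>) * ((1 - s) * real T) - I * s * real T"
        proof -
          have "(r - \<eta>) * (1 - s) - I * s = 2 * \<eta> + \<eta> * s"
            by (simp add: \<eta>_def I_def field_simps)
          then have "(r - \<eta>) * ((1 - s) * real T) - I * s * real T = (2 * \<eta> + \<eta> * s) * real T"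
            by (metis (no_types) left_diff_distrib mult.assoc)
          then show ?thesis using \<eta> s by (simp add: mult_right_mono)
        qed
        then have "- I - (r - \<eta>) * (1 + real n) + \<eta> * real T
            \<le> (- I - I * s * real T) + (- \<eta> * real T) + (r - \<eta>) * ((1 - s) * real T - 1 - real n)"
          by (simp add: algebra_simps)
        then have "exp (- I - (r - \<eta>) * (1 + real n)) * exp (\<eta> * real T)
            \<le> exp (- I - I * s * real T) * exp (- \<eta> * real T) * exp ((r - \<eta>) * ((1 - s) * real T - 1 - real n))"
          by (simp only: exp_add[symmetric] exp_le_cancel_iff)
        then have "b / (2 * (1 + 1 / \<eta>)) * (exp (- I - (r - \<eta>) * (1 + real n)) * exp (\<eta> * real T))
            \<le> b / (2 * (1 + 1 / \<eta>)) * (exp (- I - I * s * real T) * exp (- \<eta> * real T) * exp ((r - \<eta>) * ((1 - s) * real T - 1 - real n)))"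
          using b \<eta> by (intro mult_left_mono) (auto intro: add_nonneg_nonneg)
        then show ?thesis by (simp add: C0_def exp_of_nat_mult[symmetric] ac_simps)
      qed
      ultimately show ?thesis by (simp add: \<pi>_def)
    qed
    then have "exp (- \<pi> * (c ^ j / 2)) \<le> exp (- C0 * exp \<eta> ^ T)" by simp
    with D_le have "measure env (?D T j) \<le> exp (- C0 * exp \<eta> ^ T)" by (rule order_trans)
    then show ?thesis using jn by blast
  qed
  define J where "J T = (SOME j. (1 - s) * real T - 1 - real n \<le> real j * real n \<and>
      measure env (?D T j) \<le> exp (- C0 * exp \<eta> ^ T))" for T
  have J: "(1 - s) * real T - 1 - real n \<le> real (J T) * real n"
      "measure env (?D T (J T)) \<le> exp (- C0 * exp \<eta> ^ T)" if "T \<ge> T1" for T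
    using someI_ex[OF ex_j[OF that]] unfolding J_def by blast+
  have J_top: "filterlim J at_top sequentially"
  proof -
    have "filterlim (\<lambda>T. ((1 - s) * real T - 1 - real n) / real n) at_top sequentially"
      using s n by real_asymp
    moreover have "\<forall>\<^sub>F T in sequentially. ((1 - s) * real T - 1 - real n) / real n \<le> real (J T)"
      using eventually_ge_at_top[of T1] by eventually_elim (use J(1) n in \<open>simp add: pos_divide_le_eq\<close>)
    ultimately have "filterlim (\<lambda>T. real (J T)) at_top sequentially"
      by (rule filterlim_at_top_mono)
    then show ?thesis by (simp add: filterlim_real_sequentially filterlim_sequentially_iff_filterlim_real)
  qed
  have D_meas: "?D T j \<in> sets env" for T j
  proof -
    have "Measurable.pred env (\<lambda>\<omega>. \<not> reaches T (x * real T) \<omega>)" by measurable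
    then have "{\<omega>. \<not> reaches T (x * real T) \<omega>} \<in> sets env" by (simp add: pred_def)
    then show ?thesis
      unfolding Collect_conj_eq by (intro sets.Int measurable_block_pred)
  qed
  have "summable (\<lambda>T. measure env (?D T (J T)))"
  proof (rule summable_comparison_test')
    show "summable (\<lambda>T. exp (- C0 * exp \<eta> ^ T))"
      using C0 \<eta> by (intro summable_exp_neg_power) auto
    show "norm (measure env (?D T (J T))) \<le> exp (- C0 * exp \<eta> ^ T)" if "T \<ge> T1" for T
      using J(2)[OF that] by simp
  qed
  then have "AE \<omega> in env. \<forall>\<^sub>F T in sequentially. \<omega> \<in> space env - ?D T (J T)"
    by (intro borel_cantelli_AE1 D_meas) (simp_all add: env.emeasure_eq_measure)
  then have conditional: "AE \<omega> in env. (\<forall>\<^sub>F j in sequentially. c ^ j / 2 \<le> real (block_count j \<omega>)) \<longrightarrow> fast x \<omega>"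
  proof eventually_elim
    case (elim \<omega>)
    show ?case
    proof
      assume "\<forall>\<^sub>F j in sequentially. c ^ j / 2 \<le> real (block_count j \<omega>)"
      then have "\<forall>\<^sub>F T in sequentially. c ^ J T / 2 \<le> real (block_count (J T) \<omega>)"
        using J_top by (rule eventually_compose_filterlim)
      with elim have "\<forall>\<^sub>F T in sequentially. reaches T (x * real T) \<omega>"
        by eventually_elim auto
      then obtain C where C: "\<And>T. T \<ge> C \<Longrightarrow> reaches T (x * real T) \<omega>"
        by (auto simp: eventually_sequentially)
      show "fast x \<omega>"
        unfolding fast_def
      proof (intro exI[of _ C] allI impI)
        fix T assume "T \<ge> C"
        then show "reaches T (x * real T - real C) \<omega>"
          using C[of T] by (force simp: reaches_def)
      qed
    qed
  qed
  show ?thesis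
  proof
    assume "AE \<omega> in env. \<not> fast x \<omega>"
    with conditional have "AE \<omega> in env. \<not> (\<forall>\<^sub>F j in sequentially. c ^ j / 2 \<le> real (block_count j \<omega>))"
      by eventually_elim blast
    with growth_positive[OF c] show False by (rule notE)
  qed
qed

end

section \<open>From positive probability to the event of infinitely many visits\<close>

definition returns_forever :: "(nat list \<times> nat \<Rightarrow> int) \<Rightarrow> bool" where
  "returns_forever \<omega> \<longleftrightarrow> (\<exists>\<^sub>\<infinity>n. \<exists>u. length u = n \<and> at_origin \<omega> u)"

lemma fast_append:
  assumes "at_origin \<omega> v" "fast x (subtree v \<omega>)"
  shows "fast x \<omega>"
proof -
  obtain C :: nat where C: "\<And>n. n \<ge> C \<Longrightarrow> reaches n (x * real n - real C) (subtree v \<omega>)"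
    using assms(2) unfolding fast_def by blast
  define l where "l = length v"
  define C' where "C' = C + l + nat \<lceil>x * real l\<rceil>"
  show ?thesis
    unfolding fast_def
  proof (intro exI[of _ C'] allI impI)
    fix n assume "n \<ge> C'"
    then have n: "n - l \<ge> C" "l \<le> n" by (simp_all add: C'_def)
    obtain u where u: "length u = n - l" "lives (subtree v \<omega>) u"
        "x * real (n - l) - real C \<le> real_of_int (pos (subtree v \<omega>) u)"
      using C[OF n(1)] by (auto simp: reaches_def)
    have "x * real n - real C' \<le> x * real (n - l) - real C"
    proof -
      have "x * real l \<le> real (nat \<lceil>x * real l\<rceil>)" by linarith
      then have "x * real l \<le> real C' - real C" by (simp add: C'_def)
      moreover have "x * real (n - l) = x * real n - x * real l"
        using n(2) by (simp add: of_nat_diff right_diff_distrib)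
      ultimately show ?thesis by linarith
    qed
    then show "reaches n (x * real n - real C') \<omega>"
      using u n(2) assms(1)
      by (auto simp: reaches_def at_origin_def lives_append pos_append l_def intro!: exI[of _ "u @ v"])
  qed
qed

context catalytic_laws
begin

lemma sets_fast: "{\<omega>. fast x \<omega>} \<in> sets env"
proof -
  have "Measurable.pred env (\<lambda>\<omega>. fast x \<omega>)"
    unfolding fast_def
    by measurable
  then show ?thesis by (simp add: pred_def)
qed

text \<open>The sets that can be approximated form a sigma-algebra: for a countable union, finitely many of
  the sets are approximated and the rest has small measure. The events that involve a single
  coordinate have finite depth and generate everything.\<close>

lemma finite_depth_approximation:
  assumes "A \<in> sets env" "\<epsilon> > 0"
  shows "\<exists>l B. B \<in> sets env \<and> depends_below l B \<and> measure env (A - B \<union> (B - A)) < \<epsilon>"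
proof -
  have "sets env = sigma_sets UNIV {{\<omega>. \<omega> j \<in> X} |j X. True}"
    unfolding env_def by (subst sets_PiM_single) (simp add: space_PiM)
  with assms(1) have "A \<in> sigma_sets UNIV {{\<omega>. \<omega> j \<in> X} |j X. True}" by simp
  then show ?thesis
    using assms(2)
  proof (induction arbitrary: \<epsilon>)
    case (Basic a)
    then obtain v i X where a: "a = {\<omega>. \<omega> (v, i) \<in> X}" by auto
    have "Measurable.pred env (\<lambda>\<omega>. \<omega> (v, i) \<in> X)"
      by (rule measurable_compose[OF measurable_coord]) simp
    then have "a \<in> sets env" by (simp add: a pred_def)
    moreover have "depends_below (Suc (length v)) a"
      unfolding a by (intro depends_belowI) auto
    ultimately show ?case using Basic by (intro exI[of _ "Suc (length v)"] exI[of _ a]) simp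
  next
    case Empty
    then show ?case by (intro exI[of _ 0] exI[of _ "{}"]) (simp add: depends_below_def)
  next
    case (Compl a)
    then obtain l B where B: "B \<in> sets env" "depends_below l B" "measure env (a - B \<union> (B - a)) < \<epsilon>"
      by blast
    have "(UNIV - a) - (UNIV - B) \<union> ((UNIV - B) - (UNIV - a)) = a - B \<union> (B - a)" by auto
    moreover have "UNIV - B \<in> sets env" using sets.Diff[OF sets.top B(1)] by simp
    moreover have "depends_below l (UNIV - B)" using B(2) unfolding depends_below_def by blast
    ultimately show ?case using B(3) by (intro exI[of _ l] exI[of _ "UNIV - B"]) simp
  next
    case (Union a)
    have a_meas: "a i \<in> sets env" for i
      using Union(1) \<open>sets env = _\<close> by simp
    have "(\<lambda>n. measure env (\<Union>i\<le>n. a i)) \<longlonglongrightarrow> measure env (\<Union>n. \<Union>i\<le>n. a i)"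
    proof (rule env.finite_Lim_measure_incseq)
      show "incseq (\<lambda>n. \<Union>i\<le>n. a i)" by (intro incseq_SucI UN_mono) auto
    qed (use a_meas in auto)
    moreover have "(\<Union>n. \<Union>i\<le>n. a i) = (\<Union>i. a i)" by auto
    ultimately have "\<forall>\<^sub>F n in sequentially. measure env (\<Union>i. a i) - \<epsilon> / 2 < measure env (\<Union>i\<le>n. a i)"
      using Union.prems by (intro order_tendstoD) auto
    then obtain n where n: "measure env (\<Union>i. a i) - \<epsilon> / 2 < measure env (\<Union>i\<le>n. a i)"
      by (auto simp: eventually_sequentially)
    define \<delta> where "\<delta> = \<epsilon> / (2 * (real n + 1))"
    have "\<delta> > 0" using Union.prems by (simp add: \<delta>_def)
    then have "\<forall>i. \<exists>l B. B \<in> sets env \<and> depends_below l B \<and> measure env (a i - B \<union> (B - a i)) < \<delta>"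
      using Union.IH by blast
    then obtain l B where B: "\<And>i. B i \<in> sets env" "\<And>i. depends_below (l i) (B i)"
        "\<And>i. measure env (a i - B i \<union> (B i - a i)) < \<delta>"
      by (auto simp: choice_iff)
    define L where "L = Max (l ` {..n})"
    have "depends_below L (\<Union>i\<le>n. B i)"
    proof -
      have "depends_below L (B i)" if "i \<le> n" for i
        using that by (intro depends_below_mono[OF B(2)]) (simp add: L_def)
      then show ?thesis unfolding depends_below_def by blast
    qed
    moreover have "(\<Union>i\<le>n. B i) \<in> sets env" using B(1) by auto
    moreover have "measure env ((\<Union>i. a i) - (\<Union>i\<le>n. B i) \<union> ((\<Union>i\<le>n. B i) - (\<Union>i. a i))) < \<epsilon>"
    proof -
      let ?A = "\<Union>i. a i" and ?An = "\<Union>i\<le>n. a i" and ?D = "\<lambda>i. a i - B i \<union> (B i - a i)"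
      have D_meas: "?D i \<in> sets env" for i using a_meas B(1) by auto
      have "measure env (?A - (\<Union>i\<le>n. B i) \<union> ((\<Union>i\<le>n. B i) - ?A)) \<le> measure env ((?A - ?An) \<union> (\<Union>i\<le>n. ?D i))"
        using a_meas B(1) by (intro env.finite_measure_mono) auto
      also have "\<dots> \<le> measure env (?A - ?An) + measure env (\<Union>i\<le>n. ?D i)"
        using a_meas D_meas by (intro measure_Un_le) auto
      also have "measure env (?A - ?An) = measure env ?A - measure env ?An"
        using a_meas by (intro env.finite_measure_Diff) auto
      also have "measure env (\<Union>i\<le>n. ?D i) \<le> (\<Sum>i\<le>n. measure env (?D i))"
        using D_meas by (intro measure_UNION_le) auto
      also have "\<dots> < (\<Sum>i\<le>n. \<delta>)"
        using B(3) by (intro sum_strict_mono) auto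
      also have "(\<Sum>i\<le>n. \<delta>) = \<epsilon> / 2"
        by (simp add: \<delta>_def field_simps)
      finally show ?thesis using n by simp
    qed
    ultimately show ?case by blast
  qed
qed

text \<open>The first particle that visits the origin from generation \<open>N\<close> on, in the order by generation and
  then by an enumeration of the labels, starts a copy of the process that is independent of \<open>A\<close>, and \<open>G\<close>
  fails for the whole process only if it fails for this copy.\<close>

lemma first_visit_bound:
  assumes G: "{\<omega>. G \<omega>} \<in> sets env" "\<And>\<omega> v. at_origin \<omega> v \<Longrightarrow> G (subtree v \<omega>) \<Longrightarrow> G \<omega>"
    and A: "A \<in> sets env" "depends_below N A"
  shows "measure env {\<omega>\<in>A. \<not> G \<omega> \<and> (\<exists>u. N \<le> length u \<and> at_origin \<omega> u)} \<le> measure env {\<omega>. \<not> G \<omega>} * measure env A"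
proof -
  define before :: "(nat list \<times> nat list) set" where "before = measures [length, to_nat]"
  define I where "I = {u :: nat list. N \<le> length u}"
  define W where "W u = {\<omega>. at_origin \<omega> u \<and> (\<forall>u'\<in>I. (u', u) \<in> before \<longrightarrow> \<not> at_origin \<omega> u')}" for u
  have W_meas [measurable]: "W u \<in> sets env" for u
  proof -
    have "Measurable.pred env (\<lambda>\<omega>. at_origin \<omega> u \<and> (\<forall>u'. u' \<in> I \<longrightarrow> (u', u) \<in> before \<longrightarrow> \<not> at_origin \<omega> u'))"
      by (intro pred_intros_logic pred_intros_countable sets_at_origin) simp_all
    then show ?thesis by (simp add: W_def pred_def Ball_def)
  qed
  have W_dep: "depends_below (length u) (W u)" for u
  proof (rule depends_belowI)
    fix \<omega> \<omega>' :: "nat list \<times> nat \<Rightarrow> int"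
    assume *: "\<And>v i. length v < length u \<Longrightarrow> \<omega> (v, i) = \<omega>' (v, i)" and "\<omega> \<in> W u"
    moreover have "at_origin \<omega> w \<longleftrightarrow> at_origin \<omega>' w" if "length w \<le> length u" for w
      using depends_below_at_origin[OF that] * unfolding depends_below_def by auto
    moreover have "length u' \<le> length u" if "(u', u) \<in> before" for u'
      using that by (auto simp: before_def)
    ultimately show "\<omega>' \<in> W u" by (auto simp: W_def)
  qed
  have G_meas [measurable]: "{\<omega>. \<not> G \<omega>} \<in> sets env"
    using sets.Diff[OF sets.top G(1)] by (simp add: Compl_eq_Diff_UNIV[symmetric] Collect_neg_eq)
  note A(1) [measurable]
  have disj: "disjoint_family_on W I"
    unfolding disjoint_family_on_def
  proof (intro ballI impI)
    fix u u' assume "u \<in> I" "u' \<in> I" "u \<noteq> u'"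
    then have "to_nat u \<noteq> to_nat u'" by (simp add: inj_eq)
    then consider "to_nat u < to_nat u'" | "to_nat u' < to_nat u" by linarith
    then have "(u, u') \<in> before \<or> (u', u) \<in> before"
      by cases (auto simp: before_def)
    then show "W u \<inter> W u' = {}"
      using \<open>u \<in> I\<close> \<open>u' \<in> I\<close> by (auto simp: W_def)
  qed
  have step: "emeasure env (A \<inter> W u \<inter> {\<omega>. \<not> G \<omega>}) \<le> emeasure env (A \<inter> W u) * emeasure env {\<omega>. \<not> G \<omega>}"
    if "u \<in> I" for u
  proof -
    have "emeasure env (A \<inter> W u \<inter> {\<omega>. \<not> G \<omega>}) = (\<integral>\<^sup>+\<omega>. indicator (A \<inter> W u \<inter> {\<omega>. \<not> G \<omega>}) \<omega> \<partial>env)"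
      by simp
    also have "\<dots> \<le> (\<integral>\<^sup>+\<omega>. indicator (A \<inter> W u) \<omega> * (\<Prod>v\<in>{u}. indicator {\<omega>. \<not> G \<omega>} (subtree v \<omega>)) \<partial>env)"
      by (intro nn_integral_mono) (use G(2) in \<open>auto simp: W_def indicator_def\<close>)
    also have "\<dots> = emeasure env (A \<inter> W u) * emeasure env {\<omega>. \<not> G \<omega>}"
      using that depends_below_mono[OF A(2), of "length u"] W_dep[of u]
      by (subst branching_fixed[where l = "length u"]) (auto intro: depends_below_Int simp: I_def)
    finally show ?thesis .
  qed
  have cover: "{\<omega>\<in>A. \<not> G \<omega> \<and> (\<exists>u. N \<le> length u \<and> at_origin \<omega> u)} \<subseteq> (\<Union>u\<in>I. A \<inter> W u \<inter> {\<omega>. \<not> G \<omega>})"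
  proof
    fix \<omega> assume "\<omega> \<in> {\<omega>\<in>A. \<not> G \<omega> \<and> (\<exists>u. N \<le> length u \<and> at_origin \<omega> u)}"
    then obtain w where \<omega>: "\<omega> \<in> A" "\<not> G \<omega>" and w: "w \<in> {u\<in>I. at_origin \<omega> u}" by (auto simp: I_def)
    have "wf before" by (simp add: before_def)
    then obtain u where "u \<in> {u\<in>I. at_origin \<omega> u}" "\<And>u'. (u', u) \<in> before \<Longrightarrow> u' \<notin> {u\<in>I. at_origin \<omega> u}"
      using w by (rule wfE_min) blast
    then show "\<omega> \<in> (\<Union>u\<in>I. A \<inter> W u \<inter> {\<omega>. \<not> G \<omega>})"
      using \<omega> by (auto simp: W_def)
  qed
  have "emeasure env {\<omega>\<in>A. \<not> G \<omega> \<and> (\<exists>u. N \<le> length u \<and> at_origin \<omega> u)}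
      \<le> emeasure env (\<Union>u\<in>I. A \<inter> W u \<inter> {\<omega>. \<not> G \<omega>})"
    by (intro emeasure_mono cover sets.countable_UN') auto
  also have "\<dots> = (\<integral>\<^sup>+u. emeasure env (A \<inter> W u \<inter> {\<omega>. \<not> G \<omega>}) \<partial>count_space I)"
    by (intro emeasure_UN_countable disjoint_family_on_bisimulation[OF disj]) auto
  also have "\<dots> \<le> (\<integral>\<^sup>+u. emeasure env (A \<inter> W u) * emeasure env {\<omega>. \<not> G \<omega>} \<partial>count_space I)"
    using step by (intro nn_integral_mono) simp
  also have "\<dots> = (\<integral>\<^sup>+u. emeasure env (A \<inter> W u) \<partial>count_space I) * emeasure env {\<omega>. \<not> G \<omega>}"
    by (rule nn_integral_multc) simp
  also have "(\<integral>\<^sup>+u. emeasure env (A \<inter> W u) \<partial>count_space I) = emeasure env (\<Union>u\<in>I. A \<inter> W u)"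
    by (intro emeasure_UN_countable[symmetric] disjoint_family_on_bisimulation[OF disj]) auto
  also have "\<dots> * emeasure env {\<omega>. \<not> G \<omega>} \<le> emeasure env A * emeasure env {\<omega>. \<not> G \<omega>}"
    by (intro mult_right_mono emeasure_mono) auto
  finally show ?thesis
    by (simp add: env.emeasure_eq_measure ennreal_mult[symmetric] mult.commute)
qed

text \<open>Every visit of the origin gives \<open>G\<close> a fresh chance. Let \<open>H\<close> be the event that \<open>G\<close> fails in spite of
  infinitely many visits. If \<open>B\<close> is an event of finite depth close to \<open>H\<close>, then
  \<open>first_visit_bound\<close> shows that \<open>H \<inter> B\<close> has at most \<open>q\<close> times the probability of \<open>B\<close>, where
  \<open>q < 1\<close> is the probability that \<open>G\<close> fails; letting \<open>B\<close> tend to \<open>H\<close> gives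
  \<open>P(H) \<le> q * P(H)\<close>, so \<open>H\<close> is a null event.\<close>

lemma recurrent_zero_one:
  assumes G: "{\<omega>. G \<omega>} \<in> sets env" "\<And>\<omega> v. at_origin \<omega> v \<Longrightarrow> G (subtree v \<omega>) \<Longrightarrow> G \<omega>"
    and pos: "\<not> (AE \<omega> in env. \<not> G \<omega>)"
  shows "AE \<omega> in env. returns_forever \<omega> \<longrightarrow> G \<omega>"
proof -
  define q where "q = measure env {\<omega>. \<not> G \<omega>}"
  define H where "H = {\<omega>. returns_forever \<omega> \<and> \<not> G \<omega>}"
  have G_meas: "{\<omega>. \<not> G \<omega>} \<in> sets env"
    using sets.Diff[OF sets.top G(1)] by (simp add: Compl_eq_Diff_UNIV[symmetric] Collect_neg_eq)
  have "returns_forever \<omega> \<longleftrightarrow> (\<forall>N. \<exists>u. N \<le> length u \<and> at_origin \<omega> u)" for \<omega>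
    unfolding returns_forever_def INFM_nat_le by blast
  moreover have "Measurable.pred env (\<lambda>\<omega>. \<forall>N. \<exists>u. N \<le> length u \<and> at_origin \<omega> u)"
    by (intro pred_intros_logic pred_intros_countable sets_at_origin) simp
  ultimately have "{\<omega>. returns_forever \<omega>} \<in> sets env" by (simp add: pred_def)
  then have H_meas: "H \<in> sets env"
    unfolding H_def Collect_conj_eq using G_meas by (rule sets.Int)
  have "q < 1"
  proof (rule ccontr)
    assume "\<not> q < 1"
    then have "measure env {\<omega>. \<not> G \<omega>} = 1" using env.prob_le_1[of "{\<omega>. \<not> G \<omega>}"] by (simp add: q_def)
    then show False using pos env.prob_eq_1[OF G_meas] by simp
  qed
  have q: "0 \<le> q" by (simp add: q_def)
  have "(1 - q) * measure env H \<le> 2 * \<epsilon>" if \<epsilon>: "\<epsilon> > 0" for \<epsilon>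
  proof -
    obtain l B where B: "B \<in> sets env" "depends_below l B" "measure env (H - B \<union> (B - H)) < \<epsilon>"
      using finite_depth_approximation[OF H_meas \<epsilon>] by blast
    have "H \<inter> B \<subseteq> {\<omega>\<in>B. \<not> G \<omega> \<and> (\<exists>u. l \<le> length u \<and> at_origin \<omega> u)}"
      unfolding H_def returns_forever_def INFM_nat_le by blast
    moreover have "{\<omega>\<in>B. \<not> G \<omega> \<and> (\<exists>u. l \<le> length u \<and> at_origin \<omega> u)} \<in> sets env"
    proof -
      have "Measurable.pred env (\<lambda>\<omega>. \<exists>u. l \<le> length u \<and> at_origin \<omega> u)"
        by (intro pred_intros_logic pred_intros_countable sets_at_origin) simp
      then have "{\<omega>. \<exists>u. l \<le> length u \<and> at_origin \<omega> u} \<in> sets env" by (simp add: pred_def)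
      then have "B \<inter> ({\<omega>. \<not> G \<omega>} \<inter> {\<omega>. \<exists>u. l \<le> length u \<and> at_origin \<omega> u}) \<in> sets env"
        using B(1) G_meas by (intro sets.Int)
      moreover have "B \<inter> ({\<omega>. \<not> G \<omega>} \<inter> {\<omega>. \<exists>u. l \<le> length u \<and> at_origin \<omega> u})
          = {\<omega>\<in>B. \<not> G \<omega> \<and> (\<exists>u. l \<le> length u \<and> at_origin \<omega> u)}" by blast
      ultimately show ?thesis by simp
    qed
    ultimately have 1: "measure env (H \<inter> B) \<le> q * measure env B"
      using env.finite_measure_mono first_visit_bound[OF G B(1,2)] unfolding q_def by (meson order_trans)
    have 2: "measure env H \<le> measure env (H \<inter> B) + \<epsilon>"
    proof -
      have "measure env H \<le> measure env ((H \<inter> B) \<union> (H - B \<union> (B - H)))"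
        using H_meas B(1) by (intro env.finite_measure_mono) auto
      also have "\<dots> \<le> measure env (H \<inter> B) + measure env (H - B \<union> (B - H))"
        using H_meas B(1) by (intro measure_Un_le) auto
      finally show ?thesis using B(3) by simp
    qed
    have 3: "measure env B \<le> measure env H + \<epsilon>"
    proof -
      have "measure env B \<le> measure env (H \<union> (H - B \<union> (B - H)))"
        using H_meas B(1) by (intro env.finite_measure_mono) auto
      also have "\<dots> \<le> measure env H + measure env (H - B \<union> (B - H))"
        using H_meas B(1) by (intro measure_Un_le) auto
      finally show ?thesis using B(3) by simp
    qed
    have "q * measure env B \<le> q * (measure env H + \<epsilon>)" using 3 q by (rule mult_left_mono)
    moreover have "q * \<epsilon> \<le> 1 * \<epsilon>" using \<open>q < 1\<close> \<epsilon> by (intro mult_right_mono) auto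
    ultimately show ?thesis using 1 2 by (simp add: algebra_simps)
  qed
  then have "(1 - q) * measure env H \<le> 0"
    using field_le_epsilon[of "(1 - q) * measure env H" 0] by (metis add_0 half_gt_zero mult_2 field_sum_of_halves)
  then have "measure env H = 0"
    using \<open>q < 1\<close> measure_nonneg[of env H] by (simp add: mult_le_0_iff)
  then have "AE \<omega> in env. \<omega> \<notin> H"
    using env.prob_eq_0[OF H_meas] by simp
  then show ?thesis by eventually_elim (auto simp: H_def)
qed

end

section \<open>The law of the given process\<close>

lemma prod_relabel:
  fixes f :: "'a \<Rightarrow> real" and g :: "'b \<Rightarrow> real"
  assumes J: "finite U" "h ` S \<subseteq> U" "inj_on h S"
    and f: "\<And>j. j \<in> S \<Longrightarrow> f (h j) = g j" "\<And>u. u \<in> U - h ` S \<Longrightarrow> f u = 1"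
  shows "(\<Prod>u\<in>U. f u) = (\<Prod>j\<in>S. g j)"
proof -
  have "(\<Prod>u\<in>U. f u) = (\<Prod>u\<in>h ` S. f u)"
    using J f(2) by (intro prod.mono_neutral_right) auto
  also have "\<dots> = (\<Prod>j\<in>S. g j)"
    using J f(1) by (subst prod.reindex) auto
  finally show ?thesis .
qed

context cbrw
begin

sublocale catalytic_laws p \<nu> .

definition environment :: "'w \<Rightarrow> nat list \<times> nat \<Rightarrow> int" where
  "environment \<omega> j = (case snd j of 0 \<Rightarrow> int (K (fst j) \<omega>) | Suc i \<Rightarrow> \<xi> (i # fst j) \<omega>)"

lemma offspring_environment: "offspring (environment \<omega>) = (\<lambda>u. K u \<omega>)"
  by (simp add: fun_eq_iff offspring_def environment_def)

lemma pos_environment: "pos (environment \<omega>) u = position (\<lambda>u. \<xi> u \<omega>) u"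
  by (induction u) (simp_all add: environment_def)

lemma lives_environment: "lives (environment \<omega>) u = alive (\<lambda>u. K u \<omega>) (\<lambda>u. \<xi> u \<omega>) u"
  by (induction u) (simp_all add: pos_environment offspring_environment)

lemma measurable_pair: "(\<lambda>\<omega>. (K u \<omega>, \<xi> u \<omega>)) \<in> M \<rightarrow>\<^sub>M count_space UNIV"
  using indep by (simp add: indep_vars_def)

lemma measurable_K: "K u \<in> M \<rightarrow>\<^sub>M count_space UNIV" and measurable_\<xi>: "\<xi> u \<in> M \<rightarrow>\<^sub>M count_space UNIV"
  using measurable_compose[OF measurable_pair, of fst "count_space UNIV" u]
    measurable_compose[OF measurable_pair, of snd "count_space UNIV" u] by simp_all

lemma measurable_environment: "environment \<in> M \<rightarrow>\<^sub>M env"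
proof (rule measurable_into_env)
  fix j :: "nat list \<times> nat"
  show "(\<lambda>\<omega>. environment \<omega> j) \<in> M \<rightarrow>\<^sub>M count_space UNIV"
    using measurable_compose[OF measurable_K, of int "count_space UNIV" "fst j"] measurable_\<xi>
    by (cases "snd j") (simp_all add: environment_def)
qed

lemma prob_pair: "prob ((\<lambda>\<omega>. (K u \<omega>, \<xi> u \<omega>)) -` (A \<times> B) \<inter> space M) = measure \<nu> A * measure p B"
proof -
  have "prob ((\<lambda>\<omega>. (K u \<omega>, \<xi> u \<omega>)) -` (A \<times> B) \<inter> space M)
      = measure (distr M (count_space UNIV) (\<lambda>\<omega>. (K u \<omega>, \<xi> u \<omega>))) (A \<times> B)"
    by (rule measure_distr[symmetric]) (simp_all add: measurable_pair)
  also have "\<dots> = measure (pair_pmf \<nu> p) (A \<times> B)"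
    by (simp add: law)
  also have "\<dots> = measure \<nu> A * measure p B"
  proof -
    have "emeasure (pair_pmf \<nu> p) (A \<times> B) = (\<integral>\<^sup>+z. indicator (A \<times> B) z \<partial>pair_pmf \<nu> p)"
      by simp
    also have "\<dots> = (\<integral>\<^sup>+k. \<integral>\<^sup>+x. indicator A k * indicator B x \<partial>p \<partial>\<nu>)"
      unfolding nn_integral_pair_pmf' by (intro nn_integral_cong) (simp add: indicator_times)
    also have "\<dots> = emeasure \<nu> A * emeasure p B"
      by (simp add: nn_integral_cmult nn_integral_multc)
    finally show ?thesis
      by (simp add: measure_pmf.emeasure_eq_measure ennreal_mult[symmetric])
  qed
  finally show ?thesis .
qed

text \<open>The law is checked on finite cylinders. The conditions on the coordinates are regrouped by the
  label that they concern: \<open>A u\<close> collects the one on \<open>K u\<close>, and \<open>B u\<close> the one on \<open>\<xi> u\<close>, which is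
  stored at the parent of \<open>u\<close>.\<close>

lemma distr_environment: "distr M env environment = env"
proof -
  interpret P: product_prob_space "\<lambda>j. measure_pmf (coord_law j)" UNIV
    by standard
  have "distr M env environment = PiM UNIV (\<lambda>j. measure_pmf (coord_law j))"
  proof (rule P.PiM_eq)
    show "sets (distr M env environment) = sets (PiM UNIV (\<lambda>j. measure_pmf (coord_law j)))"
      by (simp add: env_def)
    fix J :: "(nat list \<times> nat) set" and F :: "nat list \<times> nat \<Rightarrow> int set"
    assume J: "finite J"
    define child where "child j = (snd j - 1) # fst j" for j :: "nat list \<times> nat"
    define J0 where "J0 = {j\<in>J. snd j = 0}"
    define J1 where "J1 = {j\<in>J. snd j \<noteq> 0}"
    \<comment> \<open>the root is added to make the index set of the intersection nonempty\<close>
    define U where "U = insert [] (fst ` J0 \<union> child ` J1)"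
    define A where "A u = (if (u, 0) \<in> J then int -` F (u, 0) else UNIV)" for u
    define B where "B u = (case u of [] \<Rightarrow> UNIV | i # v \<Rightarrow> if (v, Suc i) \<in> J then F (v, Suc i) else UNIV)" for u
    have fin: "finite J0" "finite J1" "finite U" using J by (simp_all add: J0_def J1_def U_def)
    have J_split: "J = J0 \<union> J1" "J0 \<inter> J1 = {}" by (auto simp: J0_def J1_def)
    let ?X = "\<lambda>u \<omega>. (K u \<omega>, \<xi> u \<omega>)"
    have "environment -` prod_emb UNIV (\<lambda>j. measure_pmf (coord_law j)) J (Pi\<^sub>E J F) \<inter> space M
        = (\<Inter>u\<in>U. ?X u -` (A u \<times> B u) \<inter> space M)"
    proof -
      have "(\<forall>j\<in>J. environment \<omega> j \<in> F j) \<longleftrightarrow> (\<forall>u\<in>U. K u \<omega> \<in> A u \<and> \<xi> u \<omega> \<in> B u)" for \<omega>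
      proof
        assume *: "\<forall>j\<in>J. environment \<omega> j \<in> F j"
        show "\<forall>u\<in>U. K u \<omega> \<in> A u \<and> \<xi> u \<omega> \<in> B u"
        proof (intro ballI conjI)
          fix u
          show "K u \<omega> \<in> A u"
            using *[rule_format, of "(u, 0)"] by (auto simp: A_def environment_def)
          show "\<xi> u \<omega> \<in> B u"
          proof (cases u)
            case (Cons i v)
            then show ?thesis
              using *[rule_format, of "(v, Suc i)"] by (auto simp: B_def environment_def)
          qed (simp add: B_def)
        qed
      next
        assume *: "\<forall>u\<in>U. K u \<omega> \<in> A u \<and> \<xi> u \<omega> \<in> B u"
        show "\<forall>j\<in>J. environment \<omega> j \<in> F j"
        proof
          fix j assume j: "j \<in> J"
          obtain v i where vi: "j = (v, i)" by fastforce
          show "environment \<omega> j \<in> F j"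
          proof (cases i)
            case 0
            then have "v \<in> U" using j vi by (force simp: U_def J0_def)
            then have "K v \<omega> \<in> A v" using * by blast
            then show ?thesis using j vi 0 by (simp add: A_def environment_def)
          next
            case (Suc k)
            then have "k # v \<in> U" using j vi by (force simp: U_def J1_def child_def)
            then have "\<xi> (k # v) \<omega> \<in> B (k # v)" using * by blast
            then show ?thesis using j vi Suc by (simp add: B_def environment_def)
          qed
        qed
      qed
      moreover have "environment -` prod_emb UNIV (\<lambda>j. measure_pmf (coord_law j)) J (Pi\<^sub>E J F) \<inter> space M
          = {\<omega>\<in>space M. \<forall>j\<in>J. environment \<omega> j \<in> F j}"
        by (auto simp: prod_emb_def space_PiM PiE_iff)
      moreover have "[] \<in> U" by (simp add: U_def)
      then have "(\<Inter>u\<in>U. ?X u -` (A u \<times> B u) \<inter> space M) = {\<omega>\<in>space M. \<forall>u\<in>U. K u \<omega> \<in> A u \<and> \<xi> u \<omega> \<in> B u}"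
        by auto
      ultimately show ?thesis by simp
    qed
    then have "emeasure (distr M env environment) (prod_emb UNIV (\<lambda>j. measure_pmf (coord_law j)) J (Pi\<^sub>E J F))
        = emeasure M (\<Inter>u\<in>U. ?X u -` (A u \<times> B u) \<inter> space M)"
      using J by (subst emeasure_distr[OF measurable_environment]) (auto simp: env_def intro!: sets_PiM_I)
    also have "\<dots> = ennreal (\<Prod>u\<in>U. measure \<nu> (A u) * measure p (B u))"
      using indep_varsD[OF indep, of U "\<lambda>u. A u \<times> B u"] fin
      by (simp add: emeasure_eq_measure prob_pair U_def)
    also have "(\<Prod>u\<in>U. measure \<nu> (A u) * measure p (B u))
        = (\<Prod>j\<in>J0. measure (coord_law j) (F j)) * (\<Prod>j\<in>J1. measure (coord_law j) (F j))"
    proof -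
      have "(\<Prod>u\<in>U. measure \<nu> (A u)) = (\<Prod>j\<in>J0. measure (coord_law j) (F j))"
        by (rule prod_relabel[where h = fst])
          (use J fin in \<open>auto simp: U_def J0_def A_def coord_law_def inj_on_def measure_pmf.prob_space[simplified] image_iff\<close>)
      moreover have "(\<Prod>u\<in>U. measure p (B u)) = (\<Prod>j\<in>J1. measure (coord_law j) (F j))"
      proof (rule prod_relabel[where h = child])
        fix u assume u: "u \<in> U - child ` J1"
        show "measure p (B u) = 1"
        proof (cases u)
          case (Cons i v)
          have "(v, Suc i) \<notin> J1"
            using u Cons by (auto simp: child_def image_iff)
          then show ?thesis
            by (simp add: Cons B_def J1_def measure_pmf.prob_space[simplified])
        qed (simp add: B_def measure_pmf.prob_space[simplified])
      qed (use J fin in \<open>auto simp: U_def J1_def child_def B_def coord_law_def inj_on_def\<close>)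
      ultimately show ?thesis by (simp add: prod.distrib)
    qed
    also have "\<dots> = (\<Prod>j\<in>J. measure (coord_law j) (F j))"
      using fin J_split by (simp add: prod.union_disjoint)
    also have "ennreal \<dots> = (\<Prod>j\<in>J. emeasure (coord_law j) (F j))"
      by (simp add: prod_ennreal measure_pmf.emeasure_eq_measure)
    finally show "emeasure (distr M env environment) (prod_emb UNIV (\<lambda>j. measure_pmf (coord_law j)) J (Pi\<^sub>E J F))
        = (\<Prod>j\<in>J. emeasure (measure_pmf (coord_law j)) (F j))" .
  qed
  then show ?thesis by (simp add: env_def)
qed

lemma AE_environment:
  assumes "AE \<omega> in env. P \<omega>"
  shows "AE \<omega> in M. P (environment \<omega>)"
proof (rule AE_distrD[OF measurable_environment])
  show "AE \<omega> in distr M env environment. P \<omega>"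
    unfolding distr_environment by (rule assms)
qed

end

section \<open>The speed of the maximal position\<close>

lemma tendsto_max_position:
  fixes \<alpha> :: real
  assumes upper: "\<And>k. \<forall>\<^sub>F n in sequentially. \<forall>u\<in>particles K \<xi> n. real_of_int (position \<xi> u) < (\<alpha> + 1 / real (Suc k)) * real n"
    and lower: "\<And>k. \<exists>C::nat. \<forall>n\<ge>C. \<exists>u\<in>particles K \<xi> n. (\<alpha> - \<alpha> / real (Suc (Suc k))) * real n - real C \<le> real_of_int (position \<xi> u)"
    and "\<alpha> > 0"
  shows "(\<lambda>n. max_position K \<xi> n / ereal (real n)) \<longlonglongrightarrow> ereal \<alpha>"
proof (rule order_tendstoI)
  fix l assume "l < ereal \<alpha>"
  then obtain y where y: "l < ereal y" "y < \<alpha>"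
    using ereal_dense2 by (metis ereal_less_eq(3) less_ereal.simps(1))
  have "((\<lambda>k. \<alpha> - \<alpha> / real (Suc (Suc k))) \<longlongrightarrow> \<alpha> - 0) sequentially"
    by real_asymp
  then have "\<forall>\<^sub>F k in sequentially. y < \<alpha> - \<alpha> / real (Suc (Suc k))"
    using y by (intro order_tendstoD) auto
  then obtain k where k: "y < \<alpha> - \<alpha> / real (Suc (Suc k))"
    by (auto simp: eventually_sequentially)
  define x where "x = \<alpha> - \<alpha> / real (Suc (Suc k))"
  obtain C :: nat where C: "\<And>n. n \<ge> C \<Longrightarrow> \<exists>u\<in>particles K \<xi> n. x * real n - real C \<le> real_of_int (position \<xi> u)"
    using lower[of k] unfolding x_def by blast
  have "((\<lambda>n. x - real C / real n) \<longlongrightarrow> x - 0) sequentially"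
    by real_asymp
  then have "\<forall>\<^sub>F n in sequentially. y < x - real C / real n"
    using k by (intro order_tendstoD) (auto simp: x_def)
  then show "\<forall>\<^sub>F n in sequentially. l < max_position K \<xi> n / ereal (real n)"
    using eventually_ge_at_top[of C] eventually_gt_at_top[of 0]
  proof eventually_elim
    case (elim n)
    obtain u where u: "u \<in> particles K \<xi> n" "x * real n - real C \<le> real_of_int (position \<xi> u)"
      using C elim(2) by blast
    have "l < ereal y" by (rule y)
    also have "ereal y \<le> ereal ((x * real n - real C) / real n)"
      using elim by (simp add: diff_divide_distrib)
    also have "\<dots> = ereal (x * real n - real C) / ereal (real n)"
      using elim by simp
    also have "\<dots> \<le> max_position K \<xi> n / ereal (real n)"
    proof (rule ereal_divide_right_mono)
      have "ereal (x * real n - real C) \<le> ereal (real_of_int (position \<xi> u))" using u(2) by simp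
      also have "\<dots> \<le> max_position K \<xi> n"
        unfolding max_position_def using u(1) by (rule SUP_upper)
      finally show "ereal (x * real n - real C) \<le> max_position K \<xi> n" .
    qed (use elim in simp)
    finally show ?case .
  qed
next
  fix z assume "ereal \<alpha> < z"
  then obtain y where y: "ereal y < z" "\<alpha> < y"
    using ereal_dense2 by (metis ereal_less_eq(3) less_ereal.simps(1))
  have "((\<lambda>k. \<alpha> + 1 / real (Suc k)) \<longlongrightarrow> \<alpha> + 0) sequentially"
    by real_asymp
  then have "\<forall>\<^sub>F k in sequentially. \<alpha> + 1 / real (Suc k) < y"
    using y by (intro order_tendstoD) auto
  then obtain k where k: "\<alpha> + 1 / real (Suc k) < y"
    by (auto simp: eventually_sequentially)
  from upper[of k] show "\<forall>\<^sub>F n in sequentially. max_position K \<xi> n / ereal (real n) < z"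
    using eventually_gt_at_top[of 0]
  proof eventually_elim
    case (elim n)
    have "max_position K \<xi> n / ereal (real n) \<le> ereal ((\<alpha> + 1 / real (Suc k)) * real n) / ereal (real n)"
    proof (rule ereal_divide_right_mono)
      show "max_position K \<xi> n \<le> ereal ((\<alpha> + 1 / real (Suc k)) * real n)"
        unfolding max_position_def using elim(1) by (intro SUP_least) (simp add: less_imp_le)
    qed (use elim in simp)
    also have "\<dots> = ereal (\<alpha> + 1 / real (Suc k))" using elim by simp
    also have "\<dots> < ereal y" using k by simp
    also have "\<dots> < z" by (rule y)
    finally show ?case .
  qed
qed

theorem theorem1p1:
  fixes M :: "'w measure" and p :: "int pmf" and \<nu> :: "nat pmf"
    and K :: "nat list \<Rightarrow> 'w \<Rightarrow> nat" and \<xi> :: "nat list \<Rightarrow> 'w \<Rightarrow> int"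
    and m r t\<^sub>0 :: real
  assumes cbrw: "cbrw M p \<nu> K \<xi>"
    and irreducible: "irreducible_walk p"
    and finite_mean: "integrable (measure_pmf \<nu>) real"
    and m_def: "m = measure_pmf.expectation \<nu> real"
    and supercritical: "m * (1 - q_esc p) > 1"
    and r_pos: "r > 0"
    and r_eq: "m * return_laplace p r = 1"
    and zeta_pos: "zeta p > 0"
    and t0_pos: "t\<^sub>0 > 0"
    and t0_less: "ereal t\<^sub>0 < zeta p"
    and psi_t0: "psi p t\<^sub>0 = ereal r"
  shows "AE \<omega> in M. origin_recurrent (\<lambda>u. K u \<omega>) (\<lambda>u. \<xi> u \<omega>) \<longrightarrow>
           (\<lambda>n. max_position (\<lambda>u. K u \<omega>) (\<lambda>u. \<xi> u \<omega>) n / ereal (real n))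
             \<longlonglongrightarrow> psi p t\<^sub>0 / ereal t\<^sub>0"
proof -
  interpret cbrw M p \<nu> K \<xi> by (rule cbrw)
  have m_pos: "m > 0"
  proof -
    have "0 \<le> m" unfolding m_def by (intro integral_nonneg_AE) simp
    then show ?thesis using r_eq by (cases "m = 0") auto
  qed
  have mean: "mean_children = ennreal m"
  proof -
    have "mean_children = (\<integral>\<^sup>+k. ennreal (real k) \<partial>measure_pmf \<nu>)"
      unfolding mean_children_def by (intro nn_integral_cong) (simp add: ennreal_of_nat_eq_real_of_nat)
    then show ?thesis
      using nn_integral_eq_integral[OF finite_mean] by (simp add: m_def)
  qed
  have malthus: "ennreal m * (ennreal (exp (- r)) * shift_mean (hit_laplace r) 0) = 1"
  proof -
    have "return_laplace p r \<noteq> 0" using r_eq by auto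
    then have int: "integrable (steps p) (\<lambda>\<xi>. exp_discount r (return_time (walk 0 \<xi>)))"
      unfolding return_laplace_def using not_integrable_integral_eq by blast
    have nonneg: "0 \<le> exp_discount r t" for t
      by (simp add: exp_discount_def split: enat.split)
    have "ennreal (return_laplace p r) = ennreal (exp (- r)) * shift_mean (hit_laplace r) 0"
      unfolding return_laplace_def nn_return_laplace[symmetric]
      by (rule nn_integral_eq_integral[OF int, symmetric]) (simp add: nonneg)
    moreover have "ennreal m * ennreal (return_laplace p r) = ennreal (m * return_laplace p r)"
      using m_pos by (intro ennreal_mult'[symmetric]) simp
    ultimately show ?thesis
      by (simp add: r_eq)
  qed
  have mom_r: "exp_moment p t\<^sub>0 = ennreal (exp r)"
  proof -
    have fin: "exp_moment p t\<^sub>0 \<noteq> \<infinity>" and ln: "ln (enn2real (exp_moment p t\<^sub>0)) = r"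
      using psi_t0 by (auto simp: psi_def split: if_splits)
    have "enn2real (exp_moment p t\<^sub>0) \<noteq> 0"
      using ln r_pos by auto
    then have "enn2real (exp_moment p t\<^sub>0) > 0"
      using le_neq_trans[OF enn2real_nonneg] by metis
    then have "enn2real (exp_moment p t\<^sub>0) = exp r" using ln by (metis exp_ln)
    then show ?thesis using fin by (metis ennreal_enn2real infinity_ennreal_def top.not_eq_extremum)
  qed
  obtain t1 where t1: "t\<^sub>0 < t1" "exp_moment p t1 < \<infinity>"
  proof -
    obtain t where "psi p t < \<infinity>" "ereal t\<^sub>0 < ereal t"
      using t0_less unfolding zeta_def less_Sup_iff by auto
    then show ?thesis by (intro that[of t]) (auto simp: psi_def less_top split: if_splits)
  qed
  interpret walk: catalytic_walk p \<nu> m r t\<^sub>0 t1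
    using m_pos mean malthus r_pos t0_pos t1 mom_r by unfold_locales (simp_all add: exp_moment_eq)
  define \<alpha> where "\<alpha> = r / t\<^sub>0"
  have \<alpha>: "\<alpha> > 0" using r_pos t0_pos by (simp add: \<alpha>_def)
  have "AE \<omega> in env. \<forall>k. \<forall>\<^sub>F n in sequentially. \<not> reaches n ((\<alpha> + 1 / real (Suc k)) * real n) \<omega>"
    unfolding AE_all_countable by (intro allI walk.AE_speed_le) (simp add: \<alpha>_def)
  then have upper: "AE \<omega> in M. \<forall>k. \<forall>\<^sub>F n in sequentially. 
      \<not> reaches n ((\<alpha> + 1 / real (Suc k)) * real n) (environment \<omega>)"
    by (rule AE_environment)
  have "AE \<omega> in env. \<forall>k. returns_forever \<omega> \<longrightarrow> fast (\<alpha> - \<alpha> / real (Suc (Suc k))) \<omega>"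
    unfolding AE_all_countable
  proof
    fix k
    have "0 < \<alpha> - \<alpha> / real (Suc (Suc k))" "\<alpha> - \<alpha> / real (Suc (Suc k)) < \<alpha>"
        using \<alpha> by (simp_all add: field_simps add_pos_nonneg)
    then show "AE \<omega> in env. returns_forever \<omega> \<longrightarrow> fast (\<alpha> - \<alpha> / real (Suc (Suc k))) \<omega>"
      unfolding \<alpha>_def by (intro recurrent_zero_one sets_fast walk.fast_positive) (auto intro: fast_append)
  qed
  then have lower: "AE \<omega> in M. \<forall>k. returns_forever (environment \<omega>) \<longrightarrow> fast (\<alpha> - \<alpha> / real (Suc (Suc k))) (environment \<omega>)"
    by (rule AE_environment)
  have limit: "psi p t\<^sub>0 / ereal t\<^sub>0 = ereal \<alpha>"
    using psi_t0 t0_pos by (simp add: \<alpha>_def)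
  from upper lower show ?thesis
  proof eventually_elim
    case (elim \<omega>)
    show ?case
      unfolding limit
    proof
      assume "origin_recurrent (\<lambda>u. K u \<omega>) (\<lambda>u. \<xi> u \<omega>)"
      then have "returns_forever (environment \<omega>)"
        by (simp add: origin_recurrent_def returns_forever_def particles_def at_origin_def
            lives_environment pos_environment Bex_def conj_assoc)
      then have fast: "fast (\<alpha> - \<alpha> / real (Suc (Suc k))) (environment \<omega>)" for k
        using elim(2) by blast
      show "(\<lambda>n. max_position (\<lambda>u. K u \<omega>) (\<lambda>u. \<xi> u \<omega>) n / ereal (real n)) \<longlonglongrightarrow> ereal \<alpha>"
      proof (rule tendsto_max_position)
        fix k
        show "\<forall>\<^sub>F n in sequentially. \<forall>u\<in>particles (\<lambda>u. K u \<omega>) (\<lambda>u. \<xi> u \<omega>) n.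
            real_of_int (position (\<lambda>u. \<xi> u \<omega>) u) < (\<alpha> + 1 / real (Suc k)) * real n"
          using elim(1)[rule_format, of k]
          by eventually_elim (auto simp: reaches_def particles_def lives_environment pos_environment not_le)
        show "\<exists>C::nat. \<forall>n\<ge>C. \<exists>u\<in>particles (\<lambda>u. K u \<omega>) (\<lambda>u. \<xi> u \<omega>) n.
            (\<alpha> - \<alpha> / real (Suc (Suc k))) * real n - real C \<le> real_of_int (position (\<lambda>u. \<xi> u \<omega>) u)"
          using fast[of k]
          by (simp add: fast_def reaches_def particles_def lives_environment pos_environment Bex_def conj_assoc)
      qed (rule \<alpha>)
    qed
  qed
qed

end
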